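(* Let $(\boldsymbol u,\boldsymbol B,P,T)$ be a smooth solution of the Taylor model (see context), and suppose that the magnetic flux is exact. Suppose that at some instant of time the magnetic field is nontrivial and dynamo action occurs, i.e. $\frac{\mathrm d}{\mathrm dt}\left(\frac12\int_V|\boldsymbol B|^2\,\mathrm dV\right)\ge 0$. Then at that instant the Archimedean part $\boldsymbol u^{\mathrm A}$ of the velocity satisfies, for every $3\le p\le\infty$, $$ A_p\,\|\boldsymbol u^{\mathrm A}\|_{L^p}\ \ge\ \frac1{Rm}. $$
   Context: Domain: $V=[0,L_x]\times[0,L_y]\times[0,1]$ with $L_x,L_y>0$; all fields are periodic in $x$ and $y$. $S_-=\{z=0\}$, $S_+=\{z=1\}$, $\boldsymbol n_\pm=\pm\boldsymbol e_z$. $L^p$ norms are over $V$. Taylor model (inviscid, inertialess), with positive parameters $\Lambda, Ra, Rm$: unknown velocity $\boldsymbol u$, magnetic field $\boldsymbol B$, pressure $P$, temperature $T$, satisfying $$\boldsymbol e_z\times\boldsymbol u+\nabla P=\Lambda(\nabla\times\boldsymbol B)\times\boldsymbol B+Ra\,T\boldsymbol e_z,\quad \nabla\cdot\boldsymbol u=0,\quad \partial_t\boldsymbol B-\nabla\times(\boldsymbol u\times\boldsymbol B)=\tfrac1{Rm}\nabla^2\boldsymbol B,\quad \nabla\cdot\boldsymbol B=0,$$ with boundary conditions $\boldsymbol u\cdot\boldsymbol n_\pm=0$ and $\boldsymbol B\times\boldsymbol n_\pm=0$ (ferromagnetic) on $S_\pm$. No evolution equation for $T$ is assumed; $T$ is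 a smooth function, periodic in $x,y$. Magnetic flux is exact if $\int_{S_\pm}\boldsymbol n_\pm\cdot\boldsymbol B\,\mathrm dS_\pm=0$. Archimedean part: $\boldsymbol u^{\mathrm A}$ is the divergence-free field, tangent to $\partial V$ and vanishing at $z=0$, that solves $\frac1{Ra}(\boldsymbol e_z\times\boldsymbol u^{\mathrm A}+\nabla P^{\mathrm A})=T\boldsymbol e_z$ for some pressure $P^{\mathrm A}$; explicitly $\boldsymbol u^{\mathrm A}=Ra\,\boldsymbol e_z\times\nabla\overline T=Ra\,(-\partial_y\overline T,\partial_x\overline T,0)$ with $\overline T(x,y,z)=\int_0^zT(x,y,z')\,\mathrm dz'$. Constants: $\lambda_1=\min\{\pi,2\pi/L_x,2\pi/L_y\}$, $C_{\mathrm P}=1/\lambda_1$, $C_3=\frac{2^{2/3}}{\pi^{2/3}\sqrt3}$, $C_{\mathrm S}=2\sqrt2\,C_3\Big(1+\frac{\sqrt{1+L_x^{-2}+L_y^{-2}}}{\lambda_1}\Big)$, and $A_p=C_{\mathrm P}^{(p-3)/p}C_{\mathrm S}^{3/p}$ for $3\le p\le\infty$ (so $A_3=C_{\mathrm S}$, $A_\infty=C_{\mathrm P}$). *)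

theory Defs
  imports "HOL-Analysis.Analysis" "HOL-Probability.Essential_Supremum"
begin

section \<open>Domain, smoothness, periodicity\<close>

text \<open>Fields that are periodic in the horizontal variables are represented as functions on
  the infinite slab (coordinates 1, 2, 3 are x, y, z); norms and integrals are taken over one
  periodicity cell. Values outside the slab are irrelevant.\<close>

definition slab :: "(real^3) set" where
  "slab = {x. 0 \<le> x $ 3 \<and> x $ 3 \<le> 1}"

definition cell :: "real \<Rightarrow> real \<Rightarrow> (real^3) set" where
  "cell Lx Ly = {x. 0 \<le> x $ 1 \<and> x $ 1 \<le> Lx \<and> 0 \<le> x $ 2 \<and> x $ 2 \<le> Ly \<and> 0 \<le> x $ 3 \<and> x $ 3 \<le> 1}"

definition e\<^sub>z :: "real^3" where
  "e\<^sub>z = axis 3 1"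

text \<open>Smoothness up to the boundary. All derivatives are taken within \<open>S\<close>; they are
  unique when \<open>S\<close> is convex with nonempty interior, which is the only case used.\<close>

primrec Ck_on :: "nat \<Rightarrow> 'a::real_normed_vector set \<Rightarrow> ('a \<Rightarrow> 'b::real_normed_vector) \<Rightarrow> bool" where
  "Ck_on 0 S f \<longleftrightarrow> continuous_on S f"
| "Ck_on (Suc k) S f \<longleftrightarrow>
     (\<exists>f'. (\<forall>x\<in>S. (f has_derivative f' x) (at x within S)) \<and> (\<forall>v. Ck_on k S (\<lambda>x. f' x v)))"

definition Cinf_on :: "'a::real_normed_vector set \<Rightarrow> ('a \<Rightarrow> 'b::real_normed_vector) \<Rightarrow> bool" where
  "Cinf_on S f \<longleftrightarrow> (\<forall>k. Ck_on k S f)"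

definition periodic_xy :: "real \<Rightarrow> real \<Rightarrow> (real^3 \<Rightarrow> 'a) \<Rightarrow> bool" where
  "periodic_xy Lx Ly f \<longleftrightarrow>
     (\<forall>x\<in>slab. f (x + Lx *\<^sub>R axis 1 1) = f x \<and> f (x + Ly *\<^sub>R axis 2 1) = f x)"

section \<open>Differential operators\<close>

definition partial :: "3 \<Rightarrow> (real^3 \<Rightarrow> 'a::real_normed_vector) \<Rightarrow> real^3 \<Rightarrow> 'a" where
  "partial i f x = vector_derivative (\<lambda>s. f (x + s *\<^sub>R axis i 1)) (at 0)"

definition gradient :: "(real^3 \<Rightarrow> real) \<Rightarrow> real^3 \<Rightarrow> real^3" where
  "gradient f x = (\<chi> i. partial i f x)"

definition divergence :: "(real^3 \<Rightarrow> real^3) \<Rightarrow> real^3 \<Rightarrow> real" where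
  "divergence F x = (\<Sum>i\<in>UNIV. partial i (\<lambda>y. F y $ i) x)"

definition curl :: "(real^3 \<Rightarrow> real^3) \<Rightarrow> real^3 \<Rightarrow> real^3" where
  "curl F x = vector
    [partial 2 (\<lambda>y. F y $ 3) x - partial 3 (\<lambda>y. F y $ 2) x,
     partial 3 (\<lambda>y. F y $ 1) x - partial 1 (\<lambda>y. F y $ 3) x,
     partial 1 (\<lambda>y. F y $ 2) x - partial 2 (\<lambda>y. F y $ 1) x]"

definition laplacian :: "(real^3 \<Rightarrow> real^3) \<Rightarrow> real^3 \<Rightarrow> real^3" where
  "laplacian F x = (\<Sum>i\<in>UNIV. partial i (partial i F) x)"

section \<open>The Taylor model\<close>

text \<open>\<open>I\<close> is the time interval of existence; it may or may not contain its end points,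
  where time derivatives are one-sided. The bulk equations are imposed in the open slab,
  where the two-sided derivatives in \<open>partial\<close> do not leave the domain.\<close>

definition taylor_solution ::
  "real \<Rightarrow> real \<Rightarrow> real \<Rightarrow> real \<Rightarrow> real \<Rightarrow> real set \<Rightarrow> (real \<Rightarrow> real^3 \<Rightarrow> real^3) \<Rightarrow>
   (real \<Rightarrow> real^3 \<Rightarrow> real^3) \<Rightarrow> (real \<Rightarrow> real^3 \<Rightarrow> real) \<Rightarrow> (real \<Rightarrow> real^3 \<Rightarrow> real) \<Rightarrow> bool" where
  "taylor_solution Lx Ly \<Lambda> Ra Rm I u B P T \<longleftrightarrow>
     Cinf_on (I \<times> slab) (\<lambda>(t, x). u t x) \<and>
     Cinf_on (I \<times> slab) (\<lambda>(t, x). B t x) \<and>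
     Cinf_on (I \<times> slab) (\<lambda>(t, x). P t x) \<and>
     Cinf_on (I \<times> slab) (\<lambda>(t, x). T t x) \<and>
     (\<forall>t\<in>I. periodic_xy Lx Ly (u t) \<and> periodic_xy Lx Ly (B t) \<and>
             periodic_xy Lx Ly (P t) \<and> periodic_xy Lx Ly (T t)) \<and>
     (\<forall>t\<in>I. \<forall>x. 0 < x $ 3 \<and> x $ 3 < 1 \<longrightarrow>
        cross3 e\<^sub>z (u t x) + gradient (P t) x
          = \<Lambda> *\<^sub>R cross3 (curl (B t) x) (B t x) + (Ra * T t x) *\<^sub>R e\<^sub>z \<and>
        divergence (u t) x = 0 \<and>
        vector_derivative (\<lambda>s. B s x) (at t within I) - curl (\<lambda>y. cross3 (u t y) (B t y)) x
          = (1 / Rm) *\<^sub>R laplacian (B t) x \<and>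
        divergence (B t) x = 0) \<and>
     (\<forall>t\<in>I. \<forall>x. x $ 3 = 0 \<longrightarrow> u t x \<bullet> (- e\<^sub>z) = 0 \<and> cross3 (B t x) (- e\<^sub>z) = 0) \<and>
     (\<forall>t\<in>I. \<forall>x. x $ 3 = 1 \<longrightarrow> u t x \<bullet> e\<^sub>z = 0 \<and> cross3 (B t x) e\<^sub>z = 0)"

definition exact_flux :: "real \<Rightarrow> real \<Rightarrow> (real^3 \<Rightarrow> real^3) \<Rightarrow> bool" where
  "exact_flux Lx Ly B \<longleftrightarrow>
     integral\<^sup>L (lebesgue_on ({0..Lx} \<times> {0..Ly})) (\<lambda>(x, y). (- e\<^sub>z) \<bullet> B (vector [x, y, 0])) = 0 \<and>
     integral\<^sup>L (lebesgue_on ({0..Lx} \<times> {0..Ly})) (\<lambda>(x, y). e\<^sub>z \<bullet> B (vector [x, y, 1])) = 0"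

definition magnetic_energy :: "real \<Rightarrow> real \<Rightarrow> (real^3 \<Rightarrow> real^3) \<Rightarrow> real" where
  "magnetic_energy Lx Ly B = 1/2 * integral\<^sup>L (lebesgue_on (cell Lx Ly)) (\<lambda>x. (norm (B x))\<^sup>2)"

section \<open>Archimedean part of the velocity\<close>

definition vertical_primitive :: "(real^3 \<Rightarrow> real) \<Rightarrow> real^3 \<Rightarrow> real" where
  "vertical_primitive T x = integral {0..x $ 3} (\<lambda>z. T (vector [x $ 1, x $ 2, z]))"

definition archimedean_part :: "real \<Rightarrow> (real^3 \<Rightarrow> real) \<Rightarrow> real^3 \<Rightarrow> real^3" where
  "archimedean_part Ra T x = Ra *\<^sub>R vector
     [- partial 2 (vertical_primitive T) x, partial 1 (vertical_primitive T) x, 0]"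


text \<open>The explicit formula above satisfies the defining equations of the Archimedean part: it
  is divergence-free, tangent to the boundary, vanishes at the bottom, and solves
  \<open>(1/Ra) (e\<^sub>z \<times> u + \<nabla>P) = T e\<^sub>z\<close> with \<open>P = Ra * vertical_primitive T\<close>.\<close>

lemma partial_eq_within_slab:
  assumes d: "(f has_derivative D) (at x within slab)" and x: "x \<in> slab" and i: "i \<noteq> 3"
  shows "((\<lambda>s. f (x + s *\<^sub>R axis i 1)) has_vector_derivative D (axis i 1)) (at 0)"
proof -
  have "x + s *\<^sub>R axis i 1 \<in> slab" for s
    using x i by (auto simp: slab_def axis_def)
  hence "range (\<lambda>s. x + s *\<^sub>R axis i 1) \<subseteq> slab" by auto
  hence 1: "(f has_derivative D) (at (x + 0 *\<^sub>R axis i 1) within range (\<lambda>s. x + s *\<^sub>R axis i 1))"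
    using has_derivative_subset[OF d] by simp
  have 2: "((\<lambda>s. x + s *\<^sub>R axis i 1) has_derivative (\<lambda>s. s *\<^sub>R axis i 1)) (at 0)"
    by (auto intro!: derivative_eq_intros)
  have "((\<lambda>s. f (x + s *\<^sub>R axis i 1)) has_derivative (\<lambda>s. D (s *\<^sub>R axis i 1))) (at 0)"
    using diff_chain_within[OF 2 1] by (simp add: o_def)
  moreover have "linear D" using d has_derivative_linear by blast
  ultimately show ?thesis
    by (simp add: has_vector_derivative_def linear_scale)
qed

lemma mixed_partials_commute:
  fixes h h1 h2 h12 h21 :: "real \<Rightarrow> real \<Rightarrow> real"
  assumes d1: "\<And>a b. ((\<lambda>a. h a b) has_vector_derivative h1 a b) (at a)"
    and d2: "\<And>a b. ((\<lambda>b. h a b) has_vector_derivative h2 a b) (at b)"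
    and d12: "\<And>a b. ((\<lambda>b. h1 a b) has_vector_derivative h12 a b) (at b)"
    and d21: "\<And>a b. ((\<lambda>a. h2 a b) has_vector_derivative h21 a b) (at a)"
    and c21: "continuous_on UNIV (\<lambda>(a, b). h21 a b)"
    and c2: "\<And>a. continuous_on UNIV (h2 a)"
  shows "h12 a b = h21 a b"
proof -
  define c where "c = b - 1"
  have h: "h a y - h a c = integral (cbox c y) (h2 a)" if "c \<le> y" for a y
  proof -
    have "(h2 a has_integral (h a y - h a c)) {c..y}"
      using that d2 by (intro fundamental_theorem_of_calculus) (auto intro: has_vector_derivative_at_within)
    thus ?thesis by (metis cbox_interval integral_unique)
  qed
  have h1: "h1 a y - h1 a c = integral (cbox c y) (h21 a)" if "c \<le> y" for y
  proof -
    have "((\<lambda>a. integral (cbox c y) (h2 a)) has_vector_derivative integral (cbox c y) (h21 a)) (at a within UNIV)"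
    proof (rule leibniz_rule_vector_derivative)
      show "continuous_on (UNIV \<times> cbox c y) (\<lambda>(x, t). h21 x t)"
        using c21 continuous_on_subset by blast
      show "h2 x integrable_on cbox c y" for x
        using c2 continuous_on_subset integrable_continuous by blast
    qed (use d21 in auto)
    moreover have "((\<lambda>a. h a y - h a c) has_vector_derivative (h1 a y - h1 a c)) (at a)"
      by (intro has_vector_derivative_diff d1)
    moreover have "(\<lambda>a. integral (cbox c y) (h2 a)) = (\<lambda>a. h a y - h a c)"
      using h[OF that] by auto
    ultimately show ?thesis
      using vector_derivative_unique_at by fastforce
  qed
  have cont: "continuous_on {c..b + 1} (h21 a)"
  proof -
    have "continuous_on UNIV (\<lambda>b. (\<lambda>(a, b). h21 a b) (a, b))"
      by (rule continuous_on_compose2[OF c21]) (auto intro!: continuous_intros)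
    thus ?thesis using continuous_on_subset by force
  qed
  have I: "((\<lambda>y. integral {c..y} (h21 a)) has_vector_derivative h21 a b) (at b within {c..b + 1})"
    by (rule integral_has_vector_derivative[OF cont]) (auto simp: c_def)
  have "((\<lambda>y. h1 a y - h1 a c) has_vector_derivative h21 a b) (at b within {c..b + 1})"
    by (rule has_vector_derivative_transform[OF _ _ I]) (use h1 in \<open>auto simp: c_def\<close>)
  hence "((\<lambda>y. h1 a y - h1 a c) has_vector_derivative h21 a b) (at b)"
    by (simp add: at_within_Icc_at c_def)
  moreover have "((\<lambda>y. h1 a y - h1 a c) has_vector_derivative h12 a b) (at b)"
    using d12[of a b] by (auto intro!: derivative_eq_intros)
  ultimately show ?thesis
    using vector_derivative_unique_at by blast
qed

lemma partial_vertical_primitive: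
  assumes d: "\<And>x. x \<in> slab \<Longrightarrow> (f has_derivative D x) (at x within slab)"
    and cD: "continuous_on slab (\<lambda>x. D x (axis i 1))" and i: "i \<noteq> 3" and x: "x \<in> slab"
  shows "((\<lambda>s. vertical_primitive f (x + s *\<^sub>R axis i 1)) has_vector_derivative
           vertical_primitive (\<lambda>x. D x (axis i 1)) x) (at 0)" (is ?A)
    and "partial i (vertical_primitive f) x = vertical_primitive (\<lambda>x. D x (axis i 1)) x"
proof -
  define q where "q = (\<lambda>s z. vector [x $ 1 + s * axis i 1 $ 1, x $ 2 + s * axis i 1 $ 2, z] :: real^3)"
  have q_alt: "q s z = x + s *\<^sub>R axis i 1 + (z - x $ 3) *\<^sub>R axis 3 1" for s z
    using i by (simp add: q_def vec_eq_iff forall_3 axis_def)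
  have q_slab: "q s z \<in> slab" if "z \<in> cbox 0 (x $ 3)" for s z
    using that x by (auto simp: slab_def q_def)
  have q_add: "q s z = q s0 z + (s - s0) *\<^sub>R axis i 1" for s s0 z
    by (simp add: q_alt algebra_simps)
  have cf: "continuous_on slab f"
    using d by (meson has_derivative_continuous continuous_on_eq_continuous_within)
  have dq: "((\<lambda>s. f (q s z)) has_vector_derivative D (q s z) (axis i 1)) (at s)"
    if "z \<in> cbox 0 (x $ 3)" for s z
  proof -
    have "((\<lambda>r. f (q s z + r *\<^sub>R axis i 1)) has_vector_derivative D (q s z) (axis i 1)) (at 0)"
      by (intro partial_eq_within_slab d q_slab that i)
    hence "((\<lambda>r. f (q s z + r *\<^sub>R axis i 1)) \<circ> (\<lambda>r. r - s) has_vector_derivative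
             1 *\<^sub>R D (q s z) (axis i 1)) (at s)"
      by (intro vector_diff_chain_at) (auto intro!: derivative_eq_intros)
    moreover have "(\<lambda>r. f (q s z + r *\<^sub>R axis i 1)) \<circ> (\<lambda>r. r - s) = (\<lambda>r. f (q r z))"
      using q_add by (metis comp_def)
    ultimately show ?thesis by simp
  qed
  have "((\<lambda>s. integral (cbox 0 (x $ 3)) (\<lambda>z. f (q s z))) has_vector_derivative
          integral (cbox 0 (x $ 3)) (\<lambda>z. D (q 0 z) (axis i 1))) (at 0 within UNIV)"
  proof (rule leibniz_rule_vector_derivative)
    show "(\<lambda>z. f (q s z)) integrable_on cbox 0 (x $ 3)" for s
      by (intro integrable_continuous continuous_on_compose2[OF cf])
         (use q_slab in \<open>auto simp: q_alt intro!: continuous_intros\<close>)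
    show "continuous_on (UNIV \<times> cbox 0 (x $ 3)) (\<lambda>(s, z). D (q s z) (axis i 1))"
      unfolding case_prod_beta
      by (intro continuous_on_compose2[OF cD])
         (use q_slab in \<open>auto simp: q_alt intro!: continuous_intros\<close>)
  qed (use dq in \<open>auto\<close>)
  moreover have "vertical_primitive f (x + s *\<^sub>R axis i 1) = integral (cbox 0 (x $ 3)) (\<lambda>z. f (q s z))" for s
    using i by (simp add: vertical_primitive_def q_def axis_def)
  moreover have "vertical_primitive (\<lambda>x. D x (axis i 1)) x = integral (cbox 0 (x $ 3)) (\<lambda>z. D (q 0 z) (axis i 1))"
    by (simp add: vertical_primitive_def q_def)
  ultimately show ?A by simp
  thus "partial i (vertical_primitive f) x = vertical_primitive (\<lambda>x. D x (axis i 1)) x"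
    by (simp add: partial_def vector_derivative_at)
qed

lemma Ck_on_imp_continuous_on: "Ck_on k S f \<Longrightarrow> continuous_on S f"
  by (cases k) (auto simp: continuous_on_eq_continuous_within intro: has_derivative_continuous)

lemma archimedean_part_characterization:
  assumes T: "Ck_on 2 slab T" and Ra: "Ra \<noteq> 0" and x: "x \<in> slab"
  shows "divergence (archimedean_part Ra T) x = 0"
    and "archimedean_part Ra T x \<bullet> e\<^sub>z = 0"
    and "x $ 3 = 0 \<Longrightarrow> archimedean_part Ra T x = 0"
    and "0 < x $ 3 \<Longrightarrow> x $ 3 < 1 \<Longrightarrow>
      (1 / Ra) *\<^sub>R (cross3 e\<^sub>z (archimedean_part Ra T x)
                    + gradient (\<lambda>y. Ra * vertical_primitive T y) x) = T x *\<^sub>R e\<^sub>z"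
proof -
  obtain D where D: "\<And>x. x \<in> slab \<Longrightarrow> (T has_derivative D x) (at x within slab)"
    and "\<And>v. Ck_on 1 slab (\<lambda>x. D x v)"
    using T by (auto simp: numeral_2_eq_2)
  hence "\<exists>E. (\<forall>x\<in>slab. ((\<lambda>x. D x v) has_derivative E x) (at x within slab))
           \<and> (\<forall>w. continuous_on slab (\<lambda>x. E x w))" for v
    by fastforce
  then obtain E where E: "\<And>v x. x \<in> slab \<Longrightarrow> ((\<lambda>x. D x v) has_derivative E v x) (at x within slab)"
    and cE: "\<And>v w. continuous_on slab (\<lambda>x. E v x w)"
    by metis
  have cD: "continuous_on slab (\<lambda>x. D x v)" for v
    using E by (meson has_derivative_continuous continuous_on_eq_continuous_within)
  have cT: "continuous_on slab T"
    using T by (rule Ck_on_imp_continuous_on)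
  define e1 e2 where "e1 = (axis 1 1 :: real^3)" and "e2 = (axis 2 1 :: real^3)"

  have mixed: "E e1 x e2 = E e2 x e1" if x: "x \<in> slab" for x
  proof -
    define q where "q = (\<lambda>a b. a *\<^sub>R e1 + b *\<^sub>R e2 + (x $ 3) *\<^sub>R axis 3 1 :: real^3)"
    have q_slab: "q a b \<in> slab" for a b
      using x by (simp add: q_def slab_def e1_def e2_def axis_def)
    have shift: "((\<lambda>r. g (p + (r - s) *\<^sub>R v)) has_vector_derivative d) (at s)"
      if "((\<lambda>r. g (p + r *\<^sub>R v)) has_vector_derivative d) (at 0)"
      for g :: "real^3 \<Rightarrow> real" and p v d s
    proof -
      have "((\<lambda>r. g (p + r *\<^sub>R v)) \<circ> (\<lambda>r. r - s) has_vector_derivative 1 *\<^sub>R d) (at s)"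
        by (intro vector_diff_chain_at) (use that in \<open>auto intro!: derivative_eq_intros\<close>)
      thus ?thesis by (simp add: o_def)
    qed
    have d1: "((\<lambda>a. g (q a b)) has_vector_derivative F (q a b) e1) (at a)"
      if "\<And>x. x \<in> slab \<Longrightarrow> (g has_derivative F x) (at x within slab)" for g :: "real^3 \<Rightarrow> real" and F a b
    proof -
      have "((\<lambda>r. g (q a b + (r - a) *\<^sub>R e1)) has_vector_derivative F (q a b) e1) (at a)"
        unfolding e1_def
        by (rule shift[where g = g, OF partial_eq_within_slab[OF that[OF q_slab] q_slab]]) simp
      moreover have "q a b + (r - a) *\<^sub>R e1 = q r b" for r
        by (simp add: q_def algebra_simps)
      ultimately show ?thesis by simp
    qed
    have d2: "((\<lambda>b. g (q a b)) has_vector_derivative F (q a b) e2) (at b)"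
      if "\<And>x. x \<in> slab \<Longrightarrow> (g has_derivative F x) (at x within slab)" for g :: "real^3 \<Rightarrow> real" and F a b
    proof -
      have "((\<lambda>r. g (q a b + (r - b) *\<^sub>R e2)) has_vector_derivative F (q a b) e2) (at b)"
        unfolding e2_def
        by (rule shift[where g = g, OF partial_eq_within_slab[OF that[OF q_slab] q_slab]]) simp
      moreover have "q a b + (r - b) *\<^sub>R e2 = q a r" for r
        by (simp add: q_def algebra_simps)
      ultimately show ?thesis by simp
    qed
    have "E e1 (q a b) e2 = E e2 (q a b) e1" for a b
    proof (rule mixed_partials_commute[where h = "\<lambda>a b. T (q a b)" and ?h1.0 = "\<lambda>a b. D (q a b) e1"
        and ?h2.0 = "\<lambda>a b. D (q a b) e2" and ?h12.0 = "\<lambda>a b. E e1 (q a b) e2"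
        and ?h21.0 = "\<lambda>a b. E e2 (q a b) e1"])
      show "((\<lambda>a. T (q a b)) has_vector_derivative D (q a b) e1) (at a)" for a b
        by (rule d1[OF D])
      show "((\<lambda>b. T (q a b)) has_vector_derivative D (q a b) e2) (at b)" for a b
        by (rule d2[OF D])
      show "((\<lambda>b. D (q a b) e1) has_vector_derivative E e1 (q a b) e2) (at b)" for a b
        by (rule d2[OF E])
      show "((\<lambda>a. D (q a b) e2) has_vector_derivative E e2 (q a b) e1) (at a)" for a b
        by (rule d1[OF E])
      show "continuous_on UNIV (\<lambda>(a, b). E e2 (q a b) e1)"
        unfolding case_prod_beta
        by (intro continuous_on_compose2[OF cE])
           (use q_slab in \<open>auto simp: q_def intro!: continuous_intros\<close>)
      show "continuous_on UNIV (\<lambda>b. D (q a b) e2)" for a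
        by (intro continuous_on_compose2[OF cD])
           (use q_slab in \<open>auto simp: q_def intro!: continuous_intros\<close>)
    qed
    moreover have "q (x $ 1) (x $ 2) = x"
      by (simp add: q_def e1_def e2_def vec_eq_iff forall_3 axis_def)
    ultimately show ?thesis by metis
  qed

  have line: "x + s *\<^sub>R axis 1 1 \<in> slab" "x + s *\<^sub>R axis 2 1 \<in> slab" for s
    using x by (auto simp: slab_def axis_def)
  have p1: "partial 1 (vertical_primitive T) y = vertical_primitive (\<lambda>x. D x e1) y" if "y \<in> slab" for y
    unfolding e1_def using that by (intro partial_vertical_primitive(2)[OF D cD]) auto
  have p2: "partial 2 (vertical_primitive T) y = vertical_primitive (\<lambda>x. D x e2) y" if "y \<in> slab" for y
    unfolding e2_def using that by (intro partial_vertical_primitive(2)[OF D cD]) auto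
  have "((\<lambda>s. - (Ra * vertical_primitive (\<lambda>x. D x e2) (x + s *\<^sub>R e1))) has_vector_derivative
          - (Ra * vertical_primitive (\<lambda>x. E e2 x e1) x)) (at 0)"
    unfolding e1_def
    by (intro has_vector_derivative_minus has_vector_derivative_mult_right
          partial_vertical_primitive(1)[OF E cE] x) auto
  hence 1: "partial 1 (\<lambda>y. archimedean_part Ra T y $ 1) x
          = - (Ra * vertical_primitive (\<lambda>x. E e2 x e1) x)"
    by (subst partial_def)
       (use line in \<open>simp add: archimedean_part_def p2 e1_def vector_derivative_at\<close>)
  have "((\<lambda>s. Ra * vertical_primitive (\<lambda>x. D x e1) (x + s *\<^sub>R e2)) has_vector_derivative
          Ra * vertical_primitive (\<lambda>x. E e1 x e2) x) (at 0)"
    unfolding e2_def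
    by (intro has_vector_derivative_mult_right partial_vertical_primitive(1)[OF E cE] x) auto
  hence 2: "partial 2 (\<lambda>y. archimedean_part Ra T y $ 2) x
          = Ra * vertical_primitive (\<lambda>x. E e1 x e2) x"
    by (subst partial_def)
       (use line in \<open>simp add: archimedean_part_def p1 e2_def vector_derivative_at\<close>)
  have 3: "partial 3 (\<lambda>y. archimedean_part Ra T y $ 3) x = 0"
    by (simp add: partial_def archimedean_part_def)
  have "vertical_primitive (\<lambda>x. E e2 x e1) x = vertical_primitive (\<lambda>x. E e1 x e2) x"
    unfolding vertical_primitive_def
    by (rule integral_cong) (use x in \<open>auto simp: slab_def mixed\<close>)
  thus "divergence (archimedean_part Ra T) x = 0"
    by (simp add: divergence_def sum_3 1 2 3)

  show "archimedean_part Ra T x \<bullet> e\<^sub>z = 0"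
    by (simp add: archimedean_part_def e\<^sub>z_def inner_axis)

  show "archimedean_part Ra T x = 0" if "x $ 3 = 0"
    using that x by (simp add: archimedean_part_def p1 p2 vec_eq_iff forall_3)
      (simp add: vertical_primitive_def)

  show "(1 / Ra) *\<^sub>R (cross3 e\<^sub>z (archimedean_part Ra T x)
          + gradient (\<lambda>y. Ra * vertical_primitive T y) x) = T x *\<^sub>R e\<^sub>z"
    if z: "0 < x $ 3" "x $ 3 < 1"
  proof -
    define g where "g = (\<lambda>z. T (vector [x $ 1, x $ 2, z]))"
    have g_alt: "g = (\<lambda>z. T (x + (z - x $ 3) *\<^sub>R axis 3 1))"
      by (rule ext, simp add: g_def, rule arg_cong[where f = T])
         (simp add: vec_eq_iff forall_3 axis_def)
    have "continuous_on {0..1} g"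
      unfolding g_alt by (intro continuous_on_compose2[OF cT])
        (auto simp: slab_def axis_def intro!: continuous_intros)
    hence "((\<lambda>u. integral {0..u} g) has_vector_derivative g (x $ 3)) (at (x $ 3) within {0..1})"
      by (rule integral_has_vector_derivative) (use z in auto)
    hence I: "((\<lambda>u. integral {0..u} g) has_vector_derivative g (x $ 3)) (at (x $ 3))"
      using z by (simp add: at_within_Icc_at)
    have vp: "vertical_primitive T (x + s *\<^sub>R axis 3 1) = integral {0..x $ 3 + s} g" for s
      by (simp add: vertical_primitive_def g_def axis_def)
    have gx: "g (x $ 3) = T x"
      by (simp add: g_alt)
    have "((\<lambda>u. integral {0..u} g) \<circ> (\<lambda>s. x $ 3 + s) has_vector_derivative 1 *\<^sub>R g (x $ 3)) (at 0)"
      by (rule vector_diff_chain_at) (use I in \<open>auto intro!: derivative_eq_intros\<close>)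
    hence I3: "((\<lambda>s. vertical_primitive T (x + s *\<^sub>R axis 3 1)) has_vector_derivative T x) (at 0)"
      by (simp add: vp gx o_def)
    have I1: "((\<lambda>s. vertical_primitive T (x + s *\<^sub>R axis 1 1)) has_vector_derivative
            vertical_primitive (\<lambda>x. D x e1) x) (at 0)"
      unfolding e1_def by (intro partial_vertical_primitive(1)[OF D cD] x) auto
    have I2: "((\<lambda>s. vertical_primitive T (x + s *\<^sub>R axis 2 1)) has_vector_derivative
            vertical_primitive (\<lambda>x. D x e2) x) (at 0)"
      unfolding e2_def by (intro partial_vertical_primitive(1)[OF D cD] x) auto
    note J = I1[THEN has_vector_derivative_mult_right, THEN vector_derivative_at]
      I2[THEN has_vector_derivative_mult_right, THEN vector_derivative_at]
      I3[THEN has_vector_derivative_mult_right, THEN vector_derivative_at]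
    have "gradient (\<lambda>y. Ra * vertical_primitive T y) x = vector
            [Ra * vertical_primitive (\<lambda>x. D x e1) x, Ra * vertical_primitive (\<lambda>x. D x e2) x, Ra * T x]"
      by (simp add: gradient_def partial_def vec_eq_iff forall_3 J)
    thus ?thesis
      using Ra by (simp add: archimedean_part_def p1[OF x] p2[OF x] cross3_def e\<^sub>z_def
          vec_eq_iff forall_3 axis_def)
  qed
qed

section \<open>Norms and constants\<close>

definition Lp_norm :: "ereal \<Rightarrow> 'a::euclidean_space set \<Rightarrow> ('a \<Rightarrow> 'b::real_normed_vector) \<Rightarrow> real" where
  "Lp_norm p V f =
     (if p = \<infinity> then real_of_ereal (esssup (lebesgue_on V) (\<lambda>x. ereal (norm (f x))))
      else (integral\<^sup>L (lebesgue_on V) (\<lambda>x. norm (f x) powr real_of_ereal p))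
             powr (1 / real_of_ereal p))"

definition lambda\<^sub>1 :: "real \<Rightarrow> real \<Rightarrow> real" where
  "lambda\<^sub>1 Lx Ly = Min {pi, 2 * pi / Lx, 2 * pi / Ly}"

definition C\<^sub>P :: "real \<Rightarrow> real \<Rightarrow> real" where
  "C\<^sub>P Lx Ly = 1 / lambda\<^sub>1 Lx Ly"

definition C\<^sub>3 :: real where
  "C\<^sub>3 = 2 powr (2/3) / (pi powr (2/3) * sqrt 3)"

definition C\<^sub>S :: "real \<Rightarrow> real \<Rightarrow> real" where
  "C\<^sub>S Lx Ly = 2 * sqrt 2 * C\<^sub>3 * (1 + sqrt (1 + 1 / Lx\<^sup>2 + 1 / Ly\<^sup>2) / lambda\<^sub>1 Lx Ly)"

definition A_const :: "real \<Rightarrow> real \<Rightarrow> ereal \<Rightarrow> real" where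
  "A_const Lx Ly p =
     (if p = \<infinity> then C\<^sub>P Lx Ly
      else C\<^sub>P Lx Ly powr ((real_of_ereal p - 3) / real_of_ereal p)
             * C\<^sub>S Lx Ly powr (3 / real_of_ereal p))"

end

theory Submission
  imports Defs
begin

text \<open>Split off the Archimedean part \<open>W\<close> of the velocity. By magnetostrophic balance and
  incompressibility the Lorentz force does the same work on \<open>u\<close> as on \<open>W\<close>, so with \<open>J = curl B\<close> the energy
  identity reads \<open>dE/dt = - \<integral> W \<bullet> (J \<times> B) - \<parallel>J\<parallel>\<^sup>2 / Rm\<close>, and dynamo action forces
  \<open>\<parallel>J\<parallel>\<^sup>2 / Rm \<le> \<integral> |W| |B| |J|\<close>. Hoelder's inequality with exponents \<open>p\<close>, \<open>q\<close>, \<open>2\<close>, where \<open>1/p + 1/q = 1/2\<close>, and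
  interpolation of \<open>L\<^sup>q\<close> between \<open>L\<^sup>2\<close> and \<open>L\<^sup>6\<close> reduce the claim to
  \<open>\<parallel>B\<parallel>\<^sub>2 \<le> C\<^sub>P \<parallel>J\<parallel>\<^sub>2\<close> and \<open>\<parallel>B\<parallel>\<^sub>6 \<le> C\<^sub>S \<parallel>J\<parallel>\<^sub>2\<close>; on flat ferromagnetic walls \<open>\<parallel>J\<parallel>\<^sub>2 = \<parallel>\<nabla>B\<parallel>\<^sub>2\<close>.
  The first bound follows from Wirtinger's inequalities: the horizontal components vanish on the walls, and
  the vertical one has zero mean on every horizontal section because the flux is exact. The second does not
  need the sharp Sobolev inequality behind \<open>C\<^sub>3\<close>: the Gagliardo--Nirenberg argument, that is the
  Loomis--Whitney inequality applied to \<open>|B|\<^sup>4\<close>, already yields a constant below \<open>C\<^sub>S\<close>.\<close>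

section \<open>One-dimensional inequalities\<close>

text \<open>What remains of the Coriolis force once \<open>W\<close> is removed is e_z x (u - W),
  orthogonal to u - W, while a gradient does no work on the divergence-free, tangent fields u and W;
  hence the two works agree. Flatness of the walls enters through products of first derivatives:
  exchanging indices in the integral of (d_i B_j)(d_j B_i) leaves only wall terms that carry a
  tangential component of B, so no curvature term survives. Using |B|^4 reaches the exponent 6 = 4 *
  3/2, gives a function that is differentiable at the zeros of B, and puts powers of the L^6 norm on
  both sides, which cancel. The technical obstacle is the boundary. The equations are stated in the
  open slab with two-sided derivatives and nothing is known outside, whereas integration by parts
  needs the closed slab. Each equation is therefore rewritten with derivatives taken within the slab
  and extended to the walls by continuity before it is integrated.\<close>

text \<open>\<open>\<phi> = - k tan (k (x - (a + b) / 2))\<close> solves \<open>\<phi>' = - k\<^sup>2 - \<phi>\<^sup>2\<close>, so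
  \<open>f'\<^sup>2 - k\<^sup>2 f\<^sup>2 - (\<phi> f\<^sup>2)' = (f' - \<phi> f)\<^sup>2\<close>.\<close>

lemma wirtinger_dirichlet_subcritical:
  fixes f f' :: "real \<Rightarrow> real"
  assumes ab: "a < b" and k: "0 < k" "k < pi / (b - a)"
    and d: "\<And>x. x \<in> {a..b} \<Longrightarrow> (f has_real_derivative f' x) (at x within {a..b})"
    and c: "continuous_on {a..b} f'" and bc: "f a = 0" "f b = 0"
  shows "k\<^sup>2 * integral {a..b} (\<lambda>x. (f x)\<^sup>2) \<le> integral {a..b} (\<lambda>x. (f' x)\<^sup>2)"
proof -
  define \<phi> where "\<phi> x = - k * tan (k * (x - (a + b) / 2))" for x
  \<comment> \<open>The strict bound on \<open>k\<close> keeps the argument inside (-pi/2, pi/2) up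
    to both end points, so \<open>\<phi>\<close> is finite on the closed interval.\<close>
  have cos: "cos (k * (x - (a + b) / 2)) > 0" if "x \<in> {a..b}" for x
  proof (rule cos_gt_zero_pi)
    have "\<bar>k * (x - (a + b) / 2)\<bar> \<le> k * ((b - a) / 2)"
      unfolding abs_mult using that k by (intro mult_mono) (auto simp: abs_le_iff field_simps)
    moreover have "k * (b - a) < pi" using k ab by (simp add: field_simps)
    ultimately show "- (pi / 2) < k * (x - (a + b) / 2)" "k * (x - (a + b) / 2) < pi / 2"
      by (simp_all add: abs_le_iff)
  qed
  have d\<phi>: "(\<phi> has_real_derivative (- k\<^sup>2 - (\<phi> x)\<^sup>2)) (at x within {a..b})" if "x \<in> {a..b}" for x
  proof -
    have "(\<phi> has_real_derivative (- k * (k * inverse ((cos (k * (x - (a + b) / 2)))\<^sup>2)))) (at x within {a..b})"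
      unfolding \<phi>_def using cos[OF that]
      by (auto intro!: derivative_eq_intros simp: field_simps)
    moreover have "inverse ((cos (k * (x - (a + b) / 2)))\<^sup>2) = 1 + (tan (k * (x - (a + b) / 2)))\<^sup>2"
      using cos[OF that] tan_sec[of "k * (x - (a + b) / 2)"] by (simp add: power_inverse)
    ultimately show ?thesis by (simp add: \<phi>_def algebra_simps power2_eq_square)
  qed
  have cf: "continuous_on {a..b} f"
    using d by (meson DERIV_continuous continuous_on_eq_continuous_within)
  have c\<phi>: "continuous_on {a..b} \<phi>"
    using d\<phi> by (meson DERIV_continuous continuous_on_eq_continuous_within)
  define G where "G x = (- k\<^sup>2 - (\<phi> x)\<^sup>2) * (f x)\<^sup>2 + 2 * \<phi> x * f x * f' x" for x
  have "((\<lambda>x. \<phi> x * (f x)\<^sup>2) has_real_derivative G x) (at x within {a..b})" if "x \<in> {a..b}" for x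
    unfolding G_def using d[OF that] d\<phi>[OF that]
    by (auto intro!: derivative_eq_intros simp: algebra_simps)
  hence "(G has_integral (\<phi> b * (f b)\<^sup>2 - \<phi> a * (f a)\<^sup>2)) {a..b}"
    using ab by (intro fundamental_theorem_of_calculus) (auto simp: has_real_derivative_iff_has_vector_derivative)
  hence G0: "integral {a..b} G = 0" by (simp add: bc integral_unique)
  have iG: "G integrable_on {a..b}"
    unfolding G_def by (intro integrable_continuous_interval continuous_intros cf c\<phi> c)
  have i1: "(\<lambda>x. (f x)\<^sup>2) integrable_on {a..b}" "(\<lambda>x. (f' x)\<^sup>2) integrable_on {a..b}"
    by (intro integrable_continuous_interval continuous_intros cf c)+
  have "integral {a..b} (\<lambda>x. k\<^sup>2 * (f x)\<^sup>2 + G x) \<le> integral {a..b} (\<lambda>x. (f' x)\<^sup>2)"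
  proof (rule integral_le)
    show "(\<lambda>x. k\<^sup>2 * (f x)\<^sup>2 + G x) integrable_on {a..b}"
      using i1 iG by (intro integrable_add integrable_on_mult_right) auto
    show "k\<^sup>2 * (f x)\<^sup>2 + G x \<le> (f' x)\<^sup>2" for x
      using zero_le_power2[of "f' x - \<phi> x * f x"] by (simp add: G_def power2_eq_square algebra_simps)
  qed (use i1 in auto)
  thus ?thesis using i1 iG G0 by (simp add: integral_add integrable_on_mult_right)
qed

text \<open>At k = pi / (b - a) the weight of the subcritical lemma blows up at the end points, so
  the sharp constant is obtained by letting \<open>k\<close> increase to this value in the finished
  inequality.\<close>

lemma wirtinger_dirichlet:
  fixes f f' :: "real \<Rightarrow> real"
  assumes ab: "a < b"
    and d: "\<And>x. x \<in> {a..b} \<Longrightarrow> (f has_real_derivative f' x) (at x within {a..b})"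
    and c: "continuous_on {a..b} f'" and bc: "f a = 0" "f b = 0"
  shows "integral {a..b} (\<lambda>x. (f x)\<^sup>2) \<le> ((b - a) / pi)\<^sup>2 * integral {a..b} (\<lambda>x. (f' x)\<^sup>2)"
proof -
  let ?c = "pi / (b - a)" and ?X = "integral {a..b} (\<lambda>x. (f x)\<^sup>2)" and ?Y = "integral {a..b} (\<lambda>x. (f' x)\<^sup>2)"
  have c0: "0 < ?c" using ab by simp
  have "((\<lambda>k. k\<^sup>2 * ?X) \<longlongrightarrow> ?c\<^sup>2 * ?X) (at_left ?c)"
    by (intro tendsto_intros)
  moreover have "\<forall>\<^sub>F k in at_left ?c. k\<^sup>2 * ?X \<le> ?Y"
    using eventually_at_left_real[OF c0]
  proof eventually_elim
    case (elim k)
    thus ?case by (intro wirtinger_dirichlet_subcritical[OF ab _ _ d c bc]) auto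
  qed
  ultimately have "?c\<^sup>2 * ?X \<le> ?Y"
    by (intro tendsto_upperbound[where F = "at_left ?c"]) auto
  thus ?thesis using ab by (simp add: field_simps power_divide)
qed

lemma integral_shift_period:
  fixes g :: "real \<Rightarrow> real"
  assumes p: "\<And>x. g (x + L) = g x" and c: "continuous_on UNIV g" and x: "0 \<le> x" "x \<le> L"
  shows "integral {x..x + L} g = integral {0..L} g"
proof -
  have i: "g integrable_on {a..b}" for a b
    using c continuous_on_subset by (intro integrable_continuous_interval) blast
  have "integral {0..x} (g \<circ> (\<lambda>x. x + L)) = integral {0 + L..x + L} g"
    using c continuous_on_subset by (intro integral_shift) blast
  hence "integral {L..x + L} g = integral {0..x} g" using p by (simp add: o_def)
  moreover have "integral {x..L} g + integral {L..x + L} g = integral {x..x + L} g"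
    using x i by (intro Henstock_Kurzweil_Integration.integral_combine) auto
  moreover have "integral {0..x} g + integral {x..L} g = integral {0..L} g"
    using x i by (intro Henstock_Kurzweil_Integration.integral_combine) auto
  ultimately show ?thesis by simp
qed

text \<open>Some \<open>c\<close> has \<open>f c = f (c + L/2)\<close>, so \<open>f - f c\<close> satisfies Dirichlet conditions
  on two half periods.\<close>

lemma wirtinger_periodic:
  fixes f f' :: "real \<Rightarrow> real"
  assumes L: "L > 0" and p: "\<And>x. f (x + L) = f x"
    and d: "\<And>x. (f has_real_derivative f' x) (at x)"
    and c: "continuous_on UNIV f'"
  shows "integral {0..L} (\<lambda>x. (f x)\<^sup>2) - (integral {0..L} f)\<^sup>2 / L
     \<le> (L / (2 * pi))\<^sup>2 * integral {0..L} (\<lambda>x. (f' x)\<^sup>2)"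
proof -
  have p': "f' (x + L) = f' x" for x
    using d[of "x + L"] p DERIV_unique[OF d[of x]] by (simp add: DERIV_shift)
  have cf: "continuous_on UNIV f"
    using d by (meson DERIV_isCont continuous_at_imp_continuous_on)
  have cf': "continuous_on S f" "continuous_on S f'" for S
    using cf c continuous_on_subset by blast+
  define g where "g x = f (x + L/2) - f x" for x
  have cg: "continuous_on {0..L/2} g"
    unfolding g_def by (intro continuous_intros continuous_on_compose2[OF cf]) auto
  \<comment> \<open>Two half-period shifts make a full period, so \<open>g\<close> takes opposite
    values at 0 and L/2 and vanishes somewhere in between.\<close>
  have gL: "g (L/2) = - g 0"
    using p[of 0] by (simp add: g_def)
  have "\<exists>x\<ge>0. x \<le> L/2 \<and> g x = 0"
  proof (cases "g 0 \<le> 0")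
    case True
    show ?thesis by (rule IVT'[OF _ _ _ cg]) (use True L gL in simp_all)
  next
    case False
    show ?thesis by (rule IVT2'[OF _ _ _ cg]) (use False L gL in simp_all)
  qed
  then obtain x where x: "0 \<le> x" "x \<le> L/2" "g x = 0" by blast
  define h where "h y = f y - f x" for y
  have dh: "(h has_real_derivative f' y) (at y within S)" for y S
    using DERIV_diff[OF d[of y] DERIV_const[of "f x"]] unfolding h_def
    by (simp add: has_field_derivative_at_within)
  have h0: "h x = 0" "h (x + L/2) = 0" "h (x + L) = 0"
    using x p by (auto simp: h_def g_def)
  have i: "(\<lambda>x. (h x)\<^sup>2) integrable_on {a..b}" "(\<lambda>x. (f' x)\<^sup>2) integrable_on {a..b}"
    "f integrable_on {a..b}" "(\<lambda>x. (f x)\<^sup>2) integrable_on {a..b}" for a b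
    unfolding h_def by (intro integrable_continuous_interval continuous_intros cf')+
  have 1: "integral {x..x+L/2} (\<lambda>y. (h y)\<^sup>2) \<le> (L / (2 * pi))\<^sup>2 * integral {x..x+L/2} (\<lambda>y. (f' y)\<^sup>2)"
    using wirtinger_dirichlet[OF _ dh cf'(2) h0(1,2)] L by simp
  have "integral {x+L/2..x+L} (\<lambda>y. (h y)\<^sup>2) \<le> ((x + L - (x + L/2)) / pi)\<^sup>2 * integral {x+L/2..x+L} (\<lambda>y. (f' y)\<^sup>2)"
    using wirtinger_dirichlet[OF _ dh cf'(2) h0(2,3)] L by simp
  moreover have "x + L - (x + L/2) = L/2" by simp
  ultimately have 2: "integral {x+L/2..x+L} (\<lambda>y. (h y)\<^sup>2) \<le> (L / (2 * pi))\<^sup>2 * integral {x+L/2..x+L} (\<lambda>y. (f' y)\<^sup>2)"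
    by simp
  have comb: "integral {x..x+L/2} q + integral {x+L/2..x+L} q = integral {x..x+L} q"
    if "\<And>a b. q integrable_on {a..b}" for q :: "real \<Rightarrow> real"
    using L that by (intro Henstock_Kurzweil_Integration.integral_combine) auto
  have le: "integral {x..x+L} (\<lambda>y. (h y)\<^sup>2) \<le> (L / (2 * pi))\<^sup>2 * integral {x..x+L} (\<lambda>y. (f' y)\<^sup>2)"
    using add_mono[OF 1 2] by (simp only: comb[OF i(1)] comb[OF i(2)] flip: distrib_left)
  have e1: "integral {x..x+L} (\<lambda>y. (h y)\<^sup>2) = integral {0..L} (\<lambda>y. (h y)\<^sup>2)"
    by (intro integral_shift_period) (use x L p in \<open>auto simp: h_def intro!: continuous_intros cf'\<close>)
  have e2: "integral {x..x+L} (\<lambda>y. (f' y)\<^sup>2) = integral {0..L} (\<lambda>y. (f' y)\<^sup>2)"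
    by (intro integral_shift_period) (use x L p' in \<open>auto intro!: continuous_intros cf'\<close>)
  have e3: "integral {0..L} (\<lambda>y. (h y)\<^sup>2)
      = integral {0..L} (\<lambda>x. (f x)\<^sup>2) - 2 * f x * integral {0..L} f + L * (f x)\<^sup>2"
  proof -
    have "((\<lambda>y. ((f y)\<^sup>2 - 2 * f x * f y) + (f x)\<^sup>2) has_integral
        integral {0..L} (\<lambda>x. (f x)\<^sup>2) - 2 * f x * integral {0..L} f + (L - 0) *\<^sub>R (f x)\<^sup>2) {0..L}"
      by (intro has_integral_add has_integral_diff has_integral_mult_right integrable_integral i)
         (use has_integral_const_real[of "(f x)\<^sup>2" 0 L] L in simp)
    moreover have "(\<lambda>y. (h y)\<^sup>2) = (\<lambda>y. ((f y)\<^sup>2 - 2 * f x * f y) + (f x)\<^sup>2)"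
      by (auto simp: h_def power2_eq_square algebra_simps)
    ultimately show ?thesis by (simp add: integral_unique)
  qed
  \<comment> \<open>Among all constants the mean minimises the quadratic deviation, so the variance
    is at most the integral of \<open>(h y)\<^sup>2\<close>; this is the completed square that says
    so.\<close>
  have e4: "(integral {0..L} f)\<^sup>2 / L \<ge> 2 * f x * integral {0..L} f - L * (f x)\<^sup>2"
    using zero_le_power2[of "integral {0..L} f - L * f x"] L
    by (simp add: field_simps power2_eq_square)
  show ?thesis using le[unfolded e1 e2 e3] e4 by linarith
qed

lemma abs_diff_le_integral_abs_deriv:
  fixes f f' :: "real \<Rightarrow> real"
  assumes "a \<le> b"
    and d: "\<And>x. x \<in> {a..b} \<Longrightarrow> (f has_real_derivative f' x) (at x within {a..b})"
    and c: "continuous_on {a..b} f'"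
  shows "\<bar>f b - f a\<bar> \<le> integral {a..b} (\<lambda>x. \<bar>f' x\<bar>)"
proof -
  have "(f' has_integral (f b - f a)) {a..b}"
    using assms by (intro fundamental_theorem_of_calculus) (auto simp: has_real_derivative_iff_has_vector_derivative)
  moreover have "norm (integral {a..b} f') \<le> integral {a..b} (\<lambda>x. \<bar>f' x\<bar>)"
    using c by (intro integral_norm_bound_integral integrable_continuous_interval continuous_intros) auto
  ultimately show ?thesis by (simp add: integral_unique)
qed

lemma le_average_plus:
  fixes f :: "real \<Rightarrow> real"
  assumes L: "L > 0" and c: "continuous_on {0..L} f" and le: "\<And>y. y \<in> {0..L} \<Longrightarrow> z \<le> f y + K"
  shows "z \<le> integral {0..L} f / L + K"
proof -
  have "integral {0..L} (\<lambda>y. z) \<le> integral {0..L} (\<lambda>y. f y + K)"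
    using c le by (intro integral_le integrable_continuous_interval continuous_intros) auto
  also have "\<dots> = integral {0..L} f + L * K"
    using L c by (subst integral_add) (auto intro!: integrable_continuous_interval)
  finally show ?thesis using L by (simp add: field_simps)
qed

text \<open>Passing from \<open>x\<close> to another point \<open>y\<close> costs the variation in
  between, and averaging removes \<open>y\<close>. If the end values agree, the interval closes to a
  circle and the cheaper of the two arcs costs at most half of the total variation.\<close>

lemma le_average_plus_total_variation:
  fixes f f' :: "real \<Rightarrow> real"
  assumes L: "L > 0" and x: "x \<in> {0..L}"
    and d: "\<And>x. x \<in> {0..L} \<Longrightarrow> (f has_real_derivative f' x) (at x within {0..L})"
    and c: "continuous_on {0..L} f'"
  shows "f x \<le> integral {0..L} f / L + integral {0..L} (\<lambda>x. \<bar>f' x\<bar>)"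
    and "f 0 = f L \<Longrightarrow> f x \<le> integral {0..L} f / L + integral {0..L} (\<lambda>x. \<bar>f' x\<bar>) / 2"
proof -
  define V where "V a b = integral {a..b} (\<lambda>x. \<bar>f' x\<bar>)" for a b
  have V: "\<bar>f b - f a\<bar> \<le> V a b" if "0 \<le> a" "a \<le> b" "b \<le> L" for a b
    unfolding V_def using that c d
    by (intro abs_diff_le_integral_abs_deriv)
       (auto intro: continuous_on_subset intro!: has_field_derivative_subset[OF d])
  have i: "(\<lambda>x. \<bar>f' x\<bar>) integrable_on {a..b}" if "0 \<le> a" "b \<le> L" for a b
    using c that by (intro integrable_continuous_interval continuous_intros) (auto elim: continuous_on_subset)
  have V0: "V a b \<ge> 0" if "0 \<le> a" "b \<le> L" for a b
    unfolding V_def using i that by (intro integral_nonneg) auto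
  have comb: "V 0 a + V a b + V b L = V 0 L" if "0 \<le> a" "a \<le> b" "b \<le> L" for a b
    unfolding V_def using that i
    by (simp add: Henstock_Kurzweil_Integration.integral_combine)
  have cf: "continuous_on {0..L} f"
    using d by (meson DERIV_continuous continuous_on_eq_continuous_within)
  have le: "f x \<le> f y + V 0 L \<and> (f 0 = f L \<longrightarrow> f x \<le> f y + V 0 L / 2)" if "y \<in> {0..L}" for y
  proof -
    define a b where "a = min x y" and "b = max x y"
    have ab: "0 \<le> a" "a \<le> b" "b \<le> L" using that x by (auto simp: a_def b_def)
    have "\<bar>f x - f y\<bar> = \<bar>f b - f a\<bar>" by (auto simp: a_def b_def min_def max_def)
    thus ?thesis
      using V[of a b] V[of 0 a] V[of b L] comb[of a b] V0[of 0 a] V0[of b L] ab by auto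
  qed
  show "f x \<le> integral {0..L} f / L + integral {0..L} (\<lambda>x. \<bar>f' x\<bar>)"
    using le_average_plus[OF L cf] le by (auto simp: V_def)
  show "f x \<le> integral {0..L} f / L + integral {0..L} (\<lambda>x. \<bar>f' x\<bar>) / 2" if "f 0 = f L"
    using le_average_plus[OF L cf] le that by (auto simp: V_def)
qed

section \<open>Hoelder and Cauchy-Schwarz inequalities for continuous functions on a box\<close>

lemma integral_zero_imp_zero:
  fixes f :: "'a::euclidean_space \<Rightarrow> real"
  assumes c: "continuous_on (cbox a b) f" and nn: "\<And>x. x \<in> cbox a b \<Longrightarrow> 0 \<le> f x"
    and ne: "box a b \<noteq> {}" and z: "integral (cbox a b) f = 0" and x: "x \<in> cbox a b"
  shows "f x = 0"
proof (rule has_integral_0_cbox_imp_0[OF c _ _ ne x])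
  show "0 \<le> f x" if "x \<in> box a b" for x
    using nn that box_subset_cbox by blast
  show "(f has_integral 0) (cbox a b)"
    using integrable_integral[OF integrable_continuous[OF c]] z by simp
qed

text \<open>Weighted Young inequality, integrated after normalising both functions to integral one.
  The exponents sit on the functions themselves, which is the form needed to interpolate between
  Lebesgue norms.\<close>

lemma Holder_integral_continuous:
  fixes f g :: "'a::euclidean_space \<Rightarrow> real"
  assumes c: "continuous_on (cbox a b) f" "continuous_on (cbox a b) g"
    and nn: "\<And>x. x \<in> cbox a b \<Longrightarrow> 0 \<le> f x" "\<And>x. x \<in> cbox a b \<Longrightarrow> 0 \<le> g x"
    and ne: "box a b \<noteq> {}" and p: "\<alpha> > 0" "\<beta> > 0" "\<alpha> + \<beta> = 1"
  shows "integral (cbox a b) (\<lambda>x. f x powr \<alpha> * g x powr \<beta>)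
    \<le> integral (cbox a b) f powr \<alpha> * integral (cbox a b) g powr \<beta>"
proof -
  define F where "F = integral (cbox a b) f"
  define G where "G = integral (cbox a b) g"
  have F0: "F \<ge> 0" and G0: "G \<ge> 0" unfolding F_def G_def
    using c nn by (auto intro!: integral_nonneg integrable_continuous)
  show ?thesis
  proof (cases "F = 0 \<or> G = 0")
    \<comment> \<open>The normalisation would divide by zero here; instead, a continuous nonnegative
      function with zero integral vanishes on the whole box.\<close>
    case True
    hence "f x powr \<alpha> * g x powr \<beta> = 0" if "x \<in> cbox a b" for x
      using integral_zero_imp_zero[OF c(1) nn(1) ne _ that] integral_zero_imp_zero[OF c(2) nn(2) ne _ that]
      by (auto simp: F_def G_def)
    hence "integral (cbox a b) (\<lambda>x. f x powr \<alpha> * g x powr \<beta>) = integral (cbox a b) (\<lambda>x. 0)"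
      by (intro integral_cong) auto
    thus ?thesis by simp
  next
    case False
    hence pos: "F > 0" "G > 0" using F0 G0 by auto
    have i: "f integrable_on cbox a b" "g integrable_on cbox a b" using c by (auto intro: integrable_continuous)
    have "integral (cbox a b) (\<lambda>x. f x powr \<alpha> * g x powr \<beta>)
      \<le> integral (cbox a b) (\<lambda>x. (F powr \<alpha> * G powr \<beta>) * (\<alpha> / F * f x + \<beta> / G * g x))"
    proof (rule integral_le)
      show "(\<lambda>x. f x powr \<alpha> * g x powr \<beta>) integrable_on cbox a b"
        using c nn p by (intro integrable_continuous continuous_on_mult continuous_on_powr') auto
      show "(\<lambda>x. (F powr \<alpha> * G powr \<beta>) * (\<alpha> / F * f x + \<beta> / G * g x)) integrable_on cbox a b"
        using c by (intro integrable_continuous continuous_intros)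
      fix x assume x: "x \<in> cbox a b"
      have "(f x / F) powr \<alpha> * (g x / G) powr \<beta> \<le> \<alpha> * (f x / F) + \<beta> * (g x / G)"
      proof (cases "f x = 0 \<or> g x = 0")
        case False
        thus ?thesis using nn[OF x] pos p by (intro Youngs_inequality_0) (auto simp: less_le)
      qed (use nn[OF x] pos p in auto)
      moreover have "f x powr \<alpha> * g x powr \<beta>
          = (F powr \<alpha> * G powr \<beta>) * ((f x / F) powr \<alpha> * (g x / G) powr \<beta>)"
        using nn[OF x] pos by (simp add: powr_divide)
      ultimately show "f x powr \<alpha> * g x powr \<beta> \<le> (F powr \<alpha> * G powr \<beta>) * (\<alpha> / F * f x + \<beta> / G * g x)"
        using pos by (simp add: mult_left_mono)
    qed
    also have "\<dots> = F powr \<alpha> * G powr \<beta> * (\<alpha> + \<beta>)"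
      using i pos by (simp add: integral_add integrable_on_mult_right flip: F_def G_def)
    finally show ?thesis using p by (simp add: F_def G_def)
  qed
qed

lemma Cauchy_Schwarz_integral_continuous:
  fixes f g :: "'a::euclidean_space \<Rightarrow> real"
  assumes c: "continuous_on (cbox a b) f" "continuous_on (cbox a b) g"
    and nn: "\<And>x. x \<in> cbox a b \<Longrightarrow> 0 \<le> f x" "\<And>x. x \<in> cbox a b \<Longrightarrow> 0 \<le> g x"
    and ne: "box a b \<noteq> {}"
  shows "integral (cbox a b) (\<lambda>x. f x * g x)
    \<le> sqrt (integral (cbox a b) (\<lambda>x. (f x)\<^sup>2)) * sqrt (integral (cbox a b) (\<lambda>x. (g x)\<^sup>2))"
proof -
  have "integral (cbox a b) (\<lambda>x. (f x)\<^sup>2 powr (1/2) * (g x)\<^sup>2 powr (1/2))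
    \<le> integral (cbox a b) (\<lambda>x. (f x)\<^sup>2) powr (1/2) * integral (cbox a b) (\<lambda>x. (g x)\<^sup>2) powr (1/2)"
    using c ne by (intro Holder_integral_continuous continuous_intros) auto
  moreover have "integral (cbox a b) (\<lambda>x. (f x)\<^sup>2) \<ge> 0" "integral (cbox a b) (\<lambda>x. (g x)\<^sup>2) \<ge> 0"
    using c by (auto intro!: integral_nonneg integrable_continuous continuous_intros)
  moreover have "integral (cbox a b) (\<lambda>x. (f x)\<^sup>2 powr (1/2) * (g x)\<^sup>2 powr (1/2)) = integral (cbox a b) (\<lambda>x. f x * g x)"
    using nn by (intro integral_cong) (simp add: powr_half_sqrt)
  ultimately show ?thesis by (simp add: powr_half_sqrt)
qed

section \<open>Coordinate slices of the slab\<close>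

text \<open>Written as a translation along an axis, so that continuity and the derivative in
  \<open>s\<close> are immediate and the link with the shifts in \<open>partial\<close> is
  direct.\<close>

definition upd :: "3 \<Rightarrow> real \<Rightarrow> real^3 \<Rightarrow> real^3" where
  "upd i s x = x + (s - x $ i) *\<^sub>R axis i 1"

lemma upd_nth [simp]: "upd i s x $ j = (if j = i then s else x $ j)"
  by (auto simp: upd_def axis_def)

lemma upd_upd [simp]: "upd i s (upd i r x) = upd i s x"
  by (simp add: vec_eq_iff)

lemma upd_triv [simp]: "upd i (x $ i) x = x"
  by (simp add: vec_eq_iff)

lemma upd_commute: "i \<noteq> j \<Longrightarrow> upd i s (upd j r x) = upd j r (upd i s x)"
  by (simp add: vec_eq_iff)

lemma upd_add: "upd i (s + c) x = upd i s x + c *\<^sub>R axis i 1"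
  by (simp add: upd_def algebra_simps)

lemma continuous_on_upd [continuous_intros]:
  "continuous_on S f \<Longrightarrow> continuous_on S g \<Longrightarrow> continuous_on S (\<lambda>x. upd i (f x) (g x))"
  unfolding upd_def by (intro continuous_intros)

text \<open>The slab is the product of these ranges, so moving one coordinate within its range never
  leaves it.\<close>

definition rng :: "3 \<Rightarrow> real set" where
  "rng i = (if i = 3 then {0..1} else UNIV)"

lemma upd_in_slab: "x \<in> slab \<Longrightarrow> s \<in> rng i \<Longrightarrow> upd i s x \<in> slab"
  by (auto simp: slab_def rng_def split: if_splits)

lemma nth_in_rng: "x \<in> slab \<Longrightarrow> x $ i \<in> rng i"
  by (auto simp: slab_def rng_def)

text \<open>The result stays a function on \<open>real^3\<close>, constant in direction
  \<open>i\<close>, so that slice integrals in different directions can be composed and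
  interchanged.\<close>

definition slice_integral :: "3 \<Rightarrow> real \<Rightarrow> (real^3 \<Rightarrow> real) \<Rightarrow> real^3 \<Rightarrow> real" where
  "slice_integral i c f x = integral {0..c} (\<lambda>s. f (upd i s x))"

lemma slice_integral_upd [simp]: "slice_integral i c f (upd i s x) = slice_integral i c f x"
  by (simp add: slice_integral_def)

lemma continuous_on_slice:
  assumes "continuous_on slab f" "x \<in> slab"
  shows "continuous_on (rng i) (\<lambda>s. f (upd i s x))"
  by (rule continuous_on_compose2[OF assms(1)]) (use assms in \<open>auto intro!: continuous_intros upd_in_slab\<close>)

lemma slice_integral_cong:
  assumes "\<And>x. x \<in> slab \<Longrightarrow> f x = g x" "{0..c} \<subseteq> rng i" "x \<in> slab"
  shows "slice_integral i c f x = slice_integral i c g x"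
  unfolding slice_integral_def by (intro integral_cong assms(1) upd_in_slab) (use assms in auto)

lemma continuous_on_slice_integral:
  assumes f: "continuous_on slab f" and c: "{0..c} \<subseteq> rng i"
  shows "continuous_on slab (slice_integral i c f)"
proof -
  have "continuous_on slab (\<lambda>x. integral (cbox 0 c) (\<lambda>s. f (upd i s x)))"
  proof (rule integral_continuous_on_param)
    show "continuous_on (slab \<times> cbox 0 c) (\<lambda>(x, s). f (upd i s x))"
      unfolding case_prod_beta
      by (rule continuous_on_compose2[OF f]) (use c in \<open>auto intro!: continuous_intros upd_in_slab\<close>)
  qed
  thus ?thesis by (simp add: slice_integral_def[abs_def])
qed

lemma slice_integral_commute:
  assumes f: "continuous_on slab f" and c: "{0..c} \<subseteq> rng i" and d: "{0..d} \<subseteq> rng j"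
    and ij: "i \<noteq> j" and x: "x \<in> slab"
  shows "slice_integral i c (slice_integral j d f) x = slice_integral j d (slice_integral i c f) x"
proof -
  have "integral (cbox 0 c) (\<lambda>s. integral (cbox 0 d) (\<lambda>r. f (upd j r (upd i s x))))
      = integral (cbox 0 d) (\<lambda>r. integral (cbox 0 c) (\<lambda>s. f (upd j r (upd i s x))))"
  proof (rule integral_swap_continuous)
    show "continuous_on (cbox (0, 0) (c, d)) (\<lambda>(s, r). f (upd j r (upd i s x)))"
      unfolding case_prod_beta
      by (rule continuous_on_compose2[OF f])
         (use c d x in \<open>auto intro!: continuous_intros upd_in_slab simp: cbox_Pair_eq\<close>)
  qed
  moreover have "upd j r (upd i s x) = upd i s (upd j r x)" for r s
    using ij by (rule upd_commute[symmetric, THEN sym, THEN sym])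
  ultimately show ?thesis by (simp add: slice_integral_def)
qed

text \<open>Unlike \<^const>\<open>partial\<close>, this derivative is one-sided at the walls and so independent of the values
  outside the slab.\<close>

definition has_pd :: "3 \<Rightarrow> (real^3 \<Rightarrow> real) \<Rightarrow> (real^3 \<Rightarrow> real) \<Rightarrow> bool" where
  "has_pd i f f' \<longleftrightarrow> (\<forall>x\<in>slab. ((\<lambda>s. f (upd i s x)) has_real_derivative f' x) (at (x $ i) within rng i))"

lemma has_pd_slice:
  assumes "has_pd i f f'" "x \<in> slab" "s \<in> rng i"
  shows "((\<lambda>s. f (upd i s x)) has_real_derivative f' (upd i s x)) (at s within rng i)"
  using assms(1)[unfolded has_pd_def, rule_format, OF upd_in_slab[OF assms(2,3)]] by simp

lemma has_pd_add: "has_pd i f f' \<Longrightarrow> has_pd i g g' \<Longrightarrow> has_pd i (\<lambda>x. f x + g x) (\<lambda>x. f' x + g' x)"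
  by (auto simp: has_pd_def intro!: derivative_eq_intros)

lemma has_pd_diff: "has_pd i f f' \<Longrightarrow> has_pd i g g' \<Longrightarrow> has_pd i (\<lambda>x. f x - g x) (\<lambda>x. f' x - g' x)"
  by (auto simp: has_pd_def intro!: derivative_eq_intros)

lemma has_pd_cmult: "has_pd i f f' \<Longrightarrow> has_pd i (\<lambda>x. c * f x) (\<lambda>x. c * f' x)"
  by (auto simp: has_pd_def intro!: derivative_eq_intros)

lemma has_pd_mult: "has_pd i f f' \<Longrightarrow> has_pd i g g' \<Longrightarrow> has_pd i (\<lambda>x. f x * g x) (\<lambda>x. f' x * g x + f x * g' x)"
  unfolding has_pd_def
  by (auto intro!: derivative_eq_intros)

lemma has_pd_square: "has_pd i f f' \<Longrightarrow> has_pd i (\<lambda>x. (f x)\<^sup>2) (\<lambda>x. 2 * f x * f' x)"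
  unfolding has_pd_def
  by (auto intro!: derivative_eq_intros)

lemma prod_3: "prod f (UNIV :: 3 set) = f 1 * (f 2 * f 3)"
  unfolding UNIV_3 by simp

section \<open>The periodicity cell: Fubini, averaging and integration of derivatives\<close>

locale periodicity_cell =
  fixes Lx Ly :: real
  assumes Lx: "0 < Lx" and Ly: "0 < Ly"
begin

definition len :: "3 \<Rightarrow> real" where
  "len i = vector [Lx, Ly, 1] $ i"

lemma len_simps [simp]: "len 1 = Lx" "len 2 = Ly" "len 3 = 1"
  by (auto simp: len_def)

lemma len_pos: "0 < len i"
  using Lx Ly exhaust_3[of i] by auto

lemma len_rng: "{0..len i} \<subseteq> rng i"
  by (auto simp: rng_def)

abbreviation C :: "(real^3) set" where "C \<equiv> cell Lx Ly"

lemma cell_cbox: "C = cbox 0 (vector [Lx, Ly, 1])"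
  by (auto simp: cell_def mem_box_cart forall_3)

lemma box_ne: "box 0 (vector [Lx, Ly, 1] :: real^3) \<noteq> {}"
  using Lx Ly by (simp add: interval_ne_empty_cart forall_3)

lemma cell_subset_slab: "C \<subseteq> slab"
  by (auto simp: cell_def slab_def)

lemma integrable_cell: "continuous_on slab f \<Longrightarrow> f integrable_on C" for f :: "real^3 \<Rightarrow> 'a::banach"
  using cell_subset_slab continuous_on_subset unfolding cell_cbox by (blast intro: integrable_continuous)

text \<open>Relabelling triples as vectors maps boxes to boxes of equal volume, so the integral can
  be transported to a product type, where Fubini splits it.\<close>

lemma integral_cell_iterated:
  fixes f :: "real^3 \<Rightarrow> real"
  assumes f: "continuous_on slab f"
  shows "integral C f = integral {0..Lx} (\<lambda>a. integral {0..Ly} (\<lambda>b. integral {0..1} (\<lambda>c. f (vector [a, b, c]))))"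
proof -
  define g :: "real \<times> real \<times> real \<Rightarrow> real^3" where "g p = vector [fst p, fst (snd p), snd (snd p)]" for p
  define h :: "real^3 \<Rightarrow> real \<times> real \<times> real" where "h x = (x $ 1, x $ 2, x $ 3)" for x
  have hg: "h (g p) = p" for p by (simp add: h_def g_def)
  have gh: "g (h x) = x" for x by (simp add: h_def g_def vec_eq_iff forall_3)
  have g_sum: "g = (\<lambda>p. fst p *\<^sub>R axis 1 1 + fst (snd p) *\<^sub>R axis 2 1 + snd (snd p) *\<^sub>R axis 3 1)"
    by (auto simp: g_def vec_eq_iff forall_3 axis_def)
  have contg: "continuous_on S g" for S
    unfolding g_sum by (intro continuous_intros)
  have h_box: "h ` cbox u v = cbox (h u) (h v)" for u v
  proof (intro equalityI subsetI)
    fix p assume "p \<in> cbox (h u) (h v)"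
    hence "g p \<in> cbox u v"
      by (cases p) (auto simp: h_def g_def mem_box_cart forall_3 cbox_Pair_eq)
    thus "p \<in> h ` cbox u v" using hg by (metis image_eqI)
  qed (auto simp: h_def mem_box_cart forall_3 cbox_Pair_eq)
  have g_box: "g ` cbox u v = cbox (g u) (g v)" for u v
    using h_box[of "g u" "g v"] hg gh by (metis (no_types, lifting) image_image image_cong image_ident)
  have cont_gbox: "measure lborel (g ` cbox u v) = 1 * measure lborel (cbox u v)" for u v
  proof -
    obtain u1 u2 u3 v1 v2 v3 where uv: "u = (u1, u2, u3)" "v = (v1, v2, v3)"
      by (metis prod.exhaust)
    have ne: "cbox (g u) (g v) \<noteq> {} \<longleftrightarrow> u1 \<le> v1 \<and> u2 \<le> v2 \<and> u3 \<le> v3"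
      by (simp add: interval_ne_empty_cart forall_3 uv g_def)
    have "measure lborel (cbox u v) = measure lborel {u1..v1} * (measure lborel {u2..v2} * measure lborel {u3..v3})"
      by (simp add: uv content_Pair)
    also have "\<dots> = measure lborel (cbox (g u) (g v))"
    proof (cases "u1 \<le> v1 \<and> u2 \<le> v2 \<and> u3 \<le> v3")
      case True
      hence "measure lborel (cbox (g u) (g v)) = (\<Prod>i\<in>UNIV. g v $ i - g u $ i)"
        using ne by (intro content_cbox_cart) blast
      also have "\<dots> = (v1 - u1) * ((v2 - u2) * (v3 - u3))"
        unfolding prod_3 by (simp add: uv g_def)
      finally show ?thesis using True by simp
    next
      case False
      hence "cbox (g u) (g v) = {}" using ne by blast
      thus ?thesis using False by auto
    qed
    finally show ?thesis by (simp add: g_box)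
  qed
  have "(f has_integral integral C f) (cbox 0 (vector [Lx, Ly, 1]))"
    using integrable_cell[OF f] by (simp add: cell_cbox integrable_integral)
  hence "((\<lambda>p. f (g p)) has_integral (1 / 1) *\<^sub>R integral C f) (h ` cbox 0 (vector [Lx, Ly, 1]))"
  proof (intro has_integral_twiddle[where g = g and h = h])
    show "\<exists>w z. g ` cbox u v = cbox w z" for u v using g_box by blast
    show "\<exists>w z. h ` cbox u v = cbox w z" for u v using h_box by blast
    show "isCont g p" for p using contg[of UNIV] continuous_on_eq_continuous_at[OF open_UNIV] by blast
  qed (use hg gh cont_gbox in auto)
  hence "integral C f = integral (cbox (0, 0, 0) (Lx, Ly, 1)) (\<lambda>p. f (g p))"
    unfolding h_box by (simp add: h_def integral_unique)
  also have cfg: "continuous_on (cbox (0, 0, 0) (Lx, Ly, 1)) (\<lambda>p. f (g p))"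
    by (rule continuous_on_compose2[OF f contg]) (auto simp: cbox_Pair_eq g_def slab_def)
  have "integral (cbox (0, 0, 0) (Lx, Ly, 1)) (\<lambda>p. f (g p))
      = integral (cbox 0 Lx) (\<lambda>a. integral (cbox (0, 0) (Ly, 1)) (\<lambda>y. f (g (a, y))))"
    by (rule integral_prod_continuous[OF cfg])
  also have "\<dots> = integral (cbox 0 Lx) (\<lambda>a. integral (cbox 0 Ly) (\<lambda>b. integral (cbox 0 1) (\<lambda>c. f (g (a, b, c)))))"
  proof (intro integral_cong integral_prod_continuous)
    show "continuous_on (cbox (0, 0) (Ly, 1)) (\<lambda>y. f (g (a, y)))" if "a \<in> cbox 0 Lx" for a
      by (rule continuous_on_compose2[OF cfg]) (use that in \<open>auto intro!: continuous_intros simp: cbox_Pair_eq\<close>)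
  qed
  finally show ?thesis by (simp add: g_def)
qed

lemma integral_cell_slices:
  assumes f: "continuous_on slab f"
  shows "integral C f = slice_integral 1 Lx (slice_integral 2 Ly (slice_integral 3 1 f)) x"
proof -
  have "upd 3 c (upd 2 b (upd 1 a x)) = vector [a, b, c]" for a b c
    by (simp add: vec_eq_iff forall_3)
  thus ?thesis using integral_cell_iterated[OF f] by (simp add: slice_integral_def)
qed

text \<open>Conditional expectation given the other two coordinates. The normalisation makes it
  idempotent and preserves integrals over the cell.\<close>

definition avg :: "3 \<Rightarrow> (real^3 \<Rightarrow> real) \<Rightarrow> real^3 \<Rightarrow> real" where
  "avg i f x = slice_integral i (len i) f x / len i"

lemma avg_upd [simp]: "avg i f (upd i s x) = avg i f x"
  by (simp add: avg_def)

lemma continuous_on_avg [continuous_intros]: "continuous_on slab f \<Longrightarrow> continuous_on slab (avg i f)"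
  unfolding avg_def using len_pos[of i]
  by (intro continuous_intros continuous_on_slice_integral len_rng) auto

lemma slice_integral_avg_same: "slice_integral i (len i) (avg i f) x = slice_integral i (len i) f x"
  using len_pos[of i] by (simp add: slice_integral_def[of i _ "avg i f"]) (simp add: avg_def)

lemma slice_integral_avg_commute:
  assumes "continuous_on slab f" "i \<noteq> j" "x \<in> slab"
  shows "slice_integral j (len j) (avg i f) x = avg i (slice_integral j (len j) f) x"
proof -
  have "slice_integral j (len j) (avg i f) x = slice_integral j (len j) (slice_integral i (len i) f) x / len i"
    by (simp add: avg_def[abs_def] slice_integral_def[of j])
  thus ?thesis using slice_integral_commute[OF assms(1) len_rng len_rng, of j i x] assms
    by (simp add: avg_def)
qed

text \<open>The average is pushed outwards through the iterated integral until it meets the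
  integration in its own direction, which absorbs it.\<close>

lemma integral_avg:
  assumes f: "continuous_on slab f"
  shows "integral C (avg i f) = integral C f"
proof -
  have 0: "0 \<in> slab" by (simp add: slab_def)
  have r: "{0..Lx} \<subseteq> rng 1" "{0..Ly} \<subseteq> rng 2" "{0..1} \<subseteq> rng 3" by (auto simp: rng_def)
  note I = integral_cell_slices[OF f, where x = 0] integral_cell_slices[OF continuous_on_avg[OF f], where x = 0]
  note c3 = continuous_on_slice_integral[OF f r(3)]
  have s1: "slice_integral 1 Lx (avg 1 g) x = slice_integral 1 Lx g x"
    and s2: "slice_integral 2 Ly (avg 2 g) x = slice_integral 2 Ly g x"
    and s3: "slice_integral 3 1 (avg 3 g) x = slice_integral 3 1 g x" for g x
    by (metis len_simps slice_integral_avg_same)+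
  have m3: "slice_integral 3 1 (avg i f) y = avg i (slice_integral 3 1 f) y" if "i \<noteq> 3" "y \<in> slab" for i y
    using slice_integral_avg_commute[OF f that] by simp
  have m2: "slice_integral 2 Ly (avg i (slice_integral 3 1 f)) y = avg i (slice_integral 2 Ly (slice_integral 3 1 f)) y"
    if "i \<noteq> 2" "y \<in> slab" for i y
    using slice_integral_avg_commute[OF c3 that] by simp
  consider "i = 1" | "i = 2" | "i = 3" using exhaust_3[of i] by auto
  thus ?thesis
  proof cases
    case 3
    have "slice_integral 3 1 (avg i f) = slice_integral 3 1 f"
      using s3 3 by auto
    thus ?thesis using I by simp
  next
    case 2
    have "slice_integral 2 Ly (slice_integral 3 1 (avg i f)) y = slice_integral 2 Ly (slice_integral 3 1 f) y"
      if "y \<in> slab" for y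
      unfolding 2 s2[of "slice_integral 3 1 f" y, symmetric]
      by (intro slice_integral_cong m3 r that) auto
    from slice_integral_cong[OF this r(1) 0] show ?thesis using I by simp
  next
    case 1
    have "slice_integral 2 Ly (slice_integral 3 1 (avg i f)) y = avg 1 (slice_integral 2 Ly (slice_integral 3 1 f)) y"
      if "y \<in> slab" for y
      unfolding 1 m2[OF _ that, of 1, simplified, symmetric]
      by (intro slice_integral_cong m3 r that) auto
    from slice_integral_cong[OF this r(1) 0] show ?thesis using I s1 by simp
  qed
qed

lemma integral_cell_mono:
  fixes f g :: "real^3 \<Rightarrow> real"
  assumes "continuous_on slab f" "continuous_on slab g" "\<And>x. x \<in> slab \<Longrightarrow> f x \<le> g x"
  shows "integral C f \<le> integral C g"
  using assms cell_subset_slab by (intro integral_le integrable_cell) auto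

text \<open>This lifts a one-dimensional inequality, valid on every coordinate line in direction
  \<open>i\<close>, to the cell.\<close>

lemma integral_cell_mono_avg:
  assumes "continuous_on slab f" "continuous_on slab g" "\<And>x. x \<in> slab \<Longrightarrow> avg i f x \<le> avg i g x"
  shows "integral C f \<le> integral C g"
  using integral_cell_mono[of "avg i f" "avg i g"] assms by (simp add: integral_avg continuous_on_avg)

text \<open>By the fundamental theorem of calculus the integral over each line is the difference of
  two end values, which agree.\<close>

lemma integral_pd_eq_zero:
  assumes h: "has_pd i h h'" and c: "continuous_on slab h'"
    and b: "\<And>x. x \<in> slab \<Longrightarrow> h (upd i (len i) x) = h (upd i 0 x)"
  shows "integral C h' = 0"
proof -
  have "avg i h' x = 0" if x: "x \<in> slab" for x
  proof -
    have "((\<lambda>s. h' (upd i s x)) has_integral (h (upd i (len i) x) - h (upd i 0 x))) {0..len i}"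
    proof (rule fundamental_theorem_of_calculus)
      show "((\<lambda>s. h (upd i s x)) has_vector_derivative h' (upd i s x)) (at s within {0..len i})"
        if "s \<in> {0..len i}" for s
        using DERIV_subset[OF has_pd_slice[OF h x] len_rng[of i]] len_rng[of i] that
        by (auto simp: has_real_derivative_iff_has_vector_derivative)
    qed (use len_pos[of i] in auto)
    thus ?thesis using b[OF x] by (simp add: avg_def slice_integral_def integral_unique)
  qed
  hence "integral C (avg i h') = integral C (\<lambda>x. 0)"
    using cell_subset_slab by (intro integral_cong) auto
  thus ?thesis by (simp add: integral_avg[OF c])
qed

end

section \<open>The Loomis--Whitney inequality\<close>

lemma AM_GM_3:
  fixes x y z :: real
  assumes "x \<ge> 0" "y \<ge> 0" "z \<ge> 0"
  shows "x * y * z \<le> ((x + y + z) / 3) ^ 3"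
proof -
  \<comment> \<open>A certificate of nonnegativity: the first summand is twice x^3 + y^3 + z^3 -
    3xyz, the second accounts for the mixed terms.\<close>
  have "2 * ((x + y + z) ^ 3 - 27 * (x * y * z)) =
      (x + y + z) * ((x - y)\<^sup>2 + (y - z)\<^sup>2 + (z - x)\<^sup>2)
      + 6 * (x * (y - z)\<^sup>2 + y * (z - x)\<^sup>2 + z * (x - y)\<^sup>2)"
    by (simp add: power2_eq_square power3_eq_cube algebra_simps)
  also have "\<dots> \<ge> 0" using assms by simp
  finally show ?thesis by (simp add: power_divide)
qed

text \<open>Demanded at all points rather than on the slab only, so that it rewrites without side
  conditions.\<close>

definition indep :: "3 \<Rightarrow> (real^3 \<Rightarrow> real) \<Rightarrow> bool" where
  "indep i f \<longleftrightarrow> (\<forall>s x. f (upd i s x) = f x)"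

lemma indepD [simp]: "indep i f \<Longrightarrow> f (upd i s x) = f x"
  by (simp add: indep_def)

context periodicity_cell
begin

definition per :: "3 \<Rightarrow> (real^3 \<Rightarrow> real) \<Rightarrow> bool" where
  "per i f \<longleftrightarrow> (\<forall>x\<in>slab. \<forall>s. f (upd i (s + len i) x) = f (upd i s x))"

lemma indep_avg: "indep i (avg i f)"
  by (simp add: indep_def)

lemma indep_avg_other: "indep i f \<Longrightarrow> indep i (avg j f)"
proof (cases "i = j")
  case False
  assume f: "indep i f"
  have "f (upd j r (upd i s x)) = f (upd j r x)" for r s x
    using f False by (simp add: upd_commute[of j i])
  thus ?thesis by (simp add: indep_def avg_def slice_integral_def)
qed (simp add: indep_avg)

lemma avg_indep: "indep i f \<Longrightarrow> avg i f x = f x"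
  using len_pos[of i] by (simp add: avg_def slice_integral_def)

lemma avg_mult_indep: "indep i g \<Longrightarrow> avg i (\<lambda>x. g x * f x) x = g x * avg i f x"
  by (simp add: avg_def slice_integral_def)

lemma upd_len_in_slab: "x \<in> slab \<Longrightarrow> s \<in> {0..len i} \<Longrightarrow> upd i s x \<in> slab"
  using len_rng upd_in_slab by blast

lemma slice_integrable:
  fixes f :: "real^3 \<Rightarrow> real"
  assumes "continuous_on slab f" "x \<in> slab"
  shows "(\<lambda>s. f (upd i s x)) integrable_on {0..len i}"
  by (rule integrable_continuous_interval continuous_on_subset[OF continuous_on_slice[OF assms] len_rng])+

lemma avg_mono:
  assumes "continuous_on slab f" "continuous_on slab g" "x \<in> slab" "\<And>x. x \<in> slab \<Longrightarrow> f x \<le> g x"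
  shows "avg i f x \<le> avg i g x"
  unfolding avg_def slice_integral_def using len_pos[of i] assms
  by (intro divide_right_mono integral_le slice_integrable) (auto simp: upd_len_in_slab)

lemma avg_nonneg:
  assumes "continuous_on slab f" "x \<in> slab" "\<And>x. x \<in> slab \<Longrightarrow> 0 \<le> f x"
  shows "0 \<le> avg i f x"
  using avg_mono[of "\<lambda>x. 0" f x i] assms by (simp add: avg_indep indep_def)

text \<open>Cauchy-Schwarz in a single variable; in terms of averages it carries no factor of the
  side length.\<close>

lemma avg_sqrt_mult:
  assumes "continuous_on slab f" "continuous_on slab g" "x \<in> slab"
    "\<And>x. x \<in> slab \<Longrightarrow> 0 \<le> f x" "\<And>x. x \<in> slab \<Longrightarrow> 0 \<le> g x"
  shows "avg i (\<lambda>x. sqrt (f x) * sqrt (g x)) x \<le> sqrt (avg i f x) * sqrt (avg i g x)"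
proof -
  define q where "q h s = h (upd i s x)" for h :: "real^3 \<Rightarrow> real" and s
  have q: "continuous_on {0..len i} (q h)" if "continuous_on slab h" for h
    unfolding q_def using continuous_on_subset[OF continuous_on_slice[OF that assms(3)] len_rng] .
  have nn: "0 \<le> q f s" "0 \<le> q g s" if "s \<in> {0..len i}" for s
    using assms that by (auto simp: q_def upd_len_in_slab)
  have "integral {0..len i} (\<lambda>s. sqrt (q f s) * sqrt (q g s))
    \<le> sqrt (integral {0..len i} (\<lambda>s. (sqrt (q f s))\<^sup>2)) * sqrt (integral {0..len i} (\<lambda>s. (sqrt (q g s))\<^sup>2))"
    using Cauchy_Schwarz_integral_continuous[of 0 "len i" "\<lambda>s. sqrt (q f s)" "\<lambda>s. sqrt (q g s)"]
    using q assms nn len_pos[of i] by (auto intro!: continuous_intros)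
  also have "integral {0..len i} (\<lambda>s. (sqrt (q f s))\<^sup>2) = integral {0..len i} (q f)"
    using nn by (intro integral_cong) simp
  also have "integral {0..len i} (\<lambda>s. (sqrt (q g s))\<^sup>2) = integral {0..len i} (q g)"
    using nn by (intro integral_cong) simp
  finally have "integral {0..len i} (\<lambda>s. sqrt (q f s) * sqrt (q g s)) / (sqrt (len i) * sqrt (len i))
    \<le> sqrt (integral {0..len i} (q f)) * sqrt (integral {0..len i} (q g)) / (sqrt (len i) * sqrt (len i))"
    using len_pos[of i] by (intro divide_right_mono) auto
  thus ?thesis using len_pos[of i]
    by (simp add: avg_def slice_integral_def q_def[abs_def] real_sqrt_divide)
qed

lemma integral_cell_avg:
  assumes f: "continuous_on slab f"
  shows "integral C f = Lx * Ly * avg 1 (avg 2 (avg 3 f)) x"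
  using integral_cell_slices[OF f, of x] Lx Ly
  by (simp add: avg_def[abs_def] slice_integral_def)

text \<open>The variables are integrated out one at a time: the factor independent of the current
  variable comes out, and Cauchy-Schwarz separates the other two. Each \<open>F\<close>, living on
  the whole cell, is also integrated over the variable it does not depend on; the division by
  \<open>Lx * Ly\<close> removes these extra lengths.\<close>

lemma loomis_whitney:
  assumes c: "continuous_on slab F1" "continuous_on slab F2" "continuous_on slab F3"
    and nn: "\<And>x. x \<in> slab \<Longrightarrow> 0 \<le> F1 x" "\<And>x. x \<in> slab \<Longrightarrow> 0 \<le> F2 x" "\<And>x. x \<in> slab \<Longrightarrow> 0 \<le> F3 x"
    and ind: "indep 1 F1" "indep 2 F2" "indep 3 F3"
  shows "integral C (\<lambda>x. sqrt (F1 x * F2 x * F3 x))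
    \<le> sqrt (integral C F1 * integral C F2 * integral C F3 / (Lx * Ly))"
proof -
  have 0: "0 \<in> slab" by (simp add: slab_def)
  have sq: "indep i f \<Longrightarrow> indep i (\<lambda>x. sqrt (f x))" for i f by (simp add: indep_def)
  note ind' = ind ind[THEN indep_avg_other]
  note ci = continuous_on_avg continuous_on_mult continuous_on_real_sqrt c
  define H where "H = (\<lambda>x. sqrt (F3 x) * (sqrt (F1 x) * sqrt (F2 x)))"
  have cH: "continuous_on slab H" unfolding H_def by (intro ci)
  have 1: "avg 3 H x \<le> sqrt (avg 3 F2 x) * (sqrt (F3 x) * sqrt (avg 3 F1 x))" if "x \<in> slab" for x
    unfolding H_def avg_mult_indep[OF sq[OF ind(3)]]
    using avg_sqrt_mult[OF c(1,2) that nn(1,2), of 3] nn(3)[OF that]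
    by (auto simp: mult_ac mult_left_mono)
  have 2: "avg 2 (avg 3 H) x \<le> sqrt (avg 2 (avg 3 F1) x) * (sqrt (avg 3 F2 x) * sqrt (avg 2 F3 x))" if "x \<in> slab" for x
  proof -
    have "avg 2 (avg 3 H) x \<le> avg 2 (\<lambda>x. sqrt (avg 3 F2 x) * (sqrt (F3 x) * sqrt (avg 3 F1 x))) x"
      by (intro avg_mono 1 that ci cH)
    also have "\<dots> = sqrt (avg 3 F2 x) * avg 2 (\<lambda>x. sqrt (F3 x) * sqrt (avg 3 F1 x)) x"
      by (intro avg_mult_indep sq ind')
    also have "\<dots> \<le> sqrt (avg 3 F2 x) * (sqrt (avg 2 F3 x) * sqrt (avg 2 (avg 3 F1) x))"
      using that nn c by (intro mult_left_mono avg_sqrt_mult ci avg_nonneg) (auto intro!: avg_nonneg)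
    finally show ?thesis by (simp add: mult_ac)
  qed
  have "avg 1 (avg 2 (avg 3 H)) 0
      \<le> avg 1 (\<lambda>x. sqrt (avg 2 (avg 3 F1) x) * (sqrt (avg 3 F2 x) * sqrt (avg 2 F3 x))) 0"
    by (intro avg_mono 2 0 ci cH)
  also have "\<dots> = sqrt (avg 2 (avg 3 F1) 0) * avg 1 (\<lambda>x. sqrt (avg 3 F2 x) * sqrt (avg 2 F3 x)) 0"
    by (intro avg_mult_indep sq ind' indep_avg_other)
  also have "\<dots> \<le> sqrt (avg 2 (avg 3 F1) 0) * (sqrt (avg 1 (avg 3 F2) 0) * sqrt (avg 1 (avg 2 F3) 0))"
    using nn c 0 by (intro mult_left_mono avg_sqrt_mult ci avg_nonneg) (auto intro!: avg_nonneg ci)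
  \<comment> \<open>Averaging each factor also over the variable it does not depend on completes the
    partial averages to integrals over the cell.\<close>
  also have "avg 2 (avg 3 F1) 0 = avg 1 (avg 2 (avg 3 F1)) 0"
    by (rule avg_indep[symmetric]) (intro indep_avg_other ind)
  also have "avg 3 F2 = avg 2 (avg 3 F2)"
    using avg_indep[OF ind'(5)] by auto
  also have "avg 2 F3 = avg 2 (avg 3 F3)"
    using avg_indep[OF ind(3)] by (metis ext)
  finally have "integral C H / (Lx * Ly) \<le>
      sqrt (integral C F1 / (Lx * Ly)) * (sqrt (integral C F2 / (Lx * Ly)) * sqrt (integral C F3 / (Lx * Ly)))"
    using Lx Ly by (simp add: integral_cell_avg[OF c(1), of 0] integral_cell_avg[OF c(2), of 0]
        integral_cell_avg[OF c(3), of 0] integral_cell_avg[OF cH, of 0])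
  also have "\<dots> = sqrt (integral C F1 * integral C F2 * integral C F3 / (Lx * Ly)) / (Lx * Ly)"
  proof -
    have "sqrt (Lx * Ly) * sqrt (Lx * Ly) = Lx * Ly" using Lx Ly by simp
    thus ?thesis by (simp add: real_sqrt_divide real_sqrt_mult)
  qed
  finally show ?thesis
    using Lx Ly by (simp add: H_def real_sqrt_mult mult_ac divide_le_cancel)
qed

text \<open>The bounds are constant along direction \<open>i\<close>, which is the shape required of
  the factors in \<open>loomis_whitney\<close>.\<close>

lemma le_avg_plus:
  assumes f: "has_pd i f f'" and c: "continuous_on slab f'" and x: "x \<in> C"
  shows "f x \<le> avg i f x + len i * avg i (\<lambda>x. \<bar>f' x\<bar>) x"
    and "per i f \<Longrightarrow> f x \<le> avg i f x + len i / 2 * avg i (\<lambda>x. \<bar>f' x\<bar>) x"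
proof -
  have xs: "x \<in> slab" using x cell_subset_slab by blast
  have xi: "x $ i \<in> {0..len i}"
    using x exhaust_3[of i] by (auto simp: cell_def)
  have d: "((\<lambda>s. f (upd i s x)) has_real_derivative f' (upd i s x)) (at s within {0..len i})"
    if "s \<in> {0..len i}" for s
    using DERIV_subset[OF has_pd_slice[OF f xs] len_rng[of i]] len_rng[of i] that by auto
  have c': "continuous_on {0..len i} (\<lambda>s. f' (upd i s x))"
    using continuous_on_subset[OF continuous_on_slice[OF c xs] len_rng] .
  note L = le_average_plus_total_variation[OF len_pos xi d c', simplified upd_triv]
  show "f x \<le> avg i f x + len i * avg i (\<lambda>x. \<bar>f' x\<bar>) x"
    using L(1) len_pos[of i] by (simp add: avg_def slice_integral_def)
  show "f x \<le> avg i f x + len i / 2 * avg i (\<lambda>x. \<bar>f' x\<bar>) x" if p: "per i f"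
  proof -
    have "f (upd i 0 x) = f (upd i (len i) x)"
      using p[unfolded per_def, rule_format, OF xs, of 0] by simp
    thus ?thesis using L(2) len_pos[of i] by (simp add: avg_def slice_integral_def)
  qed
qed

text \<open>The embedding of W^{1,1} into L^{3/2}: \<open>g\<close> lies below three functions, each
  independent of one coordinate, so g^{3/2} lies below the root of their product. Periodicity halves
  the horizontal variation terms only.\<close>

lemma integral_power_three_halves_le:
  assumes g: "continuous_on slab g" "\<And>x. x \<in> slab \<Longrightarrow> 0 \<le> g x"
    and d: "\<And>i. has_pd i g (g' i)" "\<And>i. continuous_on slab (g' i)"
    and p: "per 1 g" "per 2 g"
  shows "integral C (\<lambda>x. g x * sqrt (g x)) \<le> sqrt (
      (integral C g / Lx + integral C (\<lambda>x. \<bar>g' 1 x\<bar>) / 2) *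
      (integral C g / Ly + integral C (\<lambda>x. \<bar>g' 2 x\<bar>) / 2) *
      (integral C g + integral C (\<lambda>x. \<bar>g' 3 x\<bar>)))"
proof -
  define F where "F i c x = avg i g x + c * avg i (\<lambda>x. \<bar>g' i x\<bar>) x" for i c x
  have cF: "continuous_on slab (F i c)" for i c
    unfolding F_def by (intro continuous_intros g d)
  have iF: "indep i (F i c)" for i c by (simp add: F_def[abs_def] indep_def)
  have nF: "0 \<le> F i c x" if "0 \<le> c" "x \<in> slab" for i c x
    unfolding F_def using that g d by (intro add_nonneg_nonneg mult_nonneg_nonneg avg_nonneg)
      (auto intro!: continuous_intros)
  have intF: "integral C (F i c) = integral C g + c * integral C (\<lambda>x. \<bar>g' i x\<bar>)" for i c
  proof -
    have "integral C (F i c) = integral C (avg i g) + integral C (\<lambda>x. c * avg i (\<lambda>x. \<bar>g' i x\<bar>) x)"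
      unfolding F_def by (intro integral_add integrable_cell continuous_intros g d)
    thus ?thesis using g d by (simp add: integral_avg continuous_on_rabs)
  qed
  have le: "g x \<le> F 1 (Lx / 2) x" "g x \<le> F 2 (Ly / 2) x" "g x \<le> F 3 1 x" if "x \<in> C" for x
    using le_avg_plus(2)[OF d that p(1)] le_avg_plus(2)[OF d that p(2)] le_avg_plus(1)[OF d that, of 3]
    by (simp_all add: F_def)
  have "integral C (\<lambda>x. g x * sqrt (g x)) \<le> integral C (\<lambda>x. sqrt (F 1 (Lx / 2) x * F 2 (Ly / 2) x * F 3 1 x))"
  proof (intro integral_le integrable_cell continuous_intros g cF)
    fix x assume x: "x \<in> C"
    hence g0: "0 \<le> g x" using g(2) cell_subset_slab by blast
    have "g x * sqrt (g x) = sqrt (g x * g x * g x)" using g0 by (simp add: real_sqrt_mult)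
    also have "\<dots> \<le> sqrt (F 1 (Lx / 2) x * F 2 (Ly / 2) x * F 3 1 x)"
      using le[OF x] g0 by (intro real_sqrt_le_mono mult_mono) (auto intro: order_trans)
    finally show "g x * sqrt (g x) \<le> sqrt (F 1 (Lx / 2) x * F 2 (Ly / 2) x * F 3 1 x)" .
  qed
  also have "\<dots> \<le> sqrt (integral C (F 1 (Lx / 2)) * integral C (F 2 (Ly / 2)) * integral C (F 3 1) / (Lx * Ly))"
    using Lx Ly by (intro loomis_whitney cF iF nF) auto
  also have "integral C (F 1 (Lx / 2)) * integral C (F 2 (Ly / 2)) * integral C (F 3 1) / (Lx * Ly) =
      (integral C (F 1 (Lx / 2)) / Lx) * (integral C (F 2 (Ly / 2)) / Ly) * integral C (F 3 1)"
    by simp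
  finally show ?thesis using Lx Ly by (simp add: intF add_divide_distrib)
qed

lemma Cauchy_Schwarz_cell:
  assumes "continuous_on slab f" "continuous_on slab g"
    and "\<And>x. x \<in> slab \<Longrightarrow> 0 \<le> f x" "\<And>x. x \<in> slab \<Longrightarrow> 0 \<le> g x"
  shows "integral C (\<lambda>x. f x * g x) \<le> sqrt (integral C (\<lambda>x. (f x)\<^sup>2)) * sqrt (integral C (\<lambda>x. (g x)\<^sup>2))"
  using assms cell_subset_slab box_ne unfolding cell_cbox
  by (intro Cauchy_Schwarz_integral_continuous) (auto intro: continuous_on_subset)

end

section \<open>Constants and scalar Poincare inequalities\<close>

text \<open>The constant equals sqrt (8/3) times (2/pi)^(2/3), about 1.208; each factor is bounded
  below by a decimal.\<close>

lemma sobolev_constant_lower_bound: "1205 / 1000 \<le> 2 * sqrt 2 * C\<^sub>3"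
proof -
  have pi2: "pi\<^sup>2 \<le> (3142 / 1000)\<^sup>2" using pi_approx(2) by (intro power_mono) auto
  \<comment> \<open>Cubing removes the fractional power, leaving a rational comparison with an upper
    bound for pi.\<close>
  have "(739 / 1000) ^ 3 \<le> (2 / pi)\<^sup>2"
    using pi2 by (simp add: power_divide field_simps)
  also have "(2 / pi)\<^sup>2 = ((2 / pi) powr (2 / 3)) ^ 3"
    by (subst powr_power) auto
  finally have 1: "739 / 1000 \<le> (2 / pi) powr (2 / 3)"
    by (subst (asm) power_mono_iff) auto
  have "1632 / 1000 \<le> sqrt (8 / 3)" by (intro real_le_rsqrt) (simp add: power2_eq_square)
  hence "1632 / 1000 * (739 / 1000) \<le> sqrt (8 / 3) * (2 / pi) powr (2 / 3)"
    using 1 by (intro mult_mono) auto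
  also have "sqrt (8 / 3) = 2 * sqrt 2 / sqrt 3"
    using real_sqrt_mult[of 4 2] by (simp add: real_sqrt_divide)
  also have "2 * sqrt 2 / sqrt 3 * (2 / pi) powr (2 / 3) = 2 * sqrt 2 * C\<^sub>3"
    by (simp add: C\<^sub>3_def powr_divide)
  finally show ?thesis by simp
qed

context periodicity_cell
begin

lemma lambda_le: "lambda\<^sub>1 Lx Ly \<le> pi" "lambda\<^sub>1 Lx Ly \<le> 2 * pi / Lx" "lambda\<^sub>1 Lx Ly \<le> 2 * pi / Ly"
  by (auto simp: lambda\<^sub>1_def)

lemma lambda_pos: "0 < lambda\<^sub>1 Lx Ly"
  using Lx Ly by (simp add: lambda\<^sub>1_def)

lemma C\<^sub>S_pos: "0 < C\<^sub>S Lx Ly"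
proof -
  have "0 < 2 * sqrt 2 * C\<^sub>3" using sobolev_constant_lower_bound by linarith
  moreover have "0 < 1 + sqrt (1 + 1 / Lx\<^sup>2 + 1 / Ly\<^sup>2) / lambda\<^sub>1 Lx Ly"
    using lambda_pos by (intro add_pos_nonneg) auto
  ultimately show ?thesis unfolding C\<^sub>S_def by (rule mult_pos_pos)
qed

lemma C\<^sub>P_bounds: "(1 / pi)\<^sup>2 \<le> (C\<^sub>P Lx Ly)\<^sup>2" "(Lx / (2 * pi))\<^sup>2 \<le> (C\<^sub>P Lx Ly)\<^sup>2" "(Ly / (2 * pi))\<^sup>2 \<le> (C\<^sub>P Lx Ly)\<^sup>2"
  using lambda_le lambda_pos Lx Ly
  by (intro power_mono; simp add: C\<^sub>P_def field_simps)+

text \<open>Factoring out \<open>2\<close>, \<open>2\<close>, \<open>4\<close> before AM-GM treats \<open>d1\<close>, \<open>d2\<close>, \<open>d3\<close> symmetrically. This alone costs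
  the constant \<open>16 powr (1/3) / sqrt 3\<close>, which exceeds \<open>2 sqrt 2 C\<^sub>3\<close>; the deficit is covered by the second
  summand of \<open>C\<^sub>S\<close>, because the sides of the cell are at most \<open>2 \<pi> / \<lambda>\<^sub>1\<close> and \<open>\<lambda>\<^sub>1 \<le> \<pi>\<close>.\<close>

lemma anisotropic_product_le:
  assumes b: "0 \<le> b" "b \<le> C\<^sub>P Lx Ly * D" and d: "0 \<le> d1" "0 \<le> d2" "0 \<le> d3"
    and D: "d1\<^sup>2 + d2\<^sup>2 + d3\<^sup>2 \<le> D\<^sup>2" "0 \<le> D"
  shows "(b / Lx + 2 * d1) * (b / Ly + 2 * d2) * (b + 4 * d3) \<le> (C\<^sub>S Lx Ly * D) ^ 3"
proof -
  define l where "l = lambda\<^sub>1 Lx Ly"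
  define \<alpha> where "\<alpha> = 1 / Lx"
  define \<beta> where "\<beta> = 1 / Ly"
  define K where "K = sqrt (1 + 1 / Lx\<^sup>2 + 1 / Ly\<^sup>2)"
  have l: "0 < l" using lambda_pos by (simp add: l_def)
  have ab: "0 < \<alpha>" "0 < \<beta>" using Lx Ly by (auto simp: \<alpha>_def \<beta>_def)
  \<comment> \<open>Cauchy-Schwarz with three terms; 1.733 is a decimal just above sqrt 3.\<close>
  have "(d1 + d2 + d3)\<^sup>2 \<le> 3 * (d1\<^sup>2 + d2\<^sup>2 + d3\<^sup>2)"
    using zero_le_power2[of "d1 - d2"] zero_le_power2[of "d2 - d3"] zero_le_power2[of "d1 - d3"]
    by (simp add: power2_eq_square algebra_simps)
  also have "\<dots> \<le> 3 * D\<^sup>2" using D by simp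
  also have "\<dots> \<le> (1733 / 1000 * D)\<^sup>2" by (simp add: power2_eq_square)
  finally have dsum: "d1 + d2 + d3 \<le> 1733 / 1000 * D"
    using D by (intro power2_le_imp_le[of "d1 + d2 + d3"]) auto
  \<comment> \<open>This is Cauchy-Schwarz for (2, 1, 1) and (1, \<open>\<alpha>\<close>,
    \<open>\<beta>\<close>), and 0.408 is just below 1 / sqrt 6. The weight 2 makes \<open>K\<close>
    dominate both the constant and \<open>\<alpha> + \<beta>\<close>.\<close>
  have "(408 / 1000 * (2 + \<alpha> + \<beta>))\<^sup>2 \<le> (2 + \<alpha> + \<beta>)\<^sup>2 / 6"
    unfolding power_mult_distrib by (simp add: power2_eq_square)
  also have "\<dots> \<le> 1 + \<alpha>\<^sup>2 + \<beta>\<^sup>2"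
    using zero_le_power2[of "1 - 2 * \<alpha>"] zero_le_power2[of "1 - 2 * \<beta>"] zero_le_power2[of "\<alpha> - \<beta>"]
    by (simp add: power2_eq_square algebra_simps)
  finally have K: "408 / 1000 * (2 + \<alpha> + \<beta>) \<le> K"
    unfolding K_def by (intro real_le_rsqrt) (simp add: \<alpha>_def \<beta>_def power_divide)
  have al: "l / (2 * pi) \<le> \<alpha>" "l / (2 * pi) \<le> \<beta>"
    using lambda_le Lx Ly by (auto simp: l_def \<alpha>_def \<beta>_def field_simps)
  have pi: "318 / 1000 \<le> 1 / pi" using pi_approx(2) by (simp add: field_simps)
  have "318 / 1000 * l \<le> 1"
  proof -
    have "318 / 1000 * l \<le> 1 / pi * pi" using lambda_le(1) pi l by (intro mult_mono) (auto simp: l_def)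
    thus ?thesis by simp
  qed
  moreover have "318 / 1000 * l \<le> \<alpha> + \<beta>"
  proof -
    have "318 / 1000 * l \<le> 1 / pi * l" using pi l by (intro mult_right_mono) auto
    also have "\<dots> = l / (2 * pi) + l / (2 * pi)" by simp
    also have "\<dots> \<le> \<alpha> + \<beta>" using al by (rule add_mono)
    finally show ?thesis .
  qed
  \<comment> \<open>The coefficient of \<open>l\<close> on the left exceeds 1.205 by about 0.25; the
    slack in \<open>K\<close> pays for it, since \<open>l\<close> is bounded by multiples of 1 and
    of \<open>\<alpha> + \<beta>\<close>.\<close>
  ultimately have num: "84 / 100 * 1733 / 1000 * l + 42 / 100 * (\<alpha> + \<beta> + 1 / 2) \<le> 1205 / 1000 * (l + K)"
    using K by argo
  \<comment> \<open>\<open>X\<close> is the sum of the three factors after extracting 16 = 2 * 2 *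
    4. By AM-GM their product is at most 16 (X/3)^3, and 0.84 is just above the cube root of 16
    divided by 3.\<close>
  define X where "X = b * ((\<alpha> + \<beta> + 1 / 2) / 2) + (d1 + d2 + d3)"
  have "b * ((\<alpha> + \<beta> + 1 / 2) / 2) \<le> D / l * ((\<alpha> + \<beta> + 1 / 2) / 2)"
    using b ab by (intro mult_right_mono) (auto simp: C\<^sub>P_def l_def)
  hence "84 / 100 * X \<le> 84 / 100 * (D / l * ((\<alpha> + \<beta> + 1 / 2) / 2) + 1733 / 1000 * D)"
    using dsum unfolding X_def by (intro mult_left_mono add_mono) auto
  also have "\<dots> = D / l * (84 / 100 * 1733 / 1000 * l + 42 / 100 * (\<alpha> + \<beta> + 1 / 2))"
    using l by (simp add: field_simps)
  also have "\<dots> \<le> D / l * (1205 / 1000 * (l + K))"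
    using num D l by (intro mult_left_mono) auto
  also have "\<dots> = 1205 / 1000 * (1 + K / l) * D"
    using l by (simp add: field_simps)
  also have "\<dots> \<le> C\<^sub>S Lx Ly * D"
    unfolding C\<^sub>S_def K_def[symmetric] l_def[symmetric]
    using sobolev_constant_lower_bound D l by (intro mult_right_mono) (auto simp: K_def)
  finally have X: "84 / 100 * X \<le> C\<^sub>S Lx Ly * D" .
  have X0: "0 \<le> X" using b ab d by (simp add: X_def)
  have "(b / Lx + 2 * d1) * (b / Ly + 2 * d2) * (b + 4 * d3)
      = 16 * ((b * \<alpha> / 2 + d1) * (b * \<beta> / 2 + d2) * (b / 4 + d3))"
    by (simp add: \<alpha>_def \<beta>_def algebra_simps add_divide_distrib)
  also have "\<dots> \<le> 16 * (((b * \<alpha> / 2 + d1) + (b * \<beta> / 2 + d2) + (b / 4 + d3)) / 3) ^ 3"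
    using b ab d by (intro mult_left_mono AM_GM_3) auto
  also have "\<dots> = 16 * (X / 3) ^ 3"
    by (simp add: X_def algebra_simps add_divide_distrib)
  also have "\<dots> \<le> (84 / 100 * X) ^ 3"
    using X0 by (simp add: power3_eq_cube)
  also have "\<dots> \<le> (C\<^sub>S Lx Ly * D) ^ 3"
    using X X0 by (intro power_mono) auto
  finally show ?thesis .
qed

section \<open>Poincare inequalities for scalar functions on the cell\<close>

lemma poincare_dirichlet:
  assumes f: "continuous_on slab f" "has_pd 3 f f'" "continuous_on slab f'"
    and b: "\<And>x. x \<in> slab \<Longrightarrow> f (upd 3 0 x) = 0" "\<And>x. x \<in> slab \<Longrightarrow> f (upd 3 1 x) = 0"
  shows "integral C (\<lambda>x. (f x)\<^sup>2) \<le> (C\<^sub>P Lx Ly)\<^sup>2 * integral C (\<lambda>x. (f' x)\<^sup>2)"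
proof -
  have "integral C (\<lambda>x. (f x)\<^sup>2) \<le> integral C (\<lambda>x. (1 / pi)\<^sup>2 * (f' x)\<^sup>2)"
  proof (rule integral_cell_mono_avg[where i = 3])
    fix x assume x: "x \<in> slab"
    have "integral {0..1} (\<lambda>s. (f (upd 3 s x))\<^sup>2)
        \<le> ((1 - 0) / pi)\<^sup>2 * integral {0..1} (\<lambda>s. (f' (upd 3 s x))\<^sup>2)"
      by (rule wirtinger_dirichlet)
         (use has_pd_slice[OF f(2) x] b[OF x] continuous_on_slice[OF f(3) x, of 3] in \<open>auto simp: rng_def\<close>)
    thus "avg 3 (\<lambda>x. (f x)\<^sup>2) x \<le> avg 3 (\<lambda>x. (1 / pi)\<^sup>2 * (f' x)\<^sup>2) x"
      by (simp add: avg_def slice_integral_def)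
  qed (intro continuous_intros f)+
  also have "\<dots> = (1 / pi)\<^sup>2 * integral C (\<lambda>x. (f' x)\<^sup>2)" by simp
  also have "\<dots> \<le> (C\<^sub>P Lx Ly)\<^sup>2 * integral C (\<lambda>x. (f' x)\<^sup>2)"
    using f by (intro mult_right_mono C\<^sub>P_bounds integral_nonneg integrable_cell continuous_intros) auto
  finally show ?thesis .
qed

text \<open>Wirtinger's inequality on every line in direction \<open>i\<close>. Periodicity does not
  fix the mean, so only the variance along the line is controlled.\<close>

lemma variance_periodic:
  assumes f: "continuous_on slab f" "has_pd i f f'" "continuous_on slab f'" "per i f" and i: "i \<noteq> 3"
  shows "integral C (\<lambda>x. (f x)\<^sup>2) - integral C (\<lambda>x. (avg i f x)\<^sup>2)
    \<le> (C\<^sub>P Lx Ly)\<^sup>2 * integral C (\<lambda>x. (f' x)\<^sup>2)"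
proof -
  have le: "(len i / (2 * pi))\<^sup>2 \<le> (C\<^sub>P Lx Ly)\<^sup>2"
    using i exhaust_3[of i] C\<^sub>P_bounds by auto
  have "integral C (\<lambda>x. (f x)\<^sup>2) \<le> integral C (\<lambda>x. (avg i f x)\<^sup>2 + (len i / (2 * pi))\<^sup>2 * (f' x)\<^sup>2)"
  proof (rule integral_cell_mono_avg[where i = i])
    fix x assume x: "x \<in> slab"
    have r: "rng i = UNIV" using i by (simp add: rng_def)
    define q where "q s = f (upd i s x)" for s
    define q' where "q' s = f' (upd i s x)" for s
    have "integral {0..len i} (\<lambda>s. (q s)\<^sup>2) - (integral {0..len i} q)\<^sup>2 / len i
        \<le> (len i / (2 * pi))\<^sup>2 * integral {0..len i} (\<lambda>s. (q' s)\<^sup>2)"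
      using has_pd_slice[OF f(2) x] f(4) x continuous_on_slice[OF f(3) x, of i]
      by (intro wirtinger_periodic len_pos) (auto simp: r per_def q_def q'_def)
    hence "integral {0..len i} (\<lambda>s. (q s)\<^sup>2) / len i
        \<le> ((integral {0..len i} q)\<^sup>2 / len i + (len i / (2 * pi))\<^sup>2 * integral {0..len i} (\<lambda>s. (q' s)\<^sup>2)) / len i"
      using len_pos[of i] by (intro divide_right_mono) auto
    also have "\<dots> = (avg i f x)\<^sup>2 + (len i / (2 * pi))\<^sup>2 * avg i (\<lambda>x. (f' x)\<^sup>2) x"
      by (simp add: avg_def slice_integral_def q_def[abs_def] q'_def[abs_def] add_divide_distrib
          power_divide power2_eq_square)
    also have "\<dots> = avg i (\<lambda>x. (avg i f x)\<^sup>2 + (len i / (2 * pi))\<^sup>2 * (f' x)\<^sup>2) x"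
    proof -
      have "integral {0..len i} (\<lambda>s. (avg i f x)\<^sup>2 + (len i / (2 * pi))\<^sup>2 * (f' (upd i s x))\<^sup>2)
        = len i * (avg i f x)\<^sup>2 + (len i / (2 * pi))\<^sup>2 * integral {0..len i} (\<lambda>s. (f' (upd i s x))\<^sup>2)"
        using slice_integrable[OF continuous_on_power[OF f(3)] x, of i 2] len_pos[of i]
        by (subst integral_add) (auto intro: integrable_on_mult_right)
      thus ?thesis using len_pos[of i]
        by (simp add: avg_def[of i "\<lambda>x. (f' x)\<^sup>2"] avg_def[of i "\<lambda>x. (avg i f x)\<^sup>2 + (len i / (2 * pi))\<^sup>2 * (f' x)\<^sup>2"]
            slice_integral_def add_divide_distrib)
    qed
    finally show "avg i (\<lambda>x. (f x)\<^sup>2) x \<le> avg i (\<lambda>x. (avg i f x)\<^sup>2 + (len i / (2 * pi))\<^sup>2 * (f' x)\<^sup>2) x"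
      by (simp add: avg_def[of i "\<lambda>x. (f x)\<^sup>2"] slice_integral_def q_def)
  qed (intro continuous_intros f)+
  also have "\<dots> = integral C (\<lambda>x. (avg i f x)\<^sup>2) + (len i / (2 * pi))\<^sup>2 * integral C (\<lambda>x. (f' x)\<^sup>2)"
    using f by (subst integral_add) (auto intro!: integrable_cell continuous_intros)
  also have "\<dots> \<le> integral C (\<lambda>x. (avg i f x)\<^sup>2) + (C\<^sub>P Lx Ly)\<^sup>2 * integral C (\<lambda>x. (f' x)\<^sup>2)"
    using f by (intro add_left_mono mult_right_mono le integral_nonneg integrable_cell continuous_intros) auto
  finally show ?thesis by simp
qed

lemma integral_square_expand:
  fixes f h k :: "real^3 \<Rightarrow> real"
  assumes "continuous_on slab f" "continuous_on slab h" "continuous_on slab k"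
  shows "integral C (\<lambda>x. (f x - h x - k x)\<^sup>2) = integral C (\<lambda>x. (f x)\<^sup>2) + integral C (\<lambda>x. (h x)\<^sup>2)
    + integral C (\<lambda>x. (k x)\<^sup>2) - 2 * integral C (\<lambda>x. h x * f x) - 2 * integral C (\<lambda>x. k x * f x)
    + 2 * integral C (\<lambda>x. h x * k x)"
proof -
  have "((\<lambda>x. (f x)\<^sup>2 + (h x)\<^sup>2 + (k x)\<^sup>2 - 2 * (h x * f x) - 2 * (k x * f x) + 2 * (h x * k x)) has_integral
    integral C (\<lambda>x. (f x)\<^sup>2) + integral C (\<lambda>x. (h x)\<^sup>2)
    + integral C (\<lambda>x. (k x)\<^sup>2) - 2 * integral C (\<lambda>x. h x * f x) - 2 * integral C (\<lambda>x. k x * f x)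
    + 2 * integral C (\<lambda>x. h x * k x)) C"
    by (intro has_integral_add has_integral_diff has_integral_mult_right integrable_integral integrable_cell
        continuous_intros assms)
  moreover have "(\<lambda>x. (f x - h x - k x)\<^sup>2)
      = (\<lambda>x. (f x)\<^sup>2 + (h x)\<^sup>2 + (k x)\<^sup>2 - 2 * (h x * f x) - 2 * (k x * f x) + 2 * (h x * k x))"
    by (auto simp: power2_eq_square algebra_simps)
  ultimately show ?thesis by (simp add: integral_unique)
qed

text \<open>Tensorization of the variance: the square of \<open>f - avg 1 f - avg 2 f\<close> has nonnegative integral.\<close>

lemma poincare_horizontal:
  assumes f: "continuous_on slab f" "\<And>i. has_pd i f (f' i)" "\<And>i. continuous_on slab (f' i)" "per 1 f" "per 2 f"
    and m: "\<And>x. x \<in> slab \<Longrightarrow> avg 1 (avg 2 f) x = 0"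
  shows "integral C (\<lambda>x. (f x)\<^sup>2) \<le> (C\<^sub>P Lx Ly)\<^sup>2 * (integral C (\<lambda>x. (f' 1 x)\<^sup>2) + integral C (\<lambda>x. (f' 2 x)\<^sup>2))"
proof -
  define h where "h = avg 1 f"
  define k where "k = avg 2 f"
  have ch: "continuous_on slab h" and ck: "continuous_on slab k"
    unfolding h_def k_def by (intro continuous_intros f)+
  have hk: "indep 1 h" "indep 2 k" by (simp_all add: h_def k_def indep_avg)
  \<comment> \<open>\<open>h\<close> is the orthogonal projection of \<open>f\<close> onto the
    functions independent of coordinate 1, so its scalar product with \<open>f\<close> is its own
    square norm; likewise for \<open>k\<close>.\<close>
  have "integral C (\<lambda>x. h x * f x) = integral C (avg 1 (\<lambda>x. h x * f x))"
    by (rule integral_avg[symmetric]) (intro continuous_intros f ch)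
  hence 1: "integral C (\<lambda>x. h x * f x) = integral C (\<lambda>x. (h x)\<^sup>2)"
    using hk by (simp add: avg_mult_indep[OF hk(1), THEN ext] power2_eq_square flip: h_def)
  have "integral C (\<lambda>x. k x * f x) = integral C (avg 2 (\<lambda>x. k x * f x))"
    by (rule integral_avg[symmetric]) (intro continuous_intros f ck)
  hence 2: "integral C (\<lambda>x. k x * f x) = integral C (\<lambda>x. (k x)\<^sup>2)"
    using hk by (simp add: avg_mult_indep[OF hk(2), THEN ext] power2_eq_square flip: k_def)
  \<comment> \<open>The two projections are orthogonal because averaging \<open>k\<close> over
    coordinate 1 gives the full horizontal mean, which vanishes.\<close>
  have "integral C (\<lambda>x. h x * k x) = integral C (avg 1 (\<lambda>x. h x * k x))"
    by (rule integral_avg[symmetric]) (intro continuous_intros ch ck)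
  also have "\<dots> = integral C (\<lambda>x. 0)"
    using cell_subset_slab m hk
    by (intro integral_cong) (auto simp: avg_mult_indep k_def)
  finally have 3: "integral C (\<lambda>x. h x * k x) = 0" by simp
  have "0 \<le> integral C (\<lambda>x. (f x - h x - k x)\<^sup>2)"
    by (intro integral_nonneg integrable_cell continuous_intros f ch ck) auto
  hence "integral C (\<lambda>x. (h x)\<^sup>2) + integral C (\<lambda>x. (k x)\<^sup>2) \<le> integral C (\<lambda>x. (f x)\<^sup>2)"
    using integral_square_expand[OF f(1) ch ck] 1 2 3 by simp
  \<comment> \<open>The two variances add up to 2|f|^2 - |h|^2 - |k|^2 in square norms, at least
    |f|^2 by the Bessel inequality just obtained; so no factor is lost against dimension
    one.\<close>
  moreover have "integral C (\<lambda>x. (f x)\<^sup>2) - integral C (\<lambda>x. (h x)\<^sup>2) \<le> (C\<^sub>P Lx Ly)\<^sup>2 * integral C (\<lambda>x. (f' 1 x)\<^sup>2)"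
    unfolding h_def by (intro variance_periodic f) auto
  moreover have "integral C (\<lambda>x. (f x)\<^sup>2) - integral C (\<lambda>x. (k x)\<^sup>2) \<le> (C\<^sub>P Lx Ly)\<^sup>2 * integral C (\<lambda>x. (f' 2 x)\<^sup>2)"
    unfolding k_def by (intro variance_periodic f) auto
  ultimately show ?thesis unfolding distrib_left by linarith
qed

end

section \<open>Ferromagnetic fields\<close>

lemma norm_sq_3: "(norm v)\<^sup>2 = (v $ 1)\<^sup>2 + (v $ 2)\<^sup>2 + (v $ 3)\<^sup>2" for v :: "real^3"
  by (simp only: power2_norm_eq_inner inner_vec_def sum_3) (simp add: power2_eq_square)

lemma inner_3: "v \<bullet> w = v $ 1 * w $ 1 + v $ 2 * w $ 2 + v $ 3 * w $ 3" for v w :: "real^3"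
  by (simp add: inner_vec_def sum_3)

lemma slice_integral_diff:
  assumes "continuous_on slab f" "continuous_on slab g" "{0..c} \<subseteq> rng i" "x \<in> slab"
  shows "slice_integral i c (\<lambda>x. f x - g x) x = slice_integral i c f x - slice_integral i c g x"
  unfolding slice_integral_def
  by (intro integral_diff integrable_continuous_interval continuous_on_subset[OF continuous_on_slice] assms)

section \<open>Integration by parts, the Hoelder estimate and the work of the Lorentz force\<close>

context periodicity_cell
begin

lemma integral_cell_nonneg:
  "continuous_on slab f \<Longrightarrow> (\<And>x. x \<in> slab \<Longrightarrow> 0 \<le> f x) \<Longrightarrow> 0 \<le> integral C f" for f :: "real^3 \<Rightarrow> real"
  using cell_subset_slab by (intro integral_nonneg integrable_cell) auto

lemma integral_cell_add:
  "continuous_on slab f \<Longrightarrow> continuous_on slab g \<Longrightarrow> integral C (\<lambda>x. f x + g x) = integral C f + integral C g"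
  for f g :: "real^3 \<Rightarrow> real"
  by (intro integral_add integrable_cell)

lemma integral_cell_diff:
  "continuous_on slab f \<Longrightarrow> continuous_on slab g \<Longrightarrow> integral C (\<lambda>x. f x - g x) = integral C f - integral C g"
  for f g :: "real^3 \<Rightarrow> real"
  by (intro integral_diff integrable_cell)

lemma integral_cell_cong:
  "(\<And>x. x \<in> slab \<Longrightarrow> f x = g x) \<Longrightarrow> integral C f = integral C g" for f g :: "real^3 \<Rightarrow> real"
  using cell_subset_slab by (intro integral_cong) auto

text \<open>Cauchy-Schwarz splits off \<open>j\<close>, Hoelder with exponents p/2 and p/(p - 2)
  separates \<open>w\<close> from \<open>b\<close>, and the resulting L^q norm of \<open>b\<close>
  is interpolated between L^6 and L^2.\<close>

lemma Holder_cell: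
  assumes c: "continuous_on slab w" "continuous_on slab b" "continuous_on slab j"
    and nn: "\<And>x. x \<in> slab \<Longrightarrow> 0 \<le> w x" "\<And>x. x \<in> slab \<Longrightarrow> 0 \<le> b x" "\<And>x. x \<in> slab \<Longrightarrow> 0 \<le> j x"
    and b: "0 < integral C (\<lambda>x. (b x)\<^sup>2)" and p: "3 \<le> p"
  shows "integral C (\<lambda>x. w x * b x * j x) \<le> integral C (\<lambda>x. w x powr p) powr (1 / p) *
    (integral C (\<lambda>x. b x ^ 6) powr (1 / (2 * p)) * integral C (\<lambda>x. (b x)\<^sup>2) powr ((p - 3) / (2 * p))) *
    sqrt (integral C (\<lambda>x. (j x)\<^sup>2))"
proof -
  define r where "r = p - 2"
  have r: "p = r + 2" "r > 0" using p by (auto simp: r_def)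
  have conj: "1 - 2 / p = r / p" using r by (simp add: field_simps)
  \<comment> \<open>\<open>q\<close> satisfies 1/p + 1/q = 1/2, and \<open>\<theta>\<close> solves
    \<open>6 * \<theta> + 2 * (1 - \<theta>) = q\<close>: it interpolates the integrals of powers,
    not the norms.\<close>
  define q where "q = 2 * p / (p - 2)"
  define \<theta> where "\<theta> = 1 / (p - 2)"
  define W where "W = integral C (\<lambda>x. w x powr p)"
  define b6 where "b6 = integral C (\<lambda>x. b x ^ 6)"
  define b2 where "b2 = integral C (\<lambda>x. (b x)\<^sup>2)"
  define bq where "bq = integral C (\<lambda>x. b x powr q)"
  have q: "q > 0" using p by (simp add: q_def)
  have nnC: "0 \<le> w x" "0 \<le> b x" "0 \<le> j x" if "x \<in> C" for x
    using nn that cell_subset_slab by auto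
  have cw: "continuous_on slab (\<lambda>x. w x powr r)" and cb: "continuous_on slab (\<lambda>x. b x powr r)" if "r > 0" for r
    using c nn that by (auto intro!: continuous_on_powr')
  have H: "integral C (\<lambda>x. f x powr \<alpha> * g x powr \<beta>) \<le> integral C f powr \<alpha> * integral C g powr \<beta>"
    if "continuous_on slab f" "continuous_on slab g" "\<And>x. x \<in> slab \<Longrightarrow> 0 \<le> f x" "\<And>x. x \<in> slab \<Longrightarrow> 0 \<le> g x"
      "\<alpha> > 0" "\<beta> > 0" "\<alpha> + \<beta> = 1" for f g :: "real^3 \<Rightarrow> real" and \<alpha> \<beta>
    using that cell_subset_slab box_ne unfolding cell_cbox
    by (intro Holder_integral_continuous) (auto intro: continuous_on_subset)
  have nn6: "0 \<le> b6" unfolding b6_def by (intro integral_cell_nonneg continuous_intros c) (auto simp: nn)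
  have nn2: "0 < b2" using b by (simp add: b2_def)
  have nnW: "0 \<le> W" unfolding W_def using p by (intro integral_cell_nonneg cw) auto
  have nnq: "0 \<le> bq" unfolding bq_def using q by (intro integral_cell_nonneg cb) auto
  have bq: "bq \<le> b6 powr \<theta> * b2 powr (1 - \<theta>)"
  proof (cases "p = 3")
    \<comment> \<open>Here q = 6 and \<open>\<theta>\<close> = 1, so nothing is left to interpolate.
      Positivity of \<open>b2\<close> makes \<open>b2 powr 0\<close> equal to 1, since
      \<open>0 powr 0 = 0\<close>.\<close>
    case True
    have "bq = b6" unfolding bq_def b6_def
      by (intro integral_cong) (simp add: q_def True nnC)
    thus ?thesis using nn6 nn2 True by (simp add: \<theta>_def)
  next
    case False
    hence \<theta>: "0 < \<theta>" "0 < 1 - \<theta>" using p by (auto simp: \<theta>_def)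
    have q': "6 * \<theta> + 2 * (1 - \<theta>) = q" using r(2) unfolding \<theta>_def q_def r(1) by (simp add: field_simps)
    have "bq = integral C (\<lambda>x. (b x ^ 6) powr \<theta> * ((b x)\<^sup>2) powr (1 - \<theta>))"
      unfolding bq_def
    proof (intro integral_cong)
      fix x assume "x \<in> C"
      show "b x powr q = (b x ^ 6) powr \<theta> * ((b x)\<^sup>2) powr (1 - \<theta>)"
      proof (cases "b x = 0")
        case False
        hence "b x > 0" using nnC[OF \<open>x \<in> C\<close>] by simp
        hence "(b x ^ 6) powr \<theta> * ((b x)\<^sup>2) powr (1 - \<theta>) = b x powr (6 * \<theta>) * b x powr (2 * (1 - \<theta>))"
          by (simp add: powr_powr flip: powr_numeral)
        thus ?thesis by (simp only: q' flip: powr_add)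
      qed simp
    qed
    also have "\<dots> \<le> b6 powr \<theta> * b2 powr (1 - \<theta>)"
      unfolding b6_def b2_def by (intro H continuous_intros c \<theta>) (auto simp: nn)
    finally show ?thesis .
  qed
  have "integral C (\<lambda>x. (w x * b x)\<^sup>2) = integral C (\<lambda>x. (w x powr p) powr (2 / p) * (b x powr q) powr (1 - 2 / p))"
  proof (intro integral_cong)
    fix x assume "x \<in> C"
    have "q * (1 - 2 / p) = 2" using r(2) p unfolding conj q_def by (simp add: r_def)
    thus "(w x * b x)\<^sup>2 = (w x powr p) powr (2 / p) * (b x powr q) powr (1 - 2 / p)"
      using nnC[OF \<open>x \<in> C\<close>] p by (simp add: powr_powr power_mult_distrib)
  qed
  also have "\<dots> \<le> W powr (2 / p) * bq powr (1 - 2 / p)"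
    unfolding W_def bq_def using p q by (intro H cw cb) auto
  also have "\<dots> \<le> W powr (2 / p) * (b6 powr \<theta> * b2 powr (1 - \<theta>)) powr (1 - 2 / p)"
    using bq nnq p by (intro mult_left_mono powr_mono2) auto
  finally have "sqrt (integral C (\<lambda>x. (w x * b x)\<^sup>2))
      \<le> sqrt (W powr (2 / p) * (b6 powr \<theta> * b2 powr (1 - \<theta>)) powr (1 - 2 / p))"
    by (rule real_sqrt_le_mono)
  also have "\<dots> = W powr (1 / p) * (b6 powr (1 / (2 * p)) * b2 powr ((p - 3) / (2 * p)))"
  proof -
    have e: "\<theta> * ((1 - 2 / p) * (1 / 2)) = 1 / (2 * p)"
      "(1 - \<theta>) * ((1 - 2 / p) * (1 / 2)) = (p - 3) / (2 * p)" "2 / p * (1 / 2) = 1 / p"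
      using r(2) p unfolding conj \<theta>_def by (simp_all add: r_def divide_simps)
    have "sqrt (W powr (2 / p) * (b6 powr \<theta> * b2 powr (1 - \<theta>)) powr (1 - 2 / p))
        = (W powr (2 / p) * (b6 powr \<theta> * b2 powr (1 - \<theta>)) powr (1 - 2 / p)) powr (1 / 2)"
      by (simp add: powr_half_sqrt)
    also have "\<dots> = W powr (2 / p * (1 / 2)) *
        (b6 powr (\<theta> * ((1 - 2 / p) * (1 / 2))) * b2 powr ((1 - \<theta>) * ((1 - 2 / p) * (1 / 2))))"
      using nnW nn6 nn2 by (simp only: powr_mult powr_powr mult.assoc powr_ge_zero mult_nonneg_nonneg)
    finally show ?thesis unfolding e .
  qed
  finally have "sqrt (integral C (\<lambda>x. (w x * b x)\<^sup>2)) * sqrt (integral C (\<lambda>x. (j x)\<^sup>2)) \<le>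
    W powr (1 / p) * (b6 powr (1 / (2 * p)) * b2 powr ((p - 3) / (2 * p))) * sqrt (integral C (\<lambda>x. (j x)\<^sup>2))"
    by (intro mult_right_mono real_sqrt_ge_zero integral_cell_nonneg continuous_intros c) auto
  moreover have "integral C (\<lambda>x. w x * b x * j x)
      \<le> sqrt (integral C (\<lambda>x. (w x * b x)\<^sup>2)) * sqrt (integral C (\<lambda>x. (j x)\<^sup>2))"
    by (intro Cauchy_Schwarz_cell continuous_intros c) (auto simp: nn)
  ultimately show ?thesis by (simp add: W_def b6_def b2_def)
qed

text \<open>Applied to products, this is the integration by parts of everything below: periodicity
  closes the horizontal directions, vanishing on the walls the vertical one.\<close>

lemma integral_pd_cell_eq_zero:
  assumes "has_pd k h h'" "continuous_on slab h'"
    and "k \<noteq> 3 \<Longrightarrow> per k h" "k = 3 \<Longrightarrow> (\<And>x. x $ 3 = 0 \<or> x $ 3 = 1 \<Longrightarrow> h x = 0)"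
  shows "integral C h' = 0"
proof (rule integral_pd_eq_zero[OF assms(1,2)])
  fix x assume x: "x \<in> slab"
  show "h (upd k (len k) x) = h (upd k 0 x)"
  proof (cases "k = 3")
    case False
    from assms(3)[OF this, unfolded per_def, rule_format, OF x, of 0] show ?thesis by simp
  qed (use assms(4) in simp)
qed

lemma per_mult: "per k f \<Longrightarrow> per k g \<Longrightarrow> per k (\<lambda>x. f x * g x)"
  and per_diff: "per k f \<Longrightarrow> per k g \<Longrightarrow> per k (\<lambda>x. f x - g x)"
  and per_add: "per k f \<Longrightarrow> per k g \<Longrightarrow> per k (\<lambda>x. f x + g x)"
  and per_power: "per k f \<Longrightarrow> per k (\<lambda>x. f x ^ n)"
  by (auto simp: per_def)

lemma integral_norm_sq:
  fixes F :: "real^3 \<Rightarrow> real^3"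
  assumes "continuous_on slab F"
  shows "integral C (\<lambda>x. (norm (F x))\<^sup>2) = integral C (\<lambda>x. (F x $ 1)\<^sup>2) + integral C (\<lambda>x. (F x $ 2)\<^sup>2)
    + integral C (\<lambda>x. (F x $ 3)\<^sup>2)"
  unfolding norm_sq_3 using assms by (simp add: integral_cell_add continuous_intros)

text \<open>\<open>F\<close> is the Lorentz force in the balance \<open>L F = e\<^sub>z \<times> (u - W) + \<nabla>(P - Ra \<tau>)\<close>, where
  \<open>W = Ra e\<^sub>z \<times> \<nabla>\<tau>\<close>. Mixed partials fall on \<open>P\<close>, so that \<open>\<tau>\<close> need not be twice differentiable.\<close>

lemma integral_lorentz_work:
  fixes U :: "3 \<Rightarrow> real^3 \<Rightarrow> real" and P \<tau> :: "real^3 \<Rightarrow> real"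
  assumes L: "L \<noteq> 0"
    and U: "\<And>i. continuous_on slab (U i)" "\<And>i j. has_pd j (U i) (U' i j)" "\<And>i j. continuous_on slab (U' i j)"
      "\<And>i k. k \<noteq> 3 \<Longrightarrow> per k (U i)" "\<And>x. x $ 3 = 0 \<or> x $ 3 = 1 \<Longrightarrow> U 3 x = 0"
      "\<And>x. x \<in> slab \<Longrightarrow> U' 1 1 x + U' 2 2 x + U' 3 3 x = 0"
    and P: "continuous_on slab P" "\<And>j. has_pd j P (P' j)" "\<And>j. continuous_on slab (P' j)"
      "\<And>j k. has_pd k (P' j) (P'' j k)" "\<And>j k. continuous_on slab (P'' j k)"
      "\<And>x. x \<in> slab \<Longrightarrow> P'' 1 2 x = P'' 2 1 x" "\<And>k. k \<noteq> 3 \<Longrightarrow> per k P" "\<And>j k. k \<noteq> 3 \<Longrightarrow> per k (P' j)"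
    and \<tau>: "continuous_on slab \<tau>" "\<And>j. has_pd j \<tau> (\<tau>' j)" "\<And>j. continuous_on slab (\<tau>' j)"
      "\<And>k. k \<noteq> 3 \<Longrightarrow> per k \<tau>"
    and F: "\<And>x. x \<in> slab \<Longrightarrow> L * F 1 x = - (U 2 x - Ra * \<tau>' 1 x) + (P' 1 x - Ra * \<tau>' 1 x)"
      "\<And>x. x \<in> slab \<Longrightarrow> L * F 2 x = (U 1 x + Ra * \<tau>' 2 x) + (P' 2 x - Ra * \<tau>' 2 x)"
      "\<And>x. x \<in> slab \<Longrightarrow> L * F 3 x = P' 3 x - Ra * \<tau>' 3 x"
      "\<And>i. continuous_on slab (F i)"
  shows "integral C (\<lambda>x. U 1 x * F 1 x + U 2 x * F 2 x + U 3 x * F 3 x)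
    = integral C (\<lambda>x. - (Ra * \<tau>' 2 x) * F 1 x + Ra * \<tau>' 1 x * F 2 x)"
proof -
  note c = continuous_intros U(1,3) P(1,3,5) \<tau>(1,3) F(4)
  define Q where "Q x = P x - Ra * \<tau> x" for x
  define Q' where "Q' j x = P' j x - Ra * \<tau>' j x" for j x
  have cQ: "continuous_on slab Q" "\<And>j. continuous_on slab (Q' j)"
    unfolding Q_def Q'_def by (intro c)+
  have pQ: "has_pd j Q (Q' j)" for j
    unfolding Q_def Q'_def by (intro has_pd_diff has_pd_cmult P \<tau>)
  have perQ: "per k Q" if "k \<noteq> 3" for k
    using P(7)[OF that] \<tau>(4)[OF that] by (simp add: per_def Q_def)
  \<comment> \<open>Summed over the three directions this is the divergence of Q U: the reduced
    pressure does no work on a solenoidal field tangent to the walls.\<close>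
  have 1: "integral C (\<lambda>x. U' k k x * Q x + U k x * Q' k x) = 0" for k
    by (rule integral_pd_cell_eq_zero[OF has_pd_mult[OF U(2) pQ]])
       (auto intro!: c cQ per_mult U perQ)
  \<comment> \<open>The horizontal Jacobian of \<open>\<tau>\<close> and \<open>P\<close> integrates
    to zero: by parts its two terms become \<open>\<tau>\<close> times the two mixed partials of
    \<open>P\<close>, which cancel.\<close>
  have 2: "integral C (\<lambda>x. \<tau>' 1 x * P' 2 x + \<tau> x * P'' 2 1 x) = 0"
    by (rule integral_pd_cell_eq_zero[OF has_pd_mult[OF \<tau>(2) P(4)]])
       (auto intro!: c per_mult P \<tau>)
  have 3: "integral C (\<lambda>x. \<tau>' 2 x * P' 1 x + \<tau> x * P'' 1 2 x) = 0"
    by (rule integral_pd_cell_eq_zero[OF has_pd_mult[OF \<tau>(2) P(4)]])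
       (auto intro!: c per_mult P \<tau>)
  have hz: "(f has_integral 0) C" if "integral C f = 0" "continuous_on slab f" for f :: "real^3 \<Rightarrow> real"
    using integrable_integral[OF integrable_cell[OF that(2)]] that(1) by simp
  have "integral C (\<lambda>x. L * ((U 1 x * F 1 x + U 2 x * F 2 x + U 3 x * F 3 x)
        - (- (Ra * \<tau>' 2 x) * F 1 x + Ra * \<tau>' 1 x * F 2 x)))
    = integral C (\<lambda>x. (U' 1 1 x * Q x + U 1 x * Q' 1 x) + (U' 2 2 x * Q x + U 2 x * Q' 2 x)
        + (U' 3 3 x * Q x + U 3 x * Q' 3 x)
        + Ra * ((\<tau>' 2 x * P' 1 x + \<tau> x * P'' 1 2 x) - (\<tau>' 1 x * P' 2 x + \<tau> x * P'' 2 1 x)))"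
  proof (rule integral_cell_cong)
    fix x assume x: "x \<in> slab"
    have "L * ((U 1 x * F 1 x + U 2 x * F 2 x + U 3 x * F 3 x)
        - (- (Ra * \<tau>' 2 x) * F 1 x + Ra * \<tau>' 1 x * F 2 x))
      = (U 1 x + Ra * \<tau>' 2 x) * (L * F 1 x) + (U 2 x - Ra * \<tau>' 1 x) * (L * F 2 x) + U 3 x * (L * F 3 x)"
      by (simp add: algebra_simps)
    \<comment> \<open>The factors multiplying the force are the components of U - W, so the rotation
      terms cancel, and so do the products of two derivatives of \<open>\<tau>\<close>.\<close>
    also have "\<dots> = U 1 x * Q' 1 x + U 2 x * Q' 2 x + U 3 x * Q' 3 x + Ra * (\<tau>' 2 x * P' 1 x - \<tau>' 1 x * P' 2 x)"
      unfolding F(1-3)[OF x] Q'_def by (simp add: algebra_simps)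
    also have "\<dots> = \<dots> + (U' 1 1 x + U' 2 2 x + U' 3 3 x) * Q x"
      by (simp add: U(6)[OF x])
    finally show "L * ((U 1 x * F 1 x + U 2 x * F 2 x + U 3 x * F 3 x)
        - (- (Ra * \<tau>' 2 x) * F 1 x + Ra * \<tau>' 1 x * F 2 x)) = (U' 1 1 x * Q x + U 1 x * Q' 1 x)
        + (U' 2 2 x * Q x + U 2 x * Q' 2 x) + (U' 3 3 x * Q x + U 3 x * Q' 3 x)
        + Ra * ((\<tau>' 2 x * P' 1 x + \<tau> x * P'' 1 2 x) - (\<tau>' 1 x * P' 2 x + \<tau> x * P'' 2 1 x))"
      by (simp add: algebra_simps P(6)[OF x])
  qed
  also have "\<dots> = (0 + 0 + 0) + Ra * (0 - 0)"
    by (rule integral_unique[OF has_integral_add[OF has_integral_add[OF has_integral_add[OF hz[OF 1] hz[OF 1]] hz[OF 1]]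
          has_integral_mult_right[OF has_integral_diff[OF hz[OF 3] hz[OF 2]]]]]) (intro c cQ)+
  also have "\<dots> = 0" by simp
  finally have "L * (integral C (\<lambda>x. U 1 x * F 1 x + U 2 x * F 2 x + U 3 x * F 3 x)
      - integral C (\<lambda>x. - (Ra * \<tau>' 2 x) * F 1 x + Ra * \<tau>' 1 x * F 2 x)) = 0"
    by (subst integral_cell_diff[symmetric]) (auto intro!: c)
  thus ?thesis using L by simp
qed

end

text \<open>The data of one instant, with first and second derivatives as explicit functions on the
  closed slab. Evaluation at 0 in \<open>no_flux\<close> selects the bottom wall.\<close>

locale ferromagnetic_field = periodicity_cell +
  fixes B :: "real^3 \<Rightarrow> real^3" and G :: "3 \<Rightarrow> 3 \<Rightarrow> real^3 \<Rightarrow> real" and H :: "3 \<Rightarrow> 3 \<Rightarrow> 3 \<Rightarrow> real^3 \<Rightarrow> real"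
  assumes contB: "continuous_on slab B"
    and pd_B: "has_pd j (\<lambda>x. B x $ i) (G i j)"
    and contG: "continuous_on slab (G i j)"
    and pd_G: "has_pd k (G i j) (H i j k)"
    and contH: "continuous_on slab (H i j k)"
    and H_sym: "x \<in> slab \<Longrightarrow> H i j k x = H i k j x"
    and per_B: "k \<noteq> 3 \<Longrightarrow> per k (\<lambda>x. B x $ i)"
    and per_G: "k \<noteq> 3 \<Longrightarrow> per k (G i j)"
    and wall: "i \<noteq> 3 \<Longrightarrow> x $ 3 = 0 \<or> x $ 3 = 1 \<Longrightarrow> B x $ i = 0"
    and div_free: "x \<in> slab \<Longrightarrow> G 1 1 x + G 2 2 x + G 3 3 x = 0"
    and no_flux: "avg 1 (avg 2 (\<lambda>x. B x $ 3)) 0 = 0"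
begin

lemma contB_nth: "continuous_on slab (\<lambda>x. B x $ i)"
  by (intro continuous_intros contB)

lemma tangential_pd_wall:
  assumes "i \<noteq> 3" "j \<noteq> 3" "x $ 3 = 0 \<or> x $ 3 = 1"
  shows "G i j x = 0"
proof -
  have x: "x \<in> slab" using assms(3) by (auto simp: slab_def)
  have "((\<lambda>s. B (upd j s x) $ i) has_real_derivative G i j x) (at (x $ j))"
    using pd_B[of j i] x assms(2) by (auto simp: has_pd_def rng_def)
  moreover have "(\<lambda>s. B (upd j s x) $ i) = (\<lambda>s. 0)"
    using assms by (intro ext wall) auto
  ultimately have "((\<lambda>s. 0) has_real_derivative G i j x) (at (x $ j))" by simp
  thus ?thesis using DERIV_unique[OF _ DERIV_const] by blast
qed

text \<open>On the walls solenoidality turns the tangential Dirichlet conditions into a Neumann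
  condition for the vertical component, which need not vanish there itself.\<close>

lemma normal_pd_wall: "x $ 3 = 0 \<or> x $ 3 = 1 \<Longrightarrow> G 3 3 x = 0"
  using div_free[of x] tangential_pd_wall[of 1 1 x] tangential_pd_wall[of 2 2 x]
  by (auto simp: slab_def)

text \<open>Unlike \<open>curl\<close>, this current is meaningful up to the walls.\<close>

definition J :: "real^3 \<Rightarrow> real^3" where
  "J x = vector [G 3 2 x - G 2 3 x, G 1 3 x - G 3 1 x, G 2 1 x - G 1 2 x]"

lemma J_nth [simp]: "J x $ 1 = G 3 2 x - G 2 3 x" "J x $ 2 = G 1 3 x - G 3 1 x" "J x $ 3 = G 2 1 x - G 1 2 x"
  by (auto simp: J_def)

lemma contJ: "continuous_on slab J"
  unfolding continuous_on_componentwise[of _ J] 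
  by (auto simp: Basis_vec_def inner_axis forall_3 J_def intro!: continuous_intros contG)

definition pdB :: "3 \<Rightarrow> real^3 \<Rightarrow> real^3" where
  "pdB j x = (\<chi> i. G i j x)"

text \<open>The Dirichlet energy is kept apart by directions because the sides of the cell enter the
  Sobolev estimate separately.\<close>

definition dir :: "3 \<Rightarrow> real" where
  "dir j = integral C (\<lambda>x. (norm (pdB j x))\<^sup>2)"

text \<open>The L^2 norm of the full gradient of \<open>B\<close>, which
  \<open>integral_J_sq\<close> identifies with that of the current.\<close>

definition D where "D = sqrt (dir 1 + dir 2 + dir 3)"

lemma contpdB: "continuous_on slab (pdB j)"
  unfolding pdB_def by (intro continuous_intros contG)

lemma dir_nonneg: "0 \<le> dir j"
  unfolding dir_def by (intro integral_cell_nonneg continuous_intros contpdB) auto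

lemma D_sq: "D\<^sup>2 = dir 1 + dir 2 + dir 3" and D_nonneg: "0 \<le> D"
  using dir_nonneg by (auto simp: D_def)

lemma dir_eq: "dir j = integral C (\<lambda>x. (G 1 j x)\<^sup>2) + integral C (\<lambda>x. (G 2 j x)\<^sup>2) + integral C (\<lambda>x. (G 3 j x)\<^sup>2)"
  unfolding dir_def integral_norm_sq[OF contpdB] by (simp add: pdB_def)

text \<open>Both sides equal minus the integral of B_i times the mixed second derivative of B_j.
  With \<open>i\<close> horizontal, the wall terms contain B_i and vanish.\<close>

lemma integral_pd_swap:
  assumes i: "i \<noteq> 3" and ij: "i \<noteq> j"
  shows "integral C (\<lambda>x. G i j x * G j i x) = integral C (\<lambda>x. G i i x * G j j x)"
proof -
  note c = continuous_intros contB_nth contG contH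
  have 1: "integral C (\<lambda>x. G i j x * G j i x + B x $ i * H j i j x) = 0"
    by (rule integral_pd_cell_eq_zero[OF has_pd_mult[OF pd_B pd_G]])
       (use i wall in \<open>auto intro!: c per_mult per_B per_G\<close>)
  have 2: "integral C (\<lambda>x. G i i x * G j j x + B x $ i * H j j i x) = 0"
    by (rule integral_pd_cell_eq_zero[OF has_pd_mult[OF pd_B pd_G]])
       (use i wall in \<open>auto intro!: c per_mult per_B per_G\<close>)
  have "integral C (\<lambda>x. B x $ i * H j i j x) = integral C (\<lambda>x. B x $ i * H j j i x)"
    by (rule integral_cell_cong) (simp add: H_sym)
  thus ?thesis using 1 2 by (simp add: integral_cell_add c)
qed

text \<open>The square of the current differs from that of the gradient by products of crossed
  derivatives; after swapping indices these are the mixed products in the squared divergence, which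
  is zero.\<close>

lemma integral_J_sq: "integral C (\<lambda>x. (norm (J x))\<^sup>2) = D\<^sup>2"
proof -
  note c = continuous_intros contG
  have s: "integral C (\<lambda>x. (f x - g x)\<^sup>2)
      = integral C (\<lambda>x. (f x)\<^sup>2) + integral C (\<lambda>x. (g x)\<^sup>2) - 2 * integral C (\<lambda>x. f x * g x)"
    if "continuous_on slab f" "continuous_on slab g" for f g :: "real^3 \<Rightarrow> real"
  proof -
    have "integral C (\<lambda>x. (f x - g x)\<^sup>2) = integral C (\<lambda>x. (f x)\<^sup>2 + (g x)\<^sup>2 - 2 * (f x * g x))"
      by (rule integral_cell_cong) (simp add: power2_eq_square algebra_simps)
    thus ?thesis using that by (simp add: integral_cell_add integral_cell_diff continuous_intros)
  qed
  have "0 = integral C (\<lambda>x. (G 1 1 x + G 2 2 x + G 3 3 x)\<^sup>2)"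
    by (subst integral_cell_cong[of _ "\<lambda>x. 0"]) (auto simp: div_free)
  also have "\<dots> = integral C (\<lambda>x. (G 1 1 x)\<^sup>2 + (G 2 2 x)\<^sup>2 + (G 3 3 x)\<^sup>2
      + 2 * (G 1 1 x * G 2 2 x) + 2 * (G 1 1 x * G 3 3 x) + 2 * (G 2 2 x * G 3 3 x))"
    by (rule integral_cell_cong) (simp add: power2_eq_square algebra_simps)
  also have "\<dots> = integral C (\<lambda>x. (G 1 1 x)\<^sup>2) + integral C (\<lambda>x. (G 2 2 x)\<^sup>2) + integral C (\<lambda>x. (G 3 3 x)\<^sup>2)
      + 2 * integral C (\<lambda>x. G 1 2 x * G 2 1 x) + 2 * integral C (\<lambda>x. G 1 3 x * G 3 1 x)
      + 2 * integral C (\<lambda>x. G 2 3 x * G 3 2 x)"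
    by (simp add: integral_cell_add c integral_pd_swap)
  finally show ?thesis
    unfolding integral_norm_sq[OF contJ] J_nth D_sq dir_eq
    by (simp add: s contG mult.commute[of "G 3 2 _"] mult.commute[of "G 2 1 _"])
qed

text \<open>The horizontal mean does not vary with height: its vertical derivative is minus the mean
  of the horizontal divergence, zero by periodicity. At the bottom it vanishes because the flux is
  exact.\<close>

lemma horizontal_mean_zero:
  assumes x: "x \<in> slab"
  shows "avg 1 (avg 2 (\<lambda>x. B x $ 3)) x = 0"
proof -
  define z where "z = x $ 3"
  have z: "0 \<le> z" "z \<le> 1" using x by (auto simp: z_def slab_def)
  hence r: "{0..z} \<subseteq> rng 3" by (auto simp: rng_def)
  have r': "{0..Lx} \<subseteq> rng 1" "{0..Ly} \<subseteq> rng 2" by (auto simp: rng_def)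
  let ?I = "\<lambda>f. slice_integral 1 Lx (slice_integral 2 Ly f)"
  have ind: "?I f y = ?I f (upd 3 (y $ 3) 0)" for f y
  proof -
    have "upd 2 b (upd 1 a y) = upd 2 b (upd 1 a (upd 3 (y $ 3) 0))" for a b
      by (simp add: vec_eq_iff forall_3)
    thus ?thesis by (simp add: slice_integral_def)
  qed
  have I_div: "?I (G 3 3) y = 0" if y: "y \<in> slab" for y
  proof -
    have s1: "slice_integral 1 Lx (G 1 1) w = 0" and s2: "slice_integral 2 Ly (G 2 2) w = 0" if w: "w \<in> slab" for w
    proof -
      have *: "slice_integral k (len k) (G k k) w = 0" if "k \<noteq> 3" for k
      proof -
        have "((\<lambda>s. G k k (upd k s w)) has_integral (B (upd k (len k) w) $ k - B (upd k 0 w) $ k)) {0..len k}"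
          using has_pd_slice[OF pd_B w, of _ k k] that len_pos[of k]
          by (intro fundamental_theorem_of_calculus)
             (auto simp: rng_def simp flip: has_real_derivative_iff_has_vector_derivative intro: has_field_derivative_at_within)
        moreover have "B (upd k (len k) w) $ k = B (upd k 0 w) $ k"
          using per_B[OF that, of k, unfolded per_def, rule_format, OF w, of 0] by simp
        ultimately show ?thesis by (simp add: slice_integral_def integral_unique)
      qed
      show "slice_integral 1 Lx (G 1 1) w = 0" "slice_integral 2 Ly (G 2 2) w = 0"
        using *[of 1] *[of 2] by auto
    qed
    have "slice_integral 2 Ly (G 3 3) w = - slice_integral 2 Ly (G 1 1) w" if w: "w \<in> slab" for w
    proof -
      have "slice_integral 2 Ly (G 3 3) w = slice_integral 2 Ly (\<lambda>x. - G 1 1 x - G 2 2 x) w"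
        using div_free by (intro slice_integral_cong r' w) (simp add: eq_neg_iff_add_eq_0 algebra_simps)
      also have "\<dots> = - slice_integral 2 Ly (G 1 1) w"
        using slice_integral_diff[OF _ contG r'(2) w, of "\<lambda>x. - G 1 1 x"] s2[OF w] contG
        by (simp add: continuous_on_minus) (simp add: slice_integral_def)
      finally show ?thesis .
    qed
    hence "?I (G 3 3) y = slice_integral 1 Lx (\<lambda>w. - slice_integral 2 Ly (G 1 1) w) y"
      by (intro slice_integral_cong r' y)
    also have "\<dots> = - ?I (G 1 1) y" by (simp add: slice_integral_def)
    also have "?I (G 1 1) y = slice_integral 2 Ly (slice_integral 1 Lx (G 1 1)) y"
      by (intro slice_integral_commute contG r' y) simp
    also have "\<dots> = slice_integral 2 Ly (\<lambda>w. 0) y"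
      by (intro slice_integral_cong r' y s1)
    finally show ?thesis by (simp add: slice_integral_def)
  qed
  define b where "b r y = B (upd 3 r y) $ 3" for r y
  have cb: "continuous_on slab (b r)" if "r \<in> rng 3" for r
    unfolding b_def using that
    by (intro continuous_on_compose2[OF contB_nth]) (auto intro!: continuous_intros upd_in_slab)
  have z3: "z \<in> rng 3" "0 \<in> rng 3" using z by (auto simp: rng_def)
  have I_b: "?I (b r) x = ?I (\<lambda>x. B x $ 3) (upd 3 r x)" for r
  proof -
    have "upd 3 r (upd 2 t (upd 1 s x)) = upd 2 t (upd 1 s (upd 3 r x))" for s t
      by (simp add: vec_eq_iff)
    thus ?thesis by (simp add: slice_integral_def b_def)
  qed
  \<comment> \<open>Integrating up from the bottom wall, rather than differentiating the mean in
    height, reduces the claim to interchanging slice integrals.\<close>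
  have "slice_integral 3 z (G 3 3) y = b z y - b 0 y" if y: "y \<in> slab" for y
  proof -
    have "((\<lambda>s. G 3 3 (upd 3 s y)) has_integral (B (upd 3 z y) $ 3 - B (upd 3 0 y) $ 3)) {0..z}"
      using DERIV_subset[OF has_pd_slice[OF pd_B y] r] r z
      by (intro fundamental_theorem_of_calculus)
         (auto simp flip: has_real_derivative_iff_has_vector_derivative)
    thus ?thesis by (simp add: slice_integral_def b_def integral_unique)
  qed
  hence "?I (\<lambda>y. b z y - b 0 y) x = ?I (slice_integral 3 z (G 3 3)) x"
    by (intro slice_integral_cong r' x) auto
  also have "\<dots> = slice_integral 1 Lx (slice_integral 3 z (slice_integral 2 Ly (G 3 3))) x"
    by (intro slice_integral_cong slice_integral_commute contG r' r x) auto
  also have "\<dots> = slice_integral 3 z (?I (G 3 3)) x"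
    by (intro slice_integral_commute continuous_on_slice_integral contG r' r x) auto
  also have "\<dots> = slice_integral 3 z (\<lambda>w. 0) x"
    by (intro slice_integral_cong r x I_div)
  also have "\<dots> = 0" by (simp add: slice_integral_def)
  also have "?I (\<lambda>y. b z y - b 0 y) x = slice_integral 1 Lx (\<lambda>y. slice_integral 2 Ly (b z) y - slice_integral 2 Ly (b 0) y) x"
    by (intro slice_integral_cong slice_integral_diff cb z3 r' x)
  also have "\<dots> = ?I (b z) x - ?I (b 0) x"
    by (intro slice_integral_diff continuous_on_slice_integral cb z3 r' x)
  also have "?I (b z) x = ?I (\<lambda>x. B x $ 3) x" by (simp only: I_b) (simp add: z_def)
  also have "?I (b 0) x = ?I (\<lambda>x. B x $ 3) 0"
    unfolding I_b using ind[of "\<lambda>x. B x $ 3" "upd 3 0 x"] ind[of "\<lambda>x. B x $ 3" 0] by simp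
  finally have "?I (\<lambda>x. B x $ 3) x = ?I (\<lambda>x. B x $ 3) 0" by simp
  moreover have "avg 1 (avg 2 (\<lambda>x. B x $ 3)) y = ?I (\<lambda>x. B x $ 3) y / (Lx * Ly)" for y
    by (simp add: avg_def[abs_def] slice_integral_def)
  ultimately show ?thesis using no_flux by simp
qed

end

section \<open>Poincare and Sobolev inequalities and the energy identities for B\<close>

context ferromagnetic_field
begin

text \<open>Tangential components are controlled by their vertical derivatives, the vertical one by
  its horizontal derivatives. These are distinct entries of the gradient, so the one-dimensional
  constant survives.\<close>

lemma poincare: "integral C (\<lambda>x. (norm (B x))\<^sup>2) \<le> (C\<^sub>P Lx Ly * D)\<^sup>2"
proof -
  let ?I = "\<lambda>i j. integral C (\<lambda>x. (G i j x)\<^sup>2)"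
  have nn: "0 \<le> ?I i j" for i j
    by (intro integral_cell_nonneg continuous_intros contG) auto
  have 1: "integral C (\<lambda>x. (B x $ i)\<^sup>2) \<le> (C\<^sub>P Lx Ly)\<^sup>2 * ?I i 3" if "i \<noteq> 3" for i
    by (intro poincare_dirichlet contB_nth pd_B contG) (auto intro!: wall that)
  have 2: "integral C (\<lambda>x. (B x $ 3)\<^sup>2) \<le> (C\<^sub>P Lx Ly)\<^sup>2 * (?I 3 1 + ?I 3 2)"
    by (intro poincare_horizontal contB_nth pd_B contG per_B horizontal_mean_zero) auto
  have "integral C (\<lambda>x. (norm (B x))\<^sup>2) \<le> (C\<^sub>P Lx Ly)\<^sup>2 * ?I 1 3 + (C\<^sub>P Lx Ly)\<^sup>2 * ?I 2 3 + (C\<^sub>P Lx Ly)\<^sup>2 * (?I 3 1 + ?I 3 2)"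
    unfolding integral_norm_sq[OF contB] by (intro add_mono 1 2) auto
  also have "\<dots> = (C\<^sub>P Lx Ly)\<^sup>2 * (?I 1 3 + ?I 2 3 + (?I 3 1 + ?I 3 2))"
    by (simp add: algebra_simps)
  also have "\<dots> \<le> (C\<^sub>P Lx Ly)\<^sup>2 * D\<^sup>2"
    unfolding D_sq dir_eq using nn[of 1 1] nn[of 1 2] nn[of 2 1] nn[of 2 2] nn[of 3 3]
    by (intro mult_left_mono) auto
  finally show ?thesis by (simp add: power_mult_distrib)
qed

text \<open>With S the cube of the L^6 norm and g = |B|^4, Cauchy-Schwarz bounds the integrals of
  \<open>g\<close> and of its derivatives by S times L^2 norms. The W^{1,1} estimate then reads S^4
  <= S^3 Q.\<close>

lemma sobolev: "integral C (\<lambda>x. norm (B x) ^ 6) \<le> (C\<^sub>S Lx Ly * D) ^ 6"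
proof -
  \<comment> \<open>\<open>g\<close> is built from the squared norm, so that it is differentiable at
    the zeros of \<open>B\<close> as well.\<close>
  define e where "e x = (norm (B x))\<^sup>2" for x
  define g where "g x = (e x)\<^sup>2" for x
  define e' where "e' j x = 2 * B x $ 1 * G 1 j x + 2 * B x $ 2 * G 2 j x + 2 * B x $ 3 * G 3 j x" for j x
  define g' where "g' j x = 2 * e x * e' j x" for j x
  define S where "S = sqrt (integral C (\<lambda>x. norm (B x) ^ 6))"
  define b where "b = sqrt (integral C (\<lambda>x. (norm (B x))\<^sup>2))"
  have e_alt: "e = (\<lambda>x. (B x $ 1)\<^sup>2 + (B x $ 2)\<^sup>2 + (B x $ 3)\<^sup>2)"
    by (auto simp: e_def norm_sq_3)
  have pe: "has_pd j e (e' j)" for j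
    unfolding e_alt e'_def by (intro has_pd_add has_pd_square pd_B)
  hence pg: "has_pd j g (g' j)" for j
    unfolding g_def g'_def by (intro has_pd_square)
  have ce: "continuous_on slab e" unfolding e_def by (intro continuous_intros contB)
  have cg: "continuous_on slab g" unfolding g_def by (intro continuous_intros ce)
  have cg': "continuous_on slab (g' j)" for j
    unfolding g'_def e'_def by (intro continuous_intros ce contB contG)
  have perg: "per k g" if "k \<noteq> 3" for k
    unfolding g_def e_alt by (intro per_power per_add per_B that)
  have S0: "0 \<le> S" and b0: "0 \<le> b"
    unfolding S_def b_def by (intro real_sqrt_ge_zero integral_cell_nonneg continuous_intros contB; simp)+
  have S6: "S\<^sup>2 = integral C (\<lambda>x. norm (B x) ^ 6)"
    unfolding S_def by (intro real_sqrt_pow2 integral_cell_nonneg continuous_intros contB) auto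
  have cube: "sqrt (integral C (\<lambda>x. (norm (B x) ^ 3)\<^sup>2)) = S"
    by (simp add: S_def flip: power_mult)
  have "integral C g = integral C (\<lambda>x. norm (B x) ^ 3 * norm (B x))"
    by (intro integral_cell_cong) (simp add: g_def e_def power2_eq_square power3_eq_cube)
  also have "\<dots> \<le> S * b"
    unfolding b_def cube[symmetric] by (intro Cauchy_Schwarz_cell continuous_intros contB) auto
  finally have N: "integral C g \<le> S * b" .
  have M: "integral C (\<lambda>x. \<bar>g' j x\<bar>) \<le> 4 * (S * sqrt (dir j))" for j
  proof -
    have "integral C (\<lambda>x. \<bar>g' j x\<bar>) \<le> integral C (\<lambda>x. 4 * (norm (B x) ^ 3 * norm (pdB j x)))"
    proof (intro integral_cell_mono continuous_intros cg' contB contpdB)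
      fix x
      have "g' j x = 4 * ((norm (B x))\<^sup>2 * (B x \<bullet> pdB j x))"
        unfolding g'_def e'_def e_def inner_3 pdB_def vec_lambda_beta by (simp add: algebra_simps)
      hence "\<bar>g' j x\<bar> = 4 * ((norm (B x))\<^sup>2 * \<bar>B x \<bullet> pdB j x\<bar>)"
        by (simp add: abs_mult)
      also have "\<dots> \<le> 4 * ((norm (B x))\<^sup>2 * (norm (B x) * norm (pdB j x)))"
        by (intro mult_left_mono Cauchy_Schwarz_ineq2) auto
      finally show "\<bar>g' j x\<bar> \<le> 4 * (norm (B x) ^ 3 * norm (pdB j x))"
        by (simp add: power2_eq_square power3_eq_cube mult.assoc)
    qed
    also have "\<dots> = 4 * integral C (\<lambda>x. norm (B x) ^ 3 * norm (pdB j x))" by simp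
    also have "\<dots> \<le> 4 * (S * sqrt (dir j))"
      unfolding dir_def cube[symmetric]
      by (intro mult_left_mono Cauchy_Schwarz_cell continuous_intros contB contpdB) auto
    finally show ?thesis .
  qed
  have nn: "0 \<le> integral C g" "0 \<le> integral C (\<lambda>x. \<bar>g' j x\<bar>)" for j
    by (intro integral_cell_nonneg continuous_intros cg cg'; simp add: g_def)+
  define Q where "Q = (b / Lx + 2 * sqrt (dir 1)) * (b / Ly + 2 * sqrt (dir 2)) * (b + 4 * sqrt (dir 3))"
  have "S\<^sup>2 = integral C (\<lambda>x. g x * sqrt (g x))"
  proof -
    have "sqrt (g x) = e x" for x
      using real_sqrt_abs[of "e x"] by (simp add: g_def) (simp add: e_def)
    thus ?thesis unfolding S6
      by (intro integral_cell_cong) (simp add: g_def e_def flip: power_mult power_add)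
  qed
  also have "\<dots> \<le> sqrt (
      (integral C g / Lx + integral C (\<lambda>x. \<bar>g' 1 x\<bar>) / 2) *
      (integral C g / Ly + integral C (\<lambda>x. \<bar>g' 2 x\<bar>) / 2) *
      (integral C g + integral C (\<lambda>x. \<bar>g' 3 x\<bar>)))"
    by (intro integral_power_three_halves_le cg pg cg' perg) (auto simp: g_def)
  also have "\<dots> \<le> sqrt ((S * b / Lx + 4 * (S * sqrt (dir 1)) / 2) *
      (S * b / Ly + 4 * (S * sqrt (dir 2)) / 2) * (S * b + 4 * (S * sqrt (dir 3))))"
    using N M nn Lx Ly S0 b0 dir_nonneg
    by (intro real_sqrt_le_mono mult_mono add_mono divide_right_mono add_nonneg_nonneg
        mult_nonneg_nonneg divide_nonneg_nonneg) auto
  also have "\<dots> = sqrt (S ^ 3 * Q)"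
    by (simp add: Q_def power3_eq_cube algebra_simps)
  finally have "(S\<^sup>2)\<^sup>2 \<le> (sqrt (S ^ 3 * Q))\<^sup>2" by (intro power_mono) auto
  also have "\<dots> = S ^ 3 * Q"
    using S0 b0 Lx Ly dir_nonneg by (intro real_sqrt_pow2) (auto simp: Q_def intro!: mult_nonneg_nonneg)
  finally have "S ^ 3 * S \<le> S ^ 3 * Q" by (simp add: power2_eq_square power3_eq_cube mult_ac)
  moreover have "Q \<le> (C\<^sub>S Lx Ly * D) ^ 3"
    unfolding Q_def
  proof (rule anisotropic_product_le)
    have "b \<le> sqrt ((C\<^sub>P Lx Ly * D)\<^sup>2)" unfolding b_def by (intro real_sqrt_le_mono poincare)
    thus "b \<le> C\<^sub>P Lx Ly * D" using D_nonneg lambda_pos by (simp add: C\<^sub>P_def)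
  qed (use b0 dir_nonneg D_sq D_nonneg in auto)
  moreover have "0 \<le> (C\<^sub>S Lx Ly * D) ^ 3" using C\<^sub>S_pos D_nonneg by simp
  ultimately have "S \<le> (C\<^sub>S Lx Ly * D) ^ 3"
    using S0 by (cases "S = 0") (auto simp: less_le)
  hence "S\<^sup>2 \<le> ((C\<^sub>S Lx Ly * D) ^ 3)\<^sup>2" using S0 by (intro power_mono)
  thus ?thesis by (simp add: S6 flip: power_mult)
qed

lemma integral_B_sq_pos:
  assumes "x \<in> C" "B x \<noteq> 0"
  shows "0 < integral C (\<lambda>x. (norm (B x))\<^sup>2)"
proof (rule ccontr)
  assume "\<not> ?thesis"
  moreover have "0 \<le> integral C (\<lambda>x. (norm (B x))\<^sup>2)"
    by (intro integral_cell_nonneg continuous_intros contB) auto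
  ultimately have "integral C (\<lambda>x. (norm (B x))\<^sup>2) = 0" by simp
  hence "(norm (B x))\<^sup>2 = 0"
    using assms box_ne continuous_on_subset[OF contB cell_subset_slab] unfolding cell_cbox
    by (intro integral_zero_imp_zero[where f = "\<lambda>x. (norm (B x))\<^sup>2"]) (auto intro!: continuous_intros)
  thus False using assms by simp
qed

text \<open>\<open>B \<bullet> curl E - E \<bullet> curl B\<close> is the divergence of \<open>E \<times> B\<close>.\<close>

lemma integral_curl_by_parts:
  fixes E :: "3 \<Rightarrow> real^3 \<Rightarrow> real"
  assumes E: "\<And>i. continuous_on slab (E i)" "\<And>i j. has_pd j (E i) (E' i j)" "\<And>i j. continuous_on slab (E' i j)"
    "\<And>i k. k \<noteq> 3 \<Longrightarrow> per k (E i)"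
  shows "integral C (\<lambda>x. B x $ 1 * (E' 3 2 x - E' 2 3 x) + B x $ 2 * (E' 1 3 x - E' 3 1 x)
      + B x $ 3 * (E' 2 1 x - E' 1 2 x))
    = integral C (\<lambda>x. E 1 x * J x $ 1 + E 2 x * J x $ 2 + E 3 x * J x $ 3)"
proof -
  note c = continuous_intros contB contG E
  \<comment> \<open>For cyclic (k, i, j) this is the k-th derivative of the k-th component of E x B.
    At the walls the vertical component contains only tangential parts of \<open>B\<close>, so
    \<open>E\<close> needs no boundary condition.\<close>
  define d where "d k i j x = (E' i k x * B x $ j + E i x * G j k x) - (E' j k x * B x $ i + E j x * G i k x)" for k i j x
  have cd: "continuous_on slab (d k i j)" for k i j unfolding d_def by (intro c)
  have d: "integral C (d k i j) = 0" if "k = 3 \<longrightarrow> i \<noteq> 3 \<and> j \<noteq> 3" for k i j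
  proof (rule integral_pd_cell_eq_zero)
    show "has_pd k (\<lambda>x. E i x * B x $ j - E j x * B x $ i) (d k i j)"
      unfolding d_def by (intro has_pd_diff has_pd_mult E pd_B)
    show "k \<noteq> 3 \<Longrightarrow> per k (\<lambda>x. E i x * B x $ j - E j x * B x $ i)"
      by (intro per_diff per_mult E per_B)
    show "E i x * B x $ j - E j x * B x $ i = 0" if "k = 3" "x $ 3 = 0 \<or> x $ 3 = 1" for x
      using wall[of i x] wall[of j x] that \<open>k = 3 \<longrightarrow> i \<noteq> 3 \<and> j \<noteq> 3\<close> by auto
  qed (rule cd)
  have "integral C (\<lambda>x. B x $ 1 * (E' 3 2 x - E' 2 3 x) + B x $ 2 * (E' 1 3 x - E' 3 1 x)
      + B x $ 3 * (E' 2 1 x - E' 1 2 x)) =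
    integral C (\<lambda>x. (E 1 x * J x $ 1 + E 2 x * J x $ 2 + E 3 x * J x $ 3) + (d 1 2 3 x + d 2 3 1 x + d 3 1 2 x))"
    by (rule integral_cell_cong) (simp add: d_def algebra_simps)
  also have "\<dots> = integral C (\<lambda>x. E 1 x * J x $ 1 + E 2 x * J x $ 2 + E 3 x * J x $ 3)
      + (integral C (d 1 2 3) + integral C (d 2 3 1) + integral C (d 3 1 2))"
    by (simp add: integral_cell_add c cd del: J_nth add: contJ)
  finally show ?thesis by (simp add: d)
qed

text \<open>Each wall term is a component times its normal derivative: the first factor vanishes for
  tangential components, the second for the vertical one.\<close>

lemma integral_laplacian_by_parts:
  "integral C (\<lambda>x. B x $ 1 * (H 1 1 1 x + H 1 2 2 x + H 1 3 3 x) + B x $ 2 * (H 2 1 1 x + H 2 2 2 x + H 2 3 3 x)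
      + B x $ 3 * (H 3 1 1 x + H 3 2 2 x + H 3 3 3 x)) = - D\<^sup>2"
proof -
  note c = continuous_intros contB contG contH
  have "integral C (\<lambda>x. G i j x * G i j x + B x $ i * H i j j x) = 0" for i j
  proof (rule integral_pd_cell_eq_zero[OF has_pd_mult[OF pd_B pd_G]])
    show "B x $ i * G i j x = 0" if "j = 3" "x $ 3 = 0 \<or> x $ 3 = 1" for x
      using that wall[of i x] normal_pd_wall[of x] by (cases "i = 3") auto
  qed (auto intro!: c per_mult per_B per_G)
  hence "integral C (\<lambda>x. B x $ i * H i j j x) = - integral C (\<lambda>x. (G i j x)\<^sup>2)" for i j
    by (simp add: integral_cell_add c power2_eq_square eq_neg_iff_add_eq_0 add.commute)
  thus ?thesis by (simp add: distrib_left integral_cell_add c D_sq dir_eq)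
qed

end

section \<open>Regularity up to the walls\<close>

lemma Ck_on_bounded_linear:
  assumes "bounded_linear h" "Ck_on k S f"
  shows "Ck_on k S (\<lambda>x. h (f x))"
  using assms(2)
proof (induction k arbitrary: f)
  case 0
  thus ?case using bounded_linear.continuous_on[OF assms(1)] by auto
next
  case (Suc k)
  then obtain f' where f': "\<And>x. x \<in> S \<Longrightarrow> (f has_derivative f' x) (at x within S)" "\<And>v. Ck_on k S (\<lambda>x. f' x v)"
    by auto
  have "((\<lambda>x. h (f x)) has_derivative (\<lambda>v. h (f' x v))) (at x within S)" if "x \<in> S" for x
    by (rule bounded_linear.has_derivative[OF assms(1) f'(1)[OF that]])
  moreover have "Ck_on k S (\<lambda>x. h (f' x v))" for v
    by (rule Suc.IH[OF f'(2)])
  ultimately show ?case by (auto intro!: exI[of _ "\<lambda>x v. h (f' x v)"])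
qed

lemma Ck_on_slice_snd:
  assumes "Ck_on k (I \<times> S) F" "t \<in> I"
  shows "Ck_on k S (\<lambda>x. F (t, x))"
  using assms(1)
proof (induction k arbitrary: F)
  case 0
  have "continuous_on S (\<lambda>x. F (t, x))"
    by (rule continuous_on_compose2[OF 0[simplified]]) (use assms in \<open>auto intro!: continuous_intros\<close>)
  thus ?case by simp
next
  case (Suc k)
  then obtain F' where F': "\<And>p. p \<in> I \<times> S \<Longrightarrow> (F has_derivative F' p) (at p within I \<times> S)"
    "\<And>v. Ck_on k (I \<times> S) (\<lambda>p. F' p v)"
    by auto
  have "((\<lambda>x. F (t, x)) has_derivative (\<lambda>v. F' (t, x) (0, v))) (at x within S)" if "x \<in> S" for x
  proof -
    have "((\<lambda>x. (t, x)) has_derivative (\<lambda>v. (0, v))) (at x within S)"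
      by (auto intro!: derivative_eq_intros)
    moreover have "(F has_derivative F' (t, x)) (at (t, x) within (\<lambda>x. (t, x)) ` S)"
      by (rule has_derivative_subset[OF F'(1)]) (use that assms in auto)
    ultimately show ?thesis using has_derivative_in_compose by fastforce
  qed
  thus ?case
    by (simp only: Ck_on.simps, intro exI[of _ "\<lambda>x v. F' (t, x) (0, v)"])
       (use Suc.IH[OF F'(2)] in auto)
qed

lemma upd_has_derivative: "((\<lambda>s. upd i s x) has_derivative (\<lambda>s. s *\<^sub>R axis i 1)) F"
  unfolding upd_def by (auto intro!: derivative_eq_intros)

lemma has_pd_of_derivative:
  assumes "\<And>x. x \<in> slab \<Longrightarrow> (f has_derivative f' x) (at x within slab)"
  shows "has_pd i f (\<lambda>x. f' x (axis i 1))"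
  unfolding has_pd_def
proof
  fix x assume x: "x \<in> slab"
  have "(f has_derivative f' x) (at (upd i (x $ i) x) within (\<lambda>s. upd i s x) ` rng i)"
    using has_derivative_subset[OF assms[OF x], of "(\<lambda>s. upd i s x) ` rng i"] upd_in_slab[OF x]
    by (auto simp: image_subset_iff)
  from has_derivative_in_compose[OF upd_has_derivative this]
  have "((\<lambda>s. f (upd i s x)) has_derivative (\<lambda>s. f' x (s *\<^sub>R axis i 1))) (at (x $ i) within rng i)" .
  moreover have "linear (f' x)" using assms[OF x] has_derivative_linear by blast
  ultimately show "((\<lambda>s. f (upd i s x)) has_real_derivative f' x (axis i 1)) (at (x $ i) within rng i)"
    by (simp add: has_field_derivative_def linear_scale mult_commute_abs)
qed

lemma Ck_on_Suc_has_pd: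
  assumes "Ck_on (Suc k) slab f"
  obtains f' where "\<And>i. has_pd i f (f' i)" "\<And>i. Ck_on k slab (f' i)"
proof -
  from assms obtain D where "\<And>x. x \<in> slab \<Longrightarrow> (f has_derivative D x) (at x within slab)"
    "\<And>v. Ck_on k slab (\<lambda>x. D x v)" by auto
  with has_pd_of_derivative[of f D] show ?thesis
    by (intro that[of "\<lambda>i x. D x (axis i 1)"]) auto
qed

lemma Ck_on_2_has_pd:
  assumes "Ck_on 2 slab f"
  obtains f' f'' where "\<And>i. has_pd i f (f' i)" "\<And>i. continuous_on slab (f' i)"
    "\<And>i j. has_pd j (f' i) (f'' i j)" "\<And>i j. continuous_on slab (f'' i j)"
proof -
  obtain f' where f': "\<And>i. has_pd i f (f' i)" "\<And>i. Ck_on (Suc 0) slab (f' i)"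
    using Ck_on_Suc_has_pd[of "Suc 0" f] assms by (auto simp: numeral_2_eq_2)
  have "\<exists>g. (\<forall>j. has_pd j (f' i) (g j)) \<and> (\<forall>j. Ck_on 0 slab (g j))" for i
    using Ck_on_Suc_has_pd[OF f'(2)] by metis
  then obtain f'' where "\<And>i j. has_pd j (f' i) (f'' i j)" "\<And>i j. Ck_on 0 slab (f'' i j)"
    by metis
  thus ?thesis using that f' Ck_on_imp_continuous_on by (metis Ck_on.simps(1))
qed

text \<open>This carries the equations of the open slab to the walls: a wall point is a limit of
  interior points along its vertical segment.\<close>

lemma eq_on_slab_if_eq_inside:
  fixes f g :: "real^3 \<Rightarrow> real"
  assumes c: "continuous_on slab f" "continuous_on slab g"
    and e: "\<And>x. 0 < x $ 3 \<Longrightarrow> x $ 3 < 1 \<Longrightarrow> f x = g x" and x: "x \<in> slab"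
  shows "f x = g x"
proof -
  have "continuous_on (closure {0<..<1}) (\<lambda>s. f (upd 3 s x) - g (upd 3 s x))"
    using continuous_on_slice[OF c(1) x, of 3] continuous_on_slice[OF c(2) x, of 3]
    by (auto simp: rng_def intro!: continuous_intros)
  hence "f (upd 3 (x $ 3) x) - g (upd 3 (x $ 3) x) = 0"
  proof (rule continuous_constant_on_closure)
    show "f (upd 3 s x) - g (upd 3 s x) = 0" if "s \<in> {0<..<1}" for s
      using e[of "upd 3 s x"] that by simp
    show "x $ 3 \<in> closure {0<..<1}" using x by (simp add: slab_def)
  qed
  thus ?thesis by simp
qed

text \<open>The substitution \<open>z = (1 + sin b) / 2\<close> makes the vertical variable run over the whole line.\<close>

lemma has_pd_mixed_eq:
  assumes f: "has_pd i f fi" "has_pd j f fj" "has_pd j fi fij" "has_pd i fj fji"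
    and c: "continuous_on slab fj" "continuous_on slab fij" "continuous_on slab fji" and i: "i \<noteq> 3" and ij: "i \<noteq> j"
    and x: "x \<in> slab"
  shows "fij x = fji x"
proof (rule eq_on_slab_if_eq_inside[OF c(2,3) _ x])
  fix x :: "real^3" assume x3: "0 < x $ 3" "x $ 3 < 1"
  hence x: "x \<in> slab" by (simp add: slab_def)
  \<comment> \<open>\<open>mixed_partials_commute\<close> wants functions on the whole plane. As
    \<open>\<rho>\<close> never leaves \<open>rng j\<close>, derivatives within the slab suffice for
    the chain rule.\<close>
  define \<rho> where "\<rho> b = (if j = 3 then (1 + sin b) / 2 else b)" for b :: real
  define \<rho>' where "\<rho>' b = (if j = 3 then cos b / 2 else 1)" for b :: real
  have d\<rho>: "(\<rho> has_real_derivative \<rho>' b) (at b)" for b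
    unfolding \<rho>_def[abs_def] \<rho>'_def by (auto intro!: derivative_eq_intros)
  have \<rho>rng: "\<rho> b \<in> rng j" for b
  proof -
    have "0 \<le> 1 + sin b" "1 + sin b \<le> 2"
      using sin_ge_minus_one[of b] sin_le_one[of b] by linarith+
    thus ?thesis by (simp add: \<rho>_def rng_def)
  qed
  have c\<rho>: "continuous_on S \<rho>" "continuous_on S \<rho>'" for S
    unfolding \<rho>_def[abs_def] \<rho>'_def[abs_def] by (cases "j = 3"; auto intro!: continuous_intros)+
  define q where "q a b = upd i a (upd j (\<rho> b) x)" for a b
  have q: "q a b \<in> slab" for a b
    unfolding q_def using i by (intro upd_in_slab x \<rho>rng) (simp add: rng_def)
  have q_alt: "q a b = upd j (\<rho> b) (upd i a x)" for a b
    unfolding q_def by (rule upd_commute[OF ij])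
  have ra: "upd i a x \<in> slab" for a using i x by (intro upd_in_slab) (auto simp: rng_def)
  have di: "((\<lambda>a. g (q a b)) has_real_derivative g' (q a b)) (at a)" if "has_pd i g g'" for g g' a b
    using has_pd_slice[OF that upd_in_slab[OF x \<rho>rng], of a b] i by (simp add: rng_def q_def)
  have dj: "((\<lambda>b. g (q a b)) has_real_derivative g' (q a b) * \<rho>' b) (at b)" if "has_pd j g g'" for g g' a b
  proof -
    have "((\<lambda>s. g (upd j s (upd i a x))) has_real_derivative g' (q a b)) (at (\<rho> b) within range \<rho>)"
      using DERIV_subset[OF has_pd_slice[OF that ra \<rho>rng]] \<rho>rng by (auto simp: q_alt image_subset_iff)
    from DERIV_image_chain[OF this d\<rho>] show ?thesis by (simp add: o_def q_alt)
  qed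
  have cq: "continuous_on UNIV (\<lambda>p. g (q (fst p) (snd p)))" if "continuous_on slab g" for g :: "real^3 \<Rightarrow> real"
    unfolding q_def
    by (rule continuous_on_compose2[OF that])
       (use q in \<open>auto simp: q_def intro!: continuous_intros continuous_on_compose2[OF c\<rho>(1)]\<close>)
  \<comment> \<open>Off the walls the substitution has nonzero derivative, so the factor
    \<open>\<rho>' b\<close> can be cancelled at the end.\<close>
  obtain b where b: "\<rho> b = x $ j" "\<rho>' b \<noteq> 0"
  proof (cases "j = 3")
    case True
    define b where "b = arcsin (2 * x $ 3 - 1)"
    have "sin b = 2 * x $ 3 - 1" "cos b \<noteq> 0"
      using x3 cos_arcsin_nonzero[of "2 * x $ 3 - 1"] by (auto simp: b_def)
    thus ?thesis using True by (intro that[of b]) (auto simp: \<rho>_def \<rho>'_def)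
  qed (auto simp: \<rho>_def \<rho>'_def intro: that)
  have "fij (q (x $ i) b) * \<rho>' b = fji (q (x $ i) b) * \<rho>' b"
  proof (rule mixed_partials_commute[where h = "\<lambda>a b. f (q a b)" and ?h1.0 = "\<lambda>a b. fi (q a b)"
        and ?h2.0 = "\<lambda>a b. fj (q a b) * \<rho>' b" and ?h12.0 = "\<lambda>a b. fij (q a b) * \<rho>' b"
        and ?h21.0 = "\<lambda>a b. fji (q a b) * \<rho>' b"])
    show "continuous_on UNIV (\<lambda>(a, b). fji (q a b) * \<rho>' b)"
      unfolding case_prod_beta
      by (intro continuous_intros cq c continuous_on_compose2[OF c\<rho>(2)]) auto
    show "continuous_on UNIV (\<lambda>b. fj (q a b) * \<rho>' b)" for a
    proof -
      have "continuous_on UNIV (\<lambda>b. (a, b))" by (intro continuous_intros)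
      from continuous_on_compose2[OF cq[OF c(1)] this] show ?thesis
        by (intro continuous_intros c\<rho>) simp
    qed
    show "((\<lambda>a. fj (q a b) * \<rho>' b) has_vector_derivative fji (q a b) * \<rho>' b) (at a)" for a b
      using DERIV_cmult_right[OF di[OF f(4)], where c = "\<rho>' b"]
      by (simp flip: has_real_derivative_iff_has_vector_derivative)
  qed (use di[OF f(1)] dj[OF f(2)] dj[OF f(3)] in \<open>auto simp flip: has_real_derivative_iff_has_vector_derivative\<close>)
  moreover have "q (x $ i) b = x" using b ij by (simp add: q_def vec_eq_iff)
  ultimately show "fij x = fji x" using b by simp
qed

text \<open>Off the walls the derivative within the slab is two-sided; this is the bridge to
  \<open>partial\<close> in the equations of the model.\<close>

lemma has_pd_inside:
  assumes f: "has_pd i f f'" and x: "0 < x $ 3" "x $ 3 < 1"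
  shows "((\<lambda>s. f (x + s *\<^sub>R axis i 1)) has_real_derivative f' x) (at 0)"
proof -
  have xs: "x \<in> slab" using x by (simp add: slab_def)
  have "((\<lambda>s. f (upd i s x)) has_real_derivative f' x) (at (x $ i) within rng i)"
    using f xs by (auto simp: has_pd_def)
  moreover have "at (x $ i) within rng i = at (x $ i)"
    using x by (cases "i = 3") (auto simp: rng_def at_within_Icc_at)
  ultimately have "((\<lambda>s. f (upd i (s + x $ i) x)) has_real_derivative f' x) (at 0)"
    using DERIV_shift[of "\<lambda>s. f (upd i s x)" "f' x" 0 "x $ i"] by simp
  thus ?thesis by (simp add: upd_def)
qed

lemma partial_inside:
  assumes "has_pd i f f'" "0 < x $ 3" "x $ 3 < 1"
  shows "partial i f x = f' x"
  unfolding partial_def using has_pd_inside[OF assms]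
  by (intro vector_derivative_at) (simp add: has_real_derivative_iff_has_vector_derivative)

lemma has_pd_inside_vec:
  fixes F :: "real^3 \<Rightarrow> real^3"
  assumes f: "\<And>k. has_pd i (\<lambda>x. F x $ k) (F' k)" and x: "0 < x $ 3" "x $ 3 < 1"
  shows "((\<lambda>s. F (x + s *\<^sub>R axis i 1)) has_vector_derivative (\<chi> k. F' k x)) (at 0)"
proof -
  have e: "v = v $ 1 *\<^sub>R axis 1 1 + v $ 2 *\<^sub>R axis 2 1 + v $ 3 *\<^sub>R axis 3 1" for v :: "real^3"
    by (simp add: vec_eq_iff forall_3 axis_def)
  have F: "F = (\<lambda>x. F x $ 1 *\<^sub>R axis 1 1 + F x $ 2 *\<^sub>R axis 2 1 + F x $ 3 *\<^sub>R axis 3 1)"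
    using e by (rule ext)
  show ?thesis
    using has_pd_inside[OF f[of 1] x] has_pd_inside[OF f[of 2] x] has_pd_inside[OF f[of 3] x]
    by (subst F, subst e[of "\<chi> k. F' k x"]) (auto intro!: derivative_eq_intros)
qed

lemma laplacian_inside:
  fixes F :: "real^3 \<Rightarrow> real^3"
  assumes f: "\<And>k i. has_pd i (\<lambda>x. F x $ k) (F' k i)" "\<And>k i j. has_pd j (F' k i) (F'' k i j)"
    and x: "0 < x $ 3" "x $ 3 < 1"
  shows "laplacian F x = (\<chi> k. F'' k 1 1 x + F'' k 2 2 x + F'' k 3 3 x)"
proof -
  have p: "partial i F y = (\<chi> k. F' k i y)" if "0 < y $ 3" "y $ 3 < 1" for i y
    unfolding partial_def by (intro vector_derivative_at has_pd_inside_vec f that)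
  have "partial i (partial i F) x = (\<chi> k. F'' k i i x)" for i
  proof -
    have d: "((\<lambda>s. \<chi> k. F' k i (x + s *\<^sub>R axis i 1)) has_vector_derivative (\<chi> k. F'' k i i x)) (at 0)"
      by (rule has_pd_inside_vec[where F = "\<lambda>x. \<chi> k. F' k i x"]) (use f x in auto)
    \<comment> \<open>The distance to the walls: the formula for the first derivative holds only
      inside, so it may be substituted only near \<open>x\<close>.\<close>
    define e where "e = min (x $ 3) (1 - x $ 3)"
    have e: "0 < e" using x by (simp add: e_def)
    have "((\<lambda>s. partial i F (x + s *\<^sub>R axis i 1)) has_vector_derivative (\<chi> k. F'' k i i x)) (at 0)"
    proof (rule has_vector_derivative_transform_within[OF d e])
      fix s :: real assume "dist s 0 < e"
      hence "0 < (x + s *\<^sub>R axis i 1) $ 3" "(x + s *\<^sub>R axis i 1) $ 3 < 1"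
        using x by (auto simp: e_def axis_def dist_real_def)
      thus "(\<chi> k. F' k i (x + s *\<^sub>R axis i 1)) = partial i F (x + s *\<^sub>R axis i 1)"
        by (simp add: p)
    qed simp
    thus ?thesis by (subst partial_def) (rule vector_derivative_at)
  qed
  thus ?thesis unfolding laplacian_def sum_3 by (simp add: vec_eq_iff)
qed

section \<open>The vertical primitive of the temperature\<close>

lemma vertical_primitive_upd: "vertical_primitive f x = integral {0..x $ 3} (\<lambda>z. f (upd 3 z x))"
proof -
  have "vector [x $ 1, x $ 2, z] = upd 3 z x" for z
    by (simp add: vec_eq_iff forall_3)
  thus ?thesis by (simp add: vertical_primitive_def)
qed

text \<open>Rescaling the integration variable by the height replaces the moving upper limit by 1,
  after which continuity in a parameter applies.\<close>

lemma continuous_on_vertical_primitive: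
  fixes f :: "real^3 \<Rightarrow> real"
  assumes f: "continuous_on slab f"
  shows "continuous_on slab (vertical_primitive f)"
proof -
  have "vertical_primitive f x = x $ 3 * integral (cbox 0 1) (\<lambda>r. f (upd 3 (x $ 3 * r) x))" if x: "x \<in> slab" for x
  proof (cases "x $ 3 = 0")
    case False
    hence p: "0 < x $ 3" using x by (auto simp: slab_def)
    have "continuous_on {0..x $ 3} (\<lambda>z. f (upd 3 z x))"
      using x by (intro continuous_on_subset[OF continuous_on_slice[OF f x]]) (auto simp: rng_def slab_def)
    hence "((\<lambda>z. f (upd 3 z x)) has_integral vertical_primitive f x) {0..x $ 3}"
      unfolding vertical_primitive_upd by (intro integrable_integral integrable_continuous_interval)
    from has_integral_stretch_real[OF this False]
    have "((\<lambda>r. f (upd 3 (x $ 3 * r) x)) has_integral (1 / x $ 3) * vertical_primitive f x) ((\<lambda>z. z / x $ 3) ` {0..x $ 3})"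
      using p by simp
    moreover have "(\<lambda>z. z / x $ 3) ` {0..x $ 3} = {0..1}"
      using p by (simp add: image_divide_atLeastAtMost)
    ultimately show ?thesis using p by (simp add: integral_unique)
  qed (simp add: vertical_primitive_upd)
  moreover have "continuous_on slab (\<lambda>x. x $ 3 * integral (cbox 0 1) (\<lambda>r. f (upd 3 (x $ 3 * r) x)))"
  proof (intro continuous_intros integral_continuous_on_param)
    show "continuous_on (slab \<times> cbox 0 1) (\<lambda>(x, r). f (upd 3 (x $ 3 * r) x))"
      unfolding case_prod_beta
      by (rule continuous_on_compose2[OF f])
         (auto intro!: continuous_intros upd_in_slab simp: rng_def slab_def mult_le_one)
  qed
  ultimately show ?thesis using continuous_on_cong by force
qed

lemma has_pd_vertical_primitive:
  assumes d: "\<And>x. x \<in> slab \<Longrightarrow> (f has_derivative D x) (at x within slab)"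
    and cD: "\<And>v. continuous_on slab (\<lambda>x. D x v)" and f: "continuous_on slab f"
  shows "has_pd i (vertical_primitive f) (if i = 3 then f else vertical_primitive (\<lambda>x. D x (axis i 1)))"
proof (cases "i = 3")
  case True
  show ?thesis unfolding has_pd_def
  proof
    fix x assume x: "x \<in> slab"
    have "((\<lambda>c. integral {0..c} (\<lambda>z. f (upd 3 z x))) has_vector_derivative f (upd 3 (x $ 3) x)) (at (x $ 3) within {0..1})"
      using x continuous_on_slice[OF f x, of 3]
      by (intro integral_has_vector_derivative) (auto simp: rng_def slab_def)
    thus "((\<lambda>s. vertical_primitive f (upd i s x)) has_real_derivative
        (if i = 3 then f else vertical_primitive (\<lambda>x. D x (axis i 1))) x) (at (x $ i) within rng i)"
      using True by (simp add: vertical_primitive_upd rng_def has_real_derivative_iff_has_vector_derivative)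
  qed
next
  case False
  show ?thesis unfolding has_pd_def
  proof
    fix x assume x: "x \<in> slab"
    have "((\<lambda>s. vertical_primitive f (x + s *\<^sub>R axis i 1)) has_real_derivative
        vertical_primitive (\<lambda>x. D x (axis i 1)) x) (at (x $ i + - x $ i))"
      using partial_vertical_primitive(1)[OF d cD False x]
      by (simp add: has_real_derivative_iff_has_vector_derivative)
    hence "((\<lambda>s. vertical_primitive f (x + (s + - x $ i) *\<^sub>R axis i 1)) has_real_derivative
        vertical_primitive (\<lambda>x. D x (axis i 1)) x) (at (x $ i))"
      by (subst (asm) DERIV_shift)
    thus "((\<lambda>s. vertical_primitive f (upd i s x)) has_real_derivative
        (if i = 3 then f else vertical_primitive (\<lambda>x. D x (axis i 1))) x) (at (x $ i) within rng i)"
      using False by (simp add: rng_def upd_def)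
  qed
qed

section \<open>The lower bound for the velocity\<close>

text \<open>This gives uniqueness of derivatives within an interval, end points included, so that
  \<open>vector_derivative\<close> denotes the actual derivative there.\<close>

lemma nontrivial_within_interval:
  fixes I :: "real set"
  assumes "is_interval I" "interior I \<noteq> {}" "t \<in> I"
  shows "at t within I \<noteq> bot"
proof -
  have "I \<noteq> {a}" for a using assms(2) by auto
  hence "t islimpt I"
    using assms by (intro connected_imp_perfect) (auto simp: is_interval_connected)
  thus ?thesis by (simp add: trivial_limit_within)
qed

text \<open>Comparing two parallel lines transfers a translation symmetry of a function to its
  derivatives.\<close>

lemma has_pd_unique:
  assumes f: "has_pd i f f'" "has_pd i g g'" and eq: "\<And>s. s \<in> rng i \<Longrightarrow> f (upd i s x) = g (upd i s y)"
    and x: "x \<in> slab" "y \<in> slab" "x $ i = y $ i"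
  shows "f' x = g' y"
proof -
  have "((\<lambda>s. g (upd i s y)) has_real_derivative g' y) (at (x $ i) within rng i)"
    using f(2) x by (auto simp: has_pd_def)
  moreover have "((\<lambda>s. g (upd i s y)) has_real_derivative f' x) (at (x $ i) within rng i)"
  proof (rule has_field_derivative_transform_within[of _ _ _ _ 1])
    show "((\<lambda>s. f (upd i s x)) has_real_derivative f' x) (at (x $ i) within rng i)"
      using f(1) x by (auto simp: has_pd_def)
  qed (use eq nth_in_rng[OF x(1)] in auto)
  moreover have "at (x $ i) within rng i \<noteq> bot"
    by (rule nontrivial_within_interval[OF _ _ nth_in_rng[OF x(1)]])
       (auto simp: rng_def is_interval_cc)
  ultimately show ?thesis
    using vector_derivative_unique_within by (metis has_real_derivative_iff_has_vector_derivative)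
qed

section \<open>Lebesgue norms, periodicity of derivatives and the time derivative of the
  energy\<close>

context periodicity_cell
begin

lemma lebesgue_integral_cell:
  fixes f :: "real^3 \<Rightarrow> real"
  assumes "continuous_on slab f"
  shows "integrable (lebesgue_on C) f" "integral\<^sup>L (lebesgue_on C) f = integral C f"
proof -
  have "continuous_on (cbox 0 (vector [Lx, Ly, 1])) f"
    using continuous_on_subset[OF assms cell_subset_slab] by (simp add: cell_cbox)
  thus i: "integrable (lebesgue_on C) f"
    unfolding cell_cbox by (rule continuous_imp_integrable)
  show "integral\<^sup>L (lebesgue_on C) f = integral C f"
    by (rule lebesgue_integral_eq_integral[OF i]) (simp add: cell_cbox)
qed

lemma periodic_imp_per:
  assumes "periodic_xy Lx Ly f" "k \<noteq> 3"
  shows "per k (\<lambda>x. h (f x))"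
  unfolding per_def
proof (intro ballI allI)
  fix x :: "real^3" and s assume x: "x \<in> slab"
  have "upd k s x \<in> slab" using x assms(2) by (intro upd_in_slab) (auto simp: rng_def)
  hence "f (upd k s x + len k *\<^sub>R axis k 1) = f (upd k s x)"
    using assms exhaust_3[of k] by (auto simp: periodic_xy_def)
  thus "h (f (upd k (s + len k) x)) = h (f (upd k s x))" by (simp add: upd_add)
qed

lemma per_has_pd:
  assumes f: "has_pd i f f'" "per k f" and k: "k \<noteq> 3"
  shows "per k f'"
  unfolding per_def
proof (intro ballI allI)
  fix x :: "real^3" and s assume x: "x \<in> slab"
  have r: "rng k = UNIV" using k by (simp add: rng_def)
  have ys: "upd k s x \<in> slab" for s using x by (intro upd_in_slab) (simp_all add: r)
  show "f' (upd k (s + len k) x) = f' (upd k s x)"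
  proof (cases "i = k")
    case True
    have e: "f (upd k (s + len k) x) = f (upd k s x)" for s using f(2) x by (simp add: per_def)
    have "((\<lambda>s. f (upd k s x)) has_real_derivative f' (upd k (s + len k) x)) (at (s + len k))"
      using has_pd_slice[OF f(1) x, of "s + len k"] r True by simp
    hence "((\<lambda>s. f (upd k s x)) has_real_derivative f' (upd k (s + len k) x)) (at s)"
      by (subst (asm) DERIV_shift) (simp add: e)
    moreover have "((\<lambda>s. f (upd k s x)) has_real_derivative f' (upd k s x)) (at s)"
      using has_pd_slice[OF f(1) x, of s] r True by simp
    ultimately show ?thesis by (rule DERIV_unique)
  next
    case False
    show ?thesis
    proof (rule has_pd_unique[OF f(1) f(1) _ ys ys])
      fix r assume "r \<in> rng i"
      hence "upd i r x \<in> slab" using x by (intro upd_in_slab)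
      thus "f (upd i r (upd k (s + len k) x)) = f (upd i r (upd k s x))"
        using f(2) False by (simp add: upd_commute[of i k] per_def)
    qed (use False in simp)
  qed
qed

lemma exact_flux_imp_avg_eq_zero:
  assumes b: "continuous_on slab b" and e: "exact_flux Lx Ly b"
  shows "avg 1 (avg 2 (\<lambda>x. b x $ 3)) 0 = 0"
proof -
  define g where "g p = - (b (vector [fst p, snd p, 0]) $ 3)" for p :: "real \<times> real"
  have v: "vector [s, r, 0] = upd 2 r (upd 1 s (0 :: real^3))" for s r
    by (simp add: vec_eq_iff forall_3)
  have cg: "continuous_on (cbox (0, 0) (Lx, Ly)) g"
    unfolding g_def v
    by (intro continuous_intros continuous_on_compose2[OF b]) (auto simp: slab_def)
  have "integral\<^sup>L (lebesgue_on ({0..Lx} \<times> {0..Ly})) (\<lambda>(x, y). (- e\<^sub>z) \<bullet> b (vector [x, y, 0]))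
      = integral\<^sup>L (lebesgue_on (cbox (0, 0) (Lx, Ly))) g"
    by (simp add: cbox_Pair_eq g_def[abs_def] e\<^sub>z_def inner_axis' case_prod_beta')
  also have "\<dots> = integral (cbox (0, 0) (Lx, Ly)) g"
    by (intro lebesgue_integral_eq_integral continuous_imp_integrable cg) simp
  also have "\<dots> = integral (cbox 0 Lx) (\<lambda>s. integral (cbox 0 Ly) (\<lambda>r. g (s, r)))"
    by (rule integral_prod_continuous[OF cg])
  also have "\<dots> = - (Lx * Ly * avg 1 (avg 2 (\<lambda>x. b x $ 3)) 0)"
    using Lx Ly by (simp add: g_def v avg_def[abs_def] slice_integral_def)
  finally show ?thesis using e Lx Ly by (simp add: exact_flux_def)
qed

lemma magnetic_energy_derivative:
  fixes B :: "real \<Rightarrow> real^3 \<Rightarrow> real^3"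
  assumes B: "Ck_on (Suc 0) (I \<times> slab) (\<lambda>(t, x). B t x)"
    and I: "is_interval I" "interior I \<noteq> {}" and t: "t \<in> I"
  obtains Bt where "continuous_on slab Bt" "\<And>x. x \<in> slab \<Longrightarrow> vector_derivative (\<lambda>s. B s x) (at t within I) = Bt x"
    "vector_derivative (\<lambda>t. magnetic_energy Lx Ly (B t)) (at t within I) = integral C (\<lambda>x. B t x \<bullet> Bt x)"
proof -
  obtain F where F: "\<And>p. p \<in> I \<times> slab \<Longrightarrow> ((\<lambda>(t, x). B t x) has_derivative F p) (at p within I \<times> slab)"
    and cF: "\<And>v. continuous_on (I \<times> slab) (\<lambda>p. F p v)"
    using B by auto
  \<comment> \<open>The joint derivative in the pure time direction; its joint continuity permits
    differentiation under the integral.\<close>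
  define Bt where "Bt s x = F (s, x) (1, 0)" for s x
  have cBt: "continuous_on (I \<times> slab) (\<lambda>p. Bt (fst p) (snd p))"
    using cF[of "(1, 0)"] by (simp add: Bt_def)
  have cB: "continuous_on (I \<times> slab) (\<lambda>p. B (fst p) (snd p))"
    using Ck_on_imp_continuous_on[OF B] by (simp add: case_prod_beta')
  have cBx: "continuous_on slab (B s)" and cBtx: "continuous_on slab (Bt s)" if "s \<in> I" for s
  proof -
    have "continuous_on slab (\<lambda>x. (s, x))" by (intro continuous_intros)
    thus "continuous_on slab (B s)" "continuous_on slab (Bt s)"
      using continuous_on_compose2[OF cB, of slab "\<lambda>x. (s, x)"] continuous_on_compose2[OF cBt, of slab "\<lambda>x. (s, x)"] that
      by auto
  qed
  have d: "((\<lambda>s. B s x) has_vector_derivative Bt s x) (at s within I)" if "s \<in> I" "x \<in> slab" for s x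
  proof -
    have "((\<lambda>s. (s, x)) has_derivative (\<lambda>h. (h, 0))) (at s within I)"
      by (auto intro!: derivative_eq_intros)
    moreover have "((\<lambda>(t, x). B t x) has_derivative F (s, x)) (at (s, x) within (\<lambda>s. (s, x)) ` I)"
      by (rule has_derivative_subset[OF F]) (use that in auto)
    ultimately have "((\<lambda>s. (\<lambda>(t, x). B t x) (s, x)) has_derivative (\<lambda>h. F (s, x) (h, 0))) (at s within I)"
      by (rule has_derivative_in_compose)
    moreover have "F (s, x) (h, 0) = h *\<^sub>R Bt s x" for h
    proof -
      have "linear (F (s, x))" using F[of "(s, x)"] that has_derivative_linear by blast
      from linear_scale[OF this, of h "(1, 0)"] show ?thesis by (simp add: Bt_def)
    qed
    ultimately show ?thesis by (simp add: has_vector_derivative_def)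
  qed
  note nt = nontrivial_within_interval[OF I t]
  have dd: "((\<lambda>s. (norm (B s x))\<^sup>2) has_vector_derivative 2 * (B s x \<bullet> Bt s x)) (at s within I)"
    if "s \<in> I" "x \<in> slab" for s x
  proof -
    have "((\<lambda>s. B s x \<bullet> B s x) has_vector_derivative (B s x \<bullet> Bt s x + Bt s x \<bullet> B s x)) (at s within I)"
      by (rule bounded_bilinear.has_vector_derivative[OF bounded_bilinear_inner d[OF that] d[OF that]])
    thus ?thesis by (simp add: power2_norm_eq_inner inner_commute)
  qed
  have "((\<lambda>s. integral C (\<lambda>x. (norm (B s x))\<^sup>2)) has_vector_derivative
      integral C (\<lambda>x. 2 * (B t x \<bullet> Bt t x))) (at t within I)"
    unfolding cell_cbox
  proof (rule leibniz_rule_vector_derivative)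
    show "(\<lambda>x. (norm (B s x))\<^sup>2) integrable_on cbox 0 (vector [Lx, Ly, 1])" if "s \<in> I" for s
      using integrable_cell[of "\<lambda>x. (norm (B s x))\<^sup>2"] cBx[OF that]
      by (simp add: cell_cbox continuous_intros)
    have sub: "I \<times> cbox 0 (vector [Lx, Ly, 1]) \<subseteq> I \<times> slab"
      using cell_subset_slab by (auto simp: cell_cbox)
    show "continuous_on (I \<times> cbox 0 (vector [Lx, Ly, 1])) (\<lambda>(s, x). 2 * (B s x \<bullet> Bt s x))"
      unfolding case_prod_beta
      by (rule continuous_on_subset[OF _ sub]) (intro continuous_intros cB cBt)
    show "convex I" using I by (simp add: is_interval_convex)
    show "((\<lambda>s. (norm (B s x))\<^sup>2) has_vector_derivative 2 * (B s x \<bullet> Bt s x)) (at s within I)"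
      if "s \<in> I" "x \<in> cbox 0 (vector [Lx, Ly, 1])" for s x
      using dd that cell_subset_slab by (auto simp: cell_cbox)
  qed (rule t)
  hence 1: "((\<lambda>s. 1/2 * integral C (\<lambda>x. (norm (B s x))\<^sup>2)) has_vector_derivative
      1/2 * integral C (\<lambda>x. 2 * (B t x \<bullet> Bt t x))) (at t within I)"
    by (rule has_vector_derivative_mult_right)
  \<comment> \<open>The two expressions are identified at times in \<open>I\<close> only, where the
    field is known to be continuous; this suffices for a derivative within \<open>I\<close>.\<close>
  have e: "magnetic_energy Lx Ly (B s) = 1/2 * integral C (\<lambda>x. (norm (B s x))\<^sup>2)" if "s \<in> I" for s
    using lebesgue_integral_cell(2)[of "\<lambda>x. (norm (B s x))\<^sup>2"] cBx[OF that]
    by (simp add: magnetic_energy_def continuous_intros)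
  have "((\<lambda>s. magnetic_energy Lx Ly (B s)) has_vector_derivative
      1/2 * integral C (\<lambda>x. 2 * (B t x \<bullet> Bt t x))) (at t within I)"
    by (rule has_vector_derivative_transform[OF t e 1])
  hence "vector_derivative (\<lambda>t. magnetic_energy Lx Ly (B t)) (at t within I) = integral C (\<lambda>x. B t x \<bullet> Bt t x)"
    using vector_derivative_within[OF nt] by force
  moreover have "vector_derivative (\<lambda>s. B s x) (at t within I) = Bt t x" if "x \<in> slab" for x
    by (rule vector_derivative_within[OF nt d[OF t that]])
  ultimately show ?thesis using that cBtx[OF t] by blast
qed

lemma Lp_norm_finite:
  assumes "continuous_on slab W" "0 < p"
  shows "Lp_norm (ereal p) C W = integral C (\<lambda>x. norm (W x) powr p) powr (1 / p)"
  using assms lebesgue_integral_cell(2)[of "\<lambda>x. norm (W x) powr p"]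
  by (simp add: Lp_norm_def continuous_on_powr' continuous_on_norm)

lemma Lp_norm_infinity_bound:
  fixes W :: "real^3 \<Rightarrow> real^3" and f :: "real^3 \<Rightarrow> real"
  assumes W: "continuous_on slab W" and f: "continuous_on slab f" "\<And>x. x \<in> slab \<Longrightarrow> 0 \<le> f x"
  shows "integral C (\<lambda>x. norm (W x) * f x) \<le> Lp_norm \<infinity> C W * integral C f"
proof -
  define M where "M = lebesgue_on C"
  define S where "S = esssup M (\<lambda>x. ereal (norm (W x)))"
  have cW: "continuous_on slab (\<lambda>x. norm (W x))" by (intro continuous_intros W)
  have spM: "space M = C" by (simp add: M_def)
  have meas: "(\<lambda>x. ereal (norm (W x))) \<in> borel_measurable M"
    using borel_measurable_integrable[OF lebesgue_integral_cell(1)[OF cW]] by (simp add: M_def)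
  \<comment> \<open>Boundedness on the compact cell makes the essential supremum finite;
    \<open>real_of_ereal\<close> would send an infinite one to 0.\<close>
  have "compact ((\<lambda>x. norm (W x)) ` C)"
    using continuous_on_subset[OF cW cell_subset_slab] by (intro compact_continuous_image) (simp_all add: cell_cbox)
  then obtain K where K: "\<And>x. x \<in> C \<Longrightarrow> norm (W x) \<le> K"
    by (meson bdd_above.E bounded_imp_bdd_above compact_imp_bounded imageI)
  have "S \<le> ereal K"
    unfolding S_def by (rule esssup_I[OF meas]) (use K in \<open>auto simp: spM intro!: AE_I2\<close>)
  hence Sfin: "S \<noteq> \<infinity>" by auto
  have "AE x in M. ereal (norm (W x)) \<le> S" unfolding S_def by (rule esssup_AE)
  hence "AE x in M. norm (W x) \<le> real_of_ereal S"
    by eventually_elim (use Sfin in \<open>cases S; auto\<close>)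
  hence AE: "AE x in M. norm (W x) * f x \<le> real_of_ereal S * f x"
    using AE_space
  proof eventually_elim
    case (elim x)
    thus ?case using f(2) cell_subset_slab by (intro mult_right_mono) (auto simp: spM)
  qed
  have "integral\<^sup>L M (\<lambda>x. norm (W x) * f x) \<le> integral\<^sup>L M (\<lambda>x. real_of_ereal S * f x)"
    unfolding M_def
    by (intro integral_mono_AE lebesgue_integral_cell continuous_intros W f AE[unfolded M_def])
  moreover have "integral\<^sup>L M (\<lambda>x. norm (W x) * f x) = integral C (\<lambda>x. norm (W x) * f x)"
    unfolding M_def by (intro lebesgue_integral_cell continuous_intros W f)
  moreover have "integral\<^sup>L M f = integral C f"
    unfolding M_def by (intro lebesgue_integral_cell f)
  ultimately show ?thesis by (simp add: Lp_norm_def S_def M_def)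
qed

text \<open>Needed because the explicit Archimedean part is identified with a continuous field on
  the slab only.\<close>

lemma Lp_norm_cong:
  fixes f g :: "real^3 \<Rightarrow> real^3"
  assumes eq: "\<And>x. x \<in> slab \<Longrightarrow> f x = g x" and g: "continuous_on slab g"
  shows "Lp_norm p C f = Lp_norm p C g"
proof -
  have eqC: "f x = g x" if "x \<in> C" for x using eq that cell_subset_slab by blast
  hence "integral\<^sup>L (lebesgue_on C) (\<lambda>x. norm (f x) powr r) = integral\<^sup>L (lebesgue_on C) (\<lambda>x. norm (g x) powr r)" for r
    by (intro Bochner_Integration.integral_cong) auto
  moreover have "esssup (lebesgue_on C) (\<lambda>x. ereal (norm (f x))) = esssup (lebesgue_on C) (\<lambda>x. ereal (norm (g x)))"
  proof (rule esssup_AE_cong)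
    show "(\<lambda>x. ereal (norm (g x))) \<in> borel_measurable (lebesgue_on C)"
      using borel_measurable_integrable[OF lebesgue_integral_cell(1)[OF continuous_on_norm[OF g]]] by simp
    thus "(\<lambda>x. ereal (norm (f x))) \<in> borel_measurable (lebesgue_on C)"
      by (rule measurable_cong[THEN iffD1, rotated]) (simp add: eqC)
  qed (auto intro!: AE_I2 simp: eqC)
  ultimately show ?thesis by (simp add: Lp_norm_def)
qed

end

section \<open>From the energy inequality to the bound on the velocity\<close>

context ferromagnetic_field
begin

lemma velocity_lower_bound:
  fixes W :: "real^3 \<Rightarrow> real^3"
  assumes W: "continuous_on slab W" and B: "x \<in> C" "B x \<noteq> 0" and Rm: "0 < Rm"
    and le: "1 / Rm * D\<^sup>2 \<le> integral C (\<lambda>x. norm (W x) * norm (B x) * norm (J x))" and p: "3 \<le> p"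
  shows "1 / Rm \<le> A_const Lx Ly p * Lp_norm p C W"
proof -
  let ?b2 = "integral C (\<lambda>x. (norm (B x))\<^sup>2)" and ?b6 = "integral C (\<lambda>x. norm (B x) ^ 6)"
  note c = continuous_intros W contB contJ
  have b2: "0 < ?b2" by (rule integral_B_sq_pos[OF B])
  have D: "0 < D"
  proof -
    have "D \<noteq> 0" using b2 poincare by auto
    thus ?thesis using D_nonneg by simp
  qed
  have CP: "0 < C\<^sub>P Lx Ly" using lambda_pos by (simp add: C\<^sub>P_def)
  have b6: "0 \<le> ?b6" by (intro integral_cell_nonneg c) auto
  have J: "sqrt (integral C (\<lambda>x. (norm (J x))\<^sup>2)) = D"
    using D_nonneg by (simp add: integral_J_sq)
  show ?thesis
  proof (cases p)
    case (real r)
    hence r: "3 \<le> r" using p by simp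
    have e6: "?b6 powr (1 / (2 * r)) \<le> (C\<^sub>S Lx Ly * D) powr (3 / r)"
    proof -
      have "?b6 powr (1 / (2 * r)) \<le> ((C\<^sub>S Lx Ly * D) ^ 6) powr (1 / (2 * r))"
        using sobolev b6 r by (intro powr_mono2) auto
      also have "\<dots> = (C\<^sub>S Lx Ly * D) powr (6 * (1 / (2 * r)))"
        using C\<^sub>S_pos D by (subst powr_powr[symmetric]) simp
      finally show ?thesis by simp
    qed
    have e2: "?b2 powr ((r - 3) / (2 * r)) \<le> (C\<^sub>P Lx Ly * D) powr ((r - 3) / r)"
    proof -
      have "?b2 powr ((r - 3) / (2 * r)) \<le> ((C\<^sub>P Lx Ly * D)\<^sup>2) powr ((r - 3) / (2 * r))"
        using poincare b2 r by (intro powr_mono2) auto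
      also have "\<dots> = (C\<^sub>P Lx Ly * D) powr (2 * ((r - 3) / (2 * r)))"
        using CP D by (subst powr_powr[symmetric]) simp
      also have "2 * ((r - 3) / (2 * r)) = (r - 3) / r" using r by (simp add: divide_simps)
      finally show ?thesis .
    qed
    have Lp: "Lp_norm p C W = integral C (\<lambda>x. norm (W x) powr r) powr (1 / r)"
      unfolding real using r by (intro Lp_norm_finite W) auto
    have Lp0: "0 \<le> Lp_norm p C W" by (simp add: Lp)
    have "1 / Rm * D\<^sup>2 \<le> Lp_norm p C W * (?b6 powr (1 / (2 * r)) * ?b2 powr ((r - 3) / (2 * r))) * D"
      using le Holder_cell[of "\<lambda>x. norm (W x)" "\<lambda>x. norm (B x)" "\<lambda>x. norm (J x)" r] b2 r
      by (simp add: Lp J c)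
    also have "\<dots> \<le> Lp_norm p C W * ((C\<^sub>S Lx Ly * D) powr (3 / r) * (C\<^sub>P Lx Ly * D) powr ((r - 3) / r)) * D"
      using e6 e2 Lp0 D by (intro mult_right_mono mult_left_mono mult_mono) auto
    also have "(C\<^sub>S Lx Ly * D) powr (3 / r) * (C\<^sub>P Lx Ly * D) powr ((r - 3) / r) =
        A_const Lx Ly p * (D powr (3 / r) * D powr ((r - 3) / r))"
      using CP C\<^sub>S_pos D by (simp add: A_const_def real powr_mult)
    \<comment> \<open>The two interpolation exponents add up to one, so together with the norm of
      the current the right-hand side is quadratic in \<open>D\<close>, like the
      dissipation.\<close>
    also have "D powr (3 / r) * D powr ((r - 3) / r) = D"
    proof -
      have "3 / r + (r - 3) / r = 1" using r by (simp add: field_simps)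
      thus ?thesis using D by (simp flip: powr_add)
    qed
    finally have "1 / Rm * D\<^sup>2 \<le> (A_const Lx Ly p * Lp_norm p C W) * D\<^sup>2"
      by (simp add: power2_eq_square mult_ac)
    thus ?thesis using D by (simp only: mult_le_cancel_right) simp
  next
    case PInf
    let ?S = "Lp_norm p C W"
    have bJ: "integral C (\<lambda>x. norm (B x) * norm (J x)) \<le> C\<^sub>P Lx Ly * D * D"
    proof -
      have "integral C (\<lambda>x. norm (B x) * norm (J x)) \<le> sqrt ?b2 * D"
        unfolding J[symmetric] by (intro Cauchy_Schwarz_cell c) auto
      also have "\<dots> \<le> sqrt ((C\<^sub>P Lx Ly * D)\<^sup>2) * D"
        using D by (intro mult_right_mono real_sqrt_le_mono poincare) auto
      finally show ?thesis using CP D by simp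
    qed
    have bJ0: "0 \<le> integral C (\<lambda>x. norm (B x) * norm (J x))"
      by (intro integral_cell_nonneg c) auto
    have 1: "1 / Rm * D\<^sup>2 \<le> ?S * integral C (\<lambda>x. norm (B x) * norm (J x))"
      using le Lp_norm_infinity_bound[OF W, of "\<lambda>x. norm (B x) * norm (J x)"]
      by (simp add: PInf c mult.assoc)
    \<comment> \<open>The sign of the essential supremum is read off from the estimate itself; it is
      needed to insert \<open>bJ\<close>.\<close>
    have "0 < 1 / Rm * D\<^sup>2" using Rm D by simp
    hence "0 < ?S * integral C (\<lambda>x. norm (B x) * norm (J x))" using 1 by linarith
    hence "0 < ?S" using bJ0 by (simp add: zero_less_mult_iff)
    hence "1 / Rm * D\<^sup>2 \<le> ?S * (C\<^sub>P Lx Ly * D * D)"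
      using 1 bJ by (meson mult_left_mono less_imp_le order_trans)
    hence "1 / Rm * D\<^sup>2 \<le> (A_const Lx Ly p * ?S) * D\<^sup>2"
      by (simp add: PInf A_const_def power2_eq_square mult_ac)
    thus ?thesis using D by (simp only: mult_le_cancel_right) simp
  qed (use p in auto)
qed

end

lemma Ck_on_2_has_pd_vec:
  fixes F :: "real^3 \<Rightarrow> real^3"
  assumes "Ck_on 2 slab F"
  obtains F' F'' where "\<And>i j. has_pd j (\<lambda>x. F x $ i) (F' i j)" "\<And>i j. continuous_on slab (F' i j)"
    "\<And>i j k. has_pd k (F' i j) (F'' i j k)" "\<And>i j k. continuous_on slab (F'' i j k)"
proof -
  have "\<exists>g h. (\<forall>j. has_pd j (\<lambda>x. F x $ i) (g j)) \<and> (\<forall>j. continuous_on slab (g j)) \<and>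
      (\<forall>j k. has_pd k (g j) (h j k)) \<and> (\<forall>j k. continuous_on slab (h j k))" for i
    using Ck_on_2_has_pd[OF Ck_on_bounded_linear[OF bounded_linear_vec_nth assms]] by metis
  then obtain F' F'' where "\<And>i. (\<forall>j. has_pd j (\<lambda>x. F x $ i) (F' i j)) \<and> (\<forall>j. continuous_on slab (F' i j)) \<and>
      (\<forall>j k. has_pd k (F' i j) (F'' i j k)) \<and> (\<forall>j k. continuous_on slab (F'' i j k))"
    by metis
  thus ?thesis by (intro that[of F' F'']) blast+
qed

lemma has_pd_second_symmetric:
  assumes f: "\<And>i. has_pd i f (f' i)" "\<And>i. continuous_on slab (f' i)"
    "\<And>i j. has_pd j (f' i) (f'' i j)" "\<And>i j. continuous_on slab (f'' i j)" and x: "x \<in> slab"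
  shows "f'' i j x = f'' j i x"
proof (cases "i = j")
  case False
  show ?thesis
  proof (cases "i = 3")
    case True
    with False have "j \<noteq> 3" by simp
    from has_pd_mixed_eq[OF f(1) f(1) f(3) f(3) f(2) f(4) f(4) this not_sym[OF False] x] show ?thesis by simp
  next
    case i: False
    from has_pd_mixed_eq[OF f(1) f(1) f(3) f(3) f(2) f(4) f(4) i False x] show ?thesis .
  qed
qed simp

lemma curl_inside:
  assumes "\<And>i j. has_pd j (\<lambda>x. F x $ i) (F' i j)" "0 < x $ 3" "x $ 3 < 1"
  shows "curl F x = vector [F' 3 2 x - F' 2 3 x, F' 1 3 x - F' 3 1 x, F' 2 1 x - F' 1 2 x]"
  by (simp add: curl_def partial_inside[OF assms])

lemma divergence_inside:
  assumes "\<And>i j. has_pd j (\<lambda>x. F x $ i) (F' i j)" "0 < x $ 3" "x $ 3 < 1"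
  shows "divergence F x = F' 1 1 x + F' 2 2 x + F' 3 3 x"
  by (simp add: divergence_def partial_inside[OF assms] sum_3)

lemma cross3_e\<^sub>z: "cross3 e\<^sub>z v = vector [- v $ 2, v $ 1, 0]" "cross3 v e\<^sub>z = vector [v $ 2, - v $ 1, 0]"
  by (simp_all add: cross3_def e\<^sub>z_def axis_def vec_eq_iff forall_3)

lemma (in periodicity_cell) per_vertical_primitive:
  assumes f: "per k f" and k: "k \<noteq> 3"
  shows "per k (vertical_primitive f)"
  unfolding per_def
proof (intro ballI allI)
  fix x :: "real^3" and s assume x: "x \<in> slab"
  have "f (upd 3 z (upd k (s + len k) x)) = f (upd 3 z (upd k s x))" if "z \<in> {0..x $ 3}" for z
  proof -
    have "upd 3 z x \<in> slab" using x that by (auto simp: slab_def)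
    thus ?thesis using f k by (simp add: per_def upd_commute[of 3 k])
  qed
  thus "vertical_primitive f (upd k (s + len k) x) = vertical_primitive f (upd k s x)"
    using k by (auto simp: vertical_primitive_upd intro!: integral_cong)
qed

theorem theorem3p4:
  fixes Lx Ly \<Lambda> Ra Rm t\<^sub>0 :: real
    and I :: "real set"
    and u B :: "real \<Rightarrow> real^3 \<Rightarrow> real^3"
    and P T :: "real \<Rightarrow> real^3 \<Rightarrow> real"
  assumes "Lx > 0" "Ly > 0" "\<Lambda> > 0" "Ra > 0" "Rm > 0"
    and "is_interval I" "interior I \<noteq> {}"
    and "taylor_solution Lx Ly \<Lambda> Ra Rm I u B P T"
    and "\<forall>t\<in>I. exact_flux Lx Ly (B t)"
    and "t\<^sub>0 \<in> I"
    and "\<exists>x\<in>cell Lx Ly. B t\<^sub>0 x \<noteq> 0"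
    and "vector_derivative (\<lambda>t. magnetic_energy Lx Ly (B t)) (at t\<^sub>0 within I) \<ge> 0"
  shows "\<forall>p::ereal. 3 \<le> p \<longrightarrow>
    A_const Lx Ly p * Lp_norm p (cell Lx Ly) (archimedean_part Ra (T t\<^sub>0)) \<ge> 1 / Rm"
proof -
  interpret periodicity_cell Lx Ly by unfold_locales fact+
  note sol = assms(8)[unfolded taylor_solution_def]
  note t0 = \<open>t\<^sub>0 \<in> I\<close>
  define b where "b = B t\<^sub>0"
  define v where "v = u t\<^sub>0"
  define q where "q = P t\<^sub>0"
  define \<theta> where "\<theta> = T t\<^sub>0"
  have smooth: "Ck_on k (I \<times> slab) (\<lambda>(t, x). u t x)" "Ck_on k (I \<times> slab) (\<lambda>(t, x). B t x)"
    "Ck_on k (I \<times> slab) (\<lambda>(t, x). P t x)" "Ck_on k (I \<times> slab) (\<lambda>(t, x). T t x)" for k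
    using sol by (auto simp: Cinf_on_def)
  have Ck: "Ck_on k slab v" "Ck_on k slab b" "Ck_on k slab q" "Ck_on k slab \<theta>" for k
    using smooth[THEN Ck_on_slice_snd, OF t0] by (simp_all add: v_def b_def q_def \<theta>_def)
  note cont = Ck[THEN Ck_on_imp_continuous_on]
  have periodic: "periodic_xy Lx Ly v" "periodic_xy Lx Ly b" "periodic_xy Lx Ly q" "periodic_xy Lx Ly \<theta>"
    using sol t0 by (auto simp: v_def b_def q_def \<theta>_def)
  have walls: "v x $ 3 = 0" "b x $ 1 = 0" "b x $ 2 = 0" if "x $ 3 = 0 \<or> x $ 3 = 1" for x
  proof -
    have *: "v x \<bullet> e\<^sub>z = 0 \<and> cross3 (b x) e\<^sub>z = 0"
      using sol t0 that by (auto simp: v_def b_def cross_minus_right)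
    thus "v x $ 3 = 0" by (simp add: e\<^sub>z_def inner_axis)
    show "b x $ 1 = 0" "b x $ 2 = 0"
      using * by (simp_all add: cross3_e\<^sub>z vec_eq_iff forall_3)
  qed

  obtain G H where GH: "\<And>i j. has_pd j (\<lambda>x. b x $ i) (G i j)" "\<And>i j. continuous_on slab (G i j)"
    "\<And>i j k. has_pd k (G i j) (H i j k)" "\<And>i j k. continuous_on slab (H i j k)"
    by (rule Ck_on_2_has_pd_vec[OF Ck(2)[of 2]]) metis
  obtain V V'' where V: "\<And>i j. has_pd j (\<lambda>x. v x $ i) (V i j)" "\<And>i j. continuous_on slab (V i j)"
    "\<And>i j k. has_pd k (V i j) (V'' i j k)" "\<And>i j k. continuous_on slab (V'' i j k)"
    by (rule Ck_on_2_has_pd_vec[OF Ck(1)[of 2]]) metis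
  obtain q' q'' where q: "\<And>i. has_pd i q (q' i)" "\<And>i. continuous_on slab (q' i)"
    "\<And>i j. has_pd j (q' i) (q'' i j)" "\<And>i j. continuous_on slab (q'' i j)"
    by (rule Ck_on_2_has_pd[OF Ck(3)[of 2]]) metis
  have cb: "continuous_on slab (\<lambda>x. b x $ i)" and cv: "continuous_on slab (\<lambda>x. v x $ i)" for i
    by (intro continuous_intros cont)+
  have perb: "per k (\<lambda>x. b x $ i)" and perv: "per k (\<lambda>x. v x $ i)" and perq: "per k q" and per\<theta>: "per k \<theta>"
    if "k \<noteq> 3" for k i
    using periodic_imp_per[OF periodic(2) that, of "\<lambda>w. w $ i"] periodic_imp_per[OF periodic(1) that, of "\<lambda>w. w $ i"]
      periodic_imp_per[OF periodic(3) that, of "\<lambda>w. w"] periodic_imp_per[OF periodic(4) that, of "\<lambda>w. w"] by auto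

  have momentum: "cross3 e\<^sub>z (v x) + gradient q x = \<Lambda> *\<^sub>R cross3 (curl b x) (b x) + (Ra * \<theta> x) *\<^sub>R e\<^sub>z"
    and div_v: "divergence v x = 0"
    and induction_eq: "vector_derivative (\<lambda>s. B s x) (at t\<^sub>0 within I) - curl (\<lambda>y. cross3 (v y) (b y)) x
        = (1 / Rm) *\<^sub>R laplacian b x"
    and div_b: "divergence b x = 0" if "0 < x $ 3" "x $ 3 < 1" for x
    using sol t0 that unfolding v_def b_def q_def \<theta>_def by blast+
  have div_V: "V 1 1 x + V 2 2 x + V 3 3 x = 0" if "x \<in> slab" for x
    by (rule eq_on_slab_if_eq_inside[OF _ _ _ that])
       (use div_v divergence_inside[OF V(1)] in \<open>auto intro!: continuous_intros V\<close>)
  have div_G: "G 1 1 x + G 2 2 x + G 3 3 x = 0" if "x \<in> slab" for x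
    by (rule eq_on_slab_if_eq_inside[OF _ _ _ that])
       (use div_b divergence_inside[OF GH(1)] in \<open>auto intro!: continuous_intros GH\<close>)

  interpret ferromagnetic_field Lx Ly b G H
  proof unfold_locales
    show "b x $ i = 0" if "i \<noteq> 3" "x $ 3 = 0 \<or> x $ 3 = 1" for i x
      using walls(2,3)[OF that(2)] that(1) exhaust_3[of i] by auto
    show "H i j k x = H i k j x" if "x \<in> slab" for i j k x
      by (rule has_pd_second_symmetric[OF GH that])
    show "avg 1 (avg 2 (\<lambda>x. b x $ 3)) 0 = 0"
      using assms(9) t0 by (intro exact_flux_imp_avg_eq_zero cont) (auto simp: b_def)
  qed (use cont GH perb per_has_pd[OF GH(1) perb] div_G in auto)

  \<comment> \<open>Cyclic successors of an index: every component of a cross product becomes a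
    single formula in \<open>i\<close>.\<close>
  define n1 :: "3 \<Rightarrow> 3" where "n1 i = (if i = 1 then 2 else if i = 2 then 3 else 1)" for i
  define n2 :: "3 \<Rightarrow> 3" where "n2 i = (if i = 1 then 3 else if i = 2 then 1 else 2)" for i
  define E where "E i x = v x $ n1 i * b x $ n2 i - v x $ n2 i * b x $ n1 i" for i x
  define E' where "E' i j x = (V (n1 i) j x * b x $ n2 i + v x $ n1 i * G (n2 i) j x)
    - (V (n2 i) j x * b x $ n1 i + v x $ n2 i * G (n1 i) j x)" for i j x
  define F where "F i x = J x $ n1 i * b x $ n2 i - J x $ n2 i * b x $ n1 i" for i x
  have cross_E: "cross3 (v x) (b x) $ i = E i x" and cross_F: "cross3 (J x) (b x) $ i = F i x" for i x
    using exhaust_3[of i] by (auto simp: E_def F_def n1_def n2_def cross3_def simp del: J_nth)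
  have E: "continuous_on slab (E i)" "has_pd j (E i) (E' i j)" "continuous_on slab (E' i j)"
    "k \<noteq> 3 \<Longrightarrow> per k (E i)" for i j k
    unfolding E_def[abs_def] E'_def[abs_def]
    by (intro continuous_intros has_pd_diff has_pd_mult per_diff per_mult cb cv GH V perb perv; assumption)+
  have cF: "continuous_on slab (F i)" for i
    unfolding F_def by (intro continuous_intros contJ cb)
  have J_curl: "curl b x = J x" if "0 < x $ 3" "x $ 3 < 1" for x
    using curl_inside[OF GH(1) that] by (simp add: J_def)

  \<comment> \<open>\<open>bc\<close>, \<open>bl\<close> and \<open>EJ\<close> stand for b . curl (v
    x b), b . laplacian b and (v x b) . J, expressed by derivatives that exist up to the
    walls.\<close>
  define bc where "bc x = b x $ 1 * (E' 3 2 x - E' 2 3 x) + b x $ 2 * (E' 1 3 x - E' 3 1 x)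
      + b x $ 3 * (E' 2 1 x - E' 1 2 x)" for x
  define bl where "bl x = b x $ 1 * (H 1 1 1 x + H 1 2 2 x + H 1 3 3 x) + b x $ 2 * (H 2 1 1 x + H 2 2 2 x + H 2 3 3 x)
      + b x $ 3 * (H 3 1 1 x + H 3 2 2 x + H 3 3 3 x)" for x
  define EJ where "EJ x = E 1 x * J x $ 1 + E 2 x * J x $ 2 + E 3 x * J x $ 3" for x
  have cbc: "continuous_on slab bc" and cbl: "continuous_on slab bl"
    unfolding bc_def bl_def by (intro continuous_intros cb E GH)+

  obtain Bt where Bt: "continuous_on slab Bt"
    "\<And>x. x \<in> slab \<Longrightarrow> vector_derivative (\<lambda>s. B s x) (at t\<^sub>0 within I) = Bt x"
    "vector_derivative (\<lambda>t. magnetic_energy Lx Ly (B t)) (at t\<^sub>0 within I) = integral C (\<lambda>x. B t\<^sub>0 x \<bullet> Bt x)"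
    using magnetic_energy_derivative[OF smooth(2)[of "Suc 0"] assms(6,7) t0] by blast
  have "b x \<bullet> Bt x = bc x + 1 / Rm * bl x" if "x \<in> slab" for x
  proof (rule eq_on_slab_if_eq_inside[OF _ _ _ that])
    fix x :: "real^3" assume x: "0 < x $ 3" "x $ 3 < 1"
    hence xs: "x \<in> slab" by (simp add: slab_def)
    have "Bt x = curl (\<lambda>y. cross3 (v y) (b y)) x + (1 / Rm) *\<^sub>R laplacian b x"
      using induction_eq[OF x] Bt(2)[OF xs] by (simp add: algebra_simps)
    also have "curl (\<lambda>y. cross3 (v y) (b y)) x = vector [E' 3 2 x - E' 2 3 x, E' 1 3 x - E' 3 1 x, E' 2 1 x - E' 1 2 x]"
      by (rule curl_inside[OF _ x]) (simp add: cross_E E)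
    also have "laplacian b x = (\<chi> k. H k 1 1 x + H k 2 2 x + H k 3 3 x)"
      by (rule laplacian_inside[OF GH(1,3) x])
    finally show "b x \<bullet> Bt x = bc x + 1 / Rm * bl x"
      by (simp add: inner_3 bc_def bl_def algebra_simps add_divide_distrib)
  qed (intro continuous_intros cont Bt cbc cbl)+
  hence "integral C (\<lambda>x. b x \<bullet> Bt x) = integral C (\<lambda>x. bc x + 1 / Rm * bl x)"
    by (rule integral_cell_cong)
  also have "\<dots> = integral C bc + 1 / Rm * integral C bl"
    using \<open>Rm > 0\<close> by (subst integral_cell_add) (auto intro!: continuous_intros cbc cbl)
  also have "integral C bc = integral C EJ"
    unfolding bc_def EJ_def by (rule integral_curl_by_parts[OF E])
  also have "integral C bl = - D\<^sup>2"
    unfolding bl_def by (rule integral_laplacian_by_parts)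
  finally have dissipation: "1 / Rm * D\<^sup>2 \<le> integral C EJ"
    using assms(12) Bt(3) by (simp add: b_def)

  obtain d where d: "\<And>x. x \<in> slab \<Longrightarrow> (\<theta> has_derivative d x) (at x within slab)" "\<And>w. continuous_on slab (\<lambda>x. d x w)"
    using Ck(4)[of "Suc 0"] by auto
  define \<tau> where "\<tau> = vertical_primitive \<theta>"
  define \<tau>' where "\<tau>' i = (if i = 3 then \<theta> else vertical_primitive (\<lambda>x. d x (axis i 1)))" for i
  have \<tau>: "continuous_on slab \<tau>" "has_pd i \<tau> (\<tau>' i)" "continuous_on slab (\<tau>' i)" "k \<noteq> 3 \<Longrightarrow> per k \<tau>" for i k
    unfolding \<tau>_def \<tau>'_def
    using has_pd_vertical_primitive[OF d cont(4)] continuous_on_vertical_primitive cont(4) d(2) per_vertical_primitive per\<theta>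
    by auto
  \<comment> \<open>This version of the Archimedean part uses derivatives valid on the closed slab,
    which makes its continuity there evident.\<close>
  define W where "W x = Ra *\<^sub>R (vector [- \<tau>' 2 x, \<tau>' 1 x, 0] :: real^3)" for x
  have W_nth: "W x $ 1 = - (Ra * \<tau>' 2 x)" "W x $ 2 = Ra * \<tau>' 1 x" "W x $ 3 = 0" for x
    by (simp_all add: W_def)
  have W_alt: "W = (\<lambda>x. (- (Ra * \<tau>' 2 x)) *\<^sub>R axis 1 1 + (Ra * \<tau>' 1 x) *\<^sub>R axis 2 1)"
    by (rule ext) (simp add: W_nth vec_eq_iff forall_3 axis_def)
  have cW: "continuous_on slab W"
    unfolding W_alt by (intro continuous_intros \<tau>)
  have W_arch: "archimedean_part Ra \<theta> x = W x" if "x \<in> slab" for x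
    using partial_vertical_primitive(2)[OF d(1) d(2) _ that, of 1] partial_vertical_primitive(2)[OF d(1) d(2) _ that, of 2]
    by (simp add: archimedean_part_def W_def \<tau>'_def)

  have balance: "\<Lambda> * F 1 x = - v x $ 2 + q' 1 x" "\<Lambda> * F 2 x = v x $ 1 + q' 2 x" "\<Lambda> * F 3 x = q' 3 x - Ra * \<theta> x"
    if "0 < x $ 3" "x $ 3 < 1" for x
  proof -
    have "cross3 e\<^sub>z (v x) $ i + q' i x = \<Lambda> * F i x + Ra * \<theta> x * e\<^sub>z $ i" for i
      using arg_cong[OF momentum[OF that], of "\<lambda>w. w $ i"]
      by (simp add: gradient_def partial_inside[OF q(1) that] J_curl[OF that] cross_F)
    from this[of 1] this[of 2] this[of 3]
    show "\<Lambda> * F 1 x = - v x $ 2 + q' 1 x" "\<Lambda> * F 2 x = v x $ 1 + q' 2 x" "\<Lambda> * F 3 x = q' 3 x - Ra * \<theta> x"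
      by (simp_all add: cross3_e\<^sub>z) (simp_all add: e\<^sub>z_def axis_def)
  qed
  have work: "integral C (\<lambda>x. v x $ 1 * F 1 x + v x $ 2 * F 2 x + v x $ 3 * F 3 x)
    = integral C (\<lambda>x. - (Ra * \<tau>' 2 x) * F 1 x + Ra * \<tau>' 1 x * F 2 x)"
  proof (rule integral_lorentz_work[where U = "\<lambda>i x. v x $ i" and U' = V and P = q and P' = q' and P'' = q''
        and \<tau> = \<tau> and \<tau>' = \<tau>' and L = \<Lambda>])
    \<comment> \<open>The term \<open>Ra * \<tau>' 1 x\<close> is inserted twice with opposite
      signs, to exhibit v - W in the rotation and P - Ra \<open>\<tau>\<close> in the
      pressure.\<close>
    show "\<Lambda> * F 1 x = - (v x $ 2 - Ra * \<tau>' 1 x) + (q' 1 x - Ra * \<tau>' 1 x)" if "x \<in> slab" for x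
      by (rule eq_on_slab_if_eq_inside[OF _ _ _ that])
         (use balance(1) in \<open>auto intro!: continuous_intros cF cv q \<tau>\<close>)
    show "\<Lambda> * F 2 x = (v x $ 1 + Ra * \<tau>' 2 x) + (q' 2 x - Ra * \<tau>' 2 x)" if "x \<in> slab" for x
      by (rule eq_on_slab_if_eq_inside[OF _ _ _ that])
         (use balance(2) in \<open>auto intro!: continuous_intros cF cv q \<tau>\<close>)
    show "\<Lambda> * F 3 x = q' 3 x - Ra * \<tau>' 3 x" if "x \<in> slab" for x
      by (rule eq_on_slab_if_eq_inside[OF _ _ _ that])
         (use balance(3) in \<open>auto simp: \<tau>'_def intro!: continuous_intros cF q cont\<close>)
    show "q'' 1 2 x = q'' 2 1 x" if "x \<in> slab" for x
      by (rule has_pd_second_symmetric[OF q that])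
  qed (use \<open>\<Lambda> > 0\<close> cv V perv walls div_V cont q perq per_has_pd[OF q(1) perq] \<tau> cF in auto)

  have "1 / Rm * D\<^sup>2 \<le> integral C (\<lambda>x. norm (W x) * norm (b x) * norm (J x))"
  proof -
    \<comment> \<open>Scalar triple product: (v x b) . J = - v . (J x b), so the induction term is
      minus the work of the Lorentz force on the velocity.\<close>
    have "integral C EJ = integral C (\<lambda>x. - (v x $ 1 * F 1 x + v x $ 2 * F 2 x + v x $ 3 * F 3 x))"
      by (rule integral_cell_cong) (simp add: EJ_def E_def F_def n1_def n2_def algebra_simps)
    also have "\<dots> = integral C (\<lambda>x. - (W x \<bullet> cross3 (J x) (b x)))"
      unfolding integral_neg work by (simp add: inner_3 W_nth cross_F)
    also have "\<dots> \<le> integral C (\<lambda>x. norm (W x) * norm (b x) * norm (J x))"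
    proof (rule integral_cell_mono)
      fix x
      have "(norm (cross3 (J x) (b x)))\<^sup>2 \<le> (norm (J x) * norm (b x))\<^sup>2"
        using norm_cross_dot[of "J x" "b x"] by (metis le_add_same_cancel1 zero_le_power2)
      hence "norm (cross3 (J x) (b x)) \<le> norm (J x) * norm (b x)"
        by (rule power2_le_imp_le) simp
      hence "norm (W x) * norm (cross3 (J x) (b x)) \<le> norm (W x) * (norm (J x) * norm (b x))"
        by (rule mult_left_mono) simp
      thus "- (W x \<bullet> cross3 (J x) (b x)) \<le> norm (W x) * norm (b x) * norm (J x)"
        using Cauchy_Schwarz_ineq2[of "W x" "cross3 (J x) (b x)"] by (simp add: mult_ac)
    next
      show "continuous_on slab (\<lambda>x. - (W x \<bullet> cross3 (J x) (b x)))"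
        unfolding inner_3 cross_F by (intro continuous_intros cW cF)
    qed (intro continuous_intros cW cont contJ)
    finally show ?thesis using dissipation by simp
  qed
  moreover obtain x where "x \<in> C" "b x \<noteq> 0" using assms(11) by (auto simp: b_def)
  ultimately have "1 / Rm \<le> A_const Lx Ly p * Lp_norm p C W" if "3 \<le> p" for p
    using velocity_lower_bound[OF cW _ _ \<open>Rm > 0\<close> _ that] by blast
  thus ?thesis using Lp_norm_cong[OF W_arch cW] by (simp add: \<theta>_def)
qed

end
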